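(* For each $n\ge 1$ let $G_n$ be a random simple graph on the vertex set $[n]$, sampled according to some probability distribution over the set of all simple graphs on $[n]$, with $|E(G_n)|\to\infty$ in probability. Let $c\ge 2$ be a fixed integer, and let $N(G_n)$ be the number of monochromatic edges when the vertices of $G_n$ are colored independently and uniformly at random with $c$ colors (independently of $G_n$). Then $$\frac{1}{\sqrt{|E(G_n)|/c}}\left(N(G_n)-\frac{|E(G_n)|}{c}\right)\to N\left(0,1-\frac1c\right)$$ in distribution as $n\to\infty$ if and only if $\{G_n\}_{n\ge1}$ satisfies the ACF4 condition in probability, i.e. $N(G_n,C_4)/|E(G_n)|^2\to 0$ in probability.
   Context: $[n]=\{1,\dots,n\}$; $E(G_n)$ is the edge set of $G_n$. The colors $Y_1,\dots,Y_n$ of the vertices are i.i.d. uniform on $\{1,\dots,c\}$ and independent of $G_n$, and $N(G_n)=\sum_{(i,j)\in E(G_n)}\mathbf{1}\{Y_i=Y_j\}$. $C_4$ is the cycle of length 4, and $N(G_n,C_4)$ is the number of (not necessarily induced) subgraphs of $G_n$ isomorphic to $C_4$. Quotients are defined when $|E(G_n)|>0$, an event of probability tending to $1$. *)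

theory Defs
  imports "HOL-Probability.Probability"
begin

type_synonym 'a graph = "'a set \<times> 'a set set"

abbreviation verts :: "'a graph \<Rightarrow> 'a set" where "verts \<equiv> fst"
abbreviation edges :: "'a graph \<Rightarrow> 'a set set" where "edges \<equiv> snd"

definition simple_graph :: "'a graph \<Rightarrow> bool" where
  "simple_graph G \<longleftrightarrow> (\<forall>e\<in>edges G. e \<subseteq> verts G \<and> card e = 2)"

definition simple_graphs_on :: "'a set \<Rightarrow> 'a graph set" where
  "simple_graphs_on V = {G. simple_graph G \<and> verts G = V}"

definition subgraph :: "'a graph \<Rightarrow> 'a graph \<Rightarrow> bool" where
  "subgraph H G \<longleftrightarrow> simple_graph H \<and> verts H \<subseteq> verts G \<and> edges H \<subseteq> edges G"

definition graph_isomorphic :: "'a graph \<Rightarrow> 'b graph \<Rightarrow> bool" where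
  "graph_isomorphic G H \<longleftrightarrow>
     (\<exists>f. bij_betw f (verts G) (verts H) \<and>
        (\<forall>u\<in>verts G. \<forall>v\<in>verts G. {u, v} \<in> edges G \<longleftrightarrow> {f u, f v} \<in> edges H))"

text \<open>The cycle on \<open>k\<close> vertices, for \<open>k \<ge> 3\<close>.\<close>

definition cycle_graph :: "nat \<Rightarrow> nat graph" where
  "cycle_graph k = ({0..<k}, {{i, (i + 1) mod k} | i. i < k})"

text \<open>Subgraphs are counted as subgraphs, neither as embeddings nor only the induced ones.\<close>

definition subgraph_count :: "'a graph \<Rightarrow> 'b graph \<Rightarrow> nat" where
  "subgraph_count G F = card {H. subgraph H G \<and> graph_isomorphic H F}"

definition mono_edges :: "'a graph \<Rightarrow> ('a \<Rightarrow> nat) \<Rightarrow> nat" where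
  "mono_edges G y = card {e \<in> edges G. \<forall>i\<in>e. \<forall>j\<in>e. y i = y j}"

text \<open>Independent uniform colors of the vertices \<open>1, \<dots>, n\<close>; the value \<open>0\<close> outside of
  \<open>{1..n}\<close> is a dummy that no edge sees.\<close>

definition coloring_pmf :: "nat \<Rightarrow> nat \<Rightarrow> (nat \<Rightarrow> nat) pmf" where
  "coloring_pmf c n = Pi_pmf {1..n} 0 (\<lambda>_. pmf_of_set {1..c})"

text \<open>Convergence in probability is stated for a sequence of laws, each with its own
  random variable, since the random graphs need not live on a common probability space.\<close>

definition tendsto_zero_in_prob :: "(nat \<Rightarrow> 'a pmf) \<Rightarrow> ('a \<Rightarrow> real) \<Rightarrow> bool" where
  "tendsto_zero_in_prob P X \<longleftrightarrow>
     (\<forall>\<epsilon>>0. (\<lambda>n. measure_pmf.prob (P n) {\<omega>. \<bar>X \<omega>\<bar> > \<epsilon>}) \<longlonglongrightarrow> 0)"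

definition tendsto_infinity_in_prob :: "(nat \<Rightarrow> 'a pmf) \<Rightarrow> ('a \<Rightarrow> real) \<Rightarrow> bool" where
  "tendsto_infinity_in_prob P X \<longleftrightarrow>
     (\<forall>K. (\<lambda>n. measure_pmf.prob (P n) {\<omega>. X \<omega> > K}) \<longlonglongrightarrow> 1)"

text \<open>Both quotients below take the value \<open>0\<close> on the edgeless graph (division by zero). That
  event has vanishing probability when the number of edges tends to infinity in probability,
  so the convention does not affect any limit.\<close>

definition ACF4_in_prob :: "(nat \<Rightarrow> nat graph pmf) \<Rightarrow> bool" where
  "ACF4_in_prob G \<longleftrightarrow>
     tendsto_zero_in_prob G
       (\<lambda>H. real (subgraph_count H (cycle_graph 4)) / (real (card (edges H)))\<^sup>2)"

definition normalized_mono_edges :: "nat \<Rightarrow> 'a graph \<Rightarrow> ('a \<Rightarrow> nat) \<Rightarrow> real" where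
  "normalized_mono_edges c H y =
     1 / sqrt (real (card (edges H)) / real c)
       * (real (mono_edges H y) - real (card (edges H)) / real c)"

text \<open>The product \<open>pair_pmf\<close> encodes that the coloring is independent of the graph.\<close>

definition normalized_mono_edges_law :: "nat \<Rightarrow> (nat \<Rightarrow> nat graph pmf) \<Rightarrow> nat \<Rightarrow> real measure" where
  "normalized_mono_edges_law c G n =
     distr (measure_pmf (pair_pmf (G n) (coloring_pmf c n))) borel
       (\<lambda>(H, y). normalized_mono_edges c H y)"

text \<open>Parametrized by the variance, whereas \<^const>\<open>normal_density\<close> takes the standard
  deviation.\<close>

definition normal_law :: "real \<Rightarrow> real \<Rightarrow> real measure" where
  "normal_law \<mu> v = density lborel (\<lambda>x. ennreal (normal_density \<mu> (sqrt v) x))"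

end

theory Submission imports Defs begin

text \<open>
  Fix a graph with \<open>m\<close> edges and put \<open>K(a, b) = [a = b] - 1/c\<close> for colors \<open>a, b\<close>. Then
  \<open>N - m/c\<close> is the sum of \<open>K(Y\<^sub>i, Y\<^sub>j)\<close> over the edges \<open>ij\<close>, and \<open>K\<close> is degenerate: averaging over
  one of its two arguments gives \<open>0\<close>. Recoloring a single vertex uniformly at random preserves the
  law of the coloring (\<open>color_exp_recolor_avg\<close>); averaging over such recolorings plays the role
  of a conditional expectation in every argument below.

  Few four-cycles imply normality. Reveal the colors vertex by vertex. The edges from the
  \<open>k\<close>-th vertex back to earlier ones contribute a martingale difference \<open>h\<^sub>k\<close>, a sum of \<open>d\<^sub>k\<close> kernels.
  The sum of the conditional variances is a constant plus a combination of the \<open>K(Y\<^sub>i, Y\<^sub>j)\<close>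
  whose coefficients are codegrees \<open>m\<^sub>i\<^sub>j\<close> of pairs, so its variance is of order
  \<open>\<Sum> m\<^sub>i\<^sub>j\<^sup>2 / m\<^sup>2\<close>, and \<open>\<Sum> m\<^sub>i\<^sub>j\<^sup>2\<close> is at most the number of labelled four-cycles plus \<open>\<Sum> d\<^sub>k\<^sup>2\<close>.
  The last sum would be of order \<open>m\<^sup>2\<close> for a star whose center comes last; but if the vertices are
  ordered by decreasing degree, then \<open>d\<^sub>k \<le> sqrt (2 m)\<close> and the sum is \<open>O(m sqrt m)\<close>. The fourth
  moments of the \<open>h\<^sub>k\<close> are of order \<open>d\<^sub>k\<^sup>2\<close> and are negligible for the same reason. A quantitative
  martingale central limit theorem (\<open>martingale_clt_bound\<close>) turns this into a bound on
  the characteristic function of the normalized count in terms of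
  \<open>N(G, C\<^sub>4)/m\<^sup>2 + 1/sqrt m\<close> alone (\<open>char_normalized_mono_edges\<close>), which can be averaged over
  the random graph; the continuity theorem of Levy concludes.

  Normality implies few four-cycles. Expand the fourth moment of the edge sum over quadruples of
  edges. Every term is nonnegative, because \<open>K\<close> is a nonnegative combination of characters of
  \<open>\<int>/c\<close> and the mean of a character is \<open>0\<close> or \<open>1\<close> (\<open>color_exp_edge_kerns_nonneg\<close>). The quadruples
  that pair up two distinct edges yield, after normalization, the Gaussian value
  \<open>3 (1 - 1/c)\<^sup>2 (1 - 1/m)\<close>, and those that run around a four-cycle yield a positive multiple of
  \<open>N(G, C\<^sub>4)/m\<^sup>2\<close> (\<open>fourth_moment_normalized_ge\<close>). On the other hand the sixth moment is bounded
  uniformly over all graphs (\<open>sixth_moment_normalized_mono_edges\<close>), so that under weak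
  convergence the fourth moments cannot exceed \<open>3 (1 - 1/c)\<^sup>2\<close> in the limit. Hence the mean
  of \<open>N(G, C\<^sub>4)/m\<^sup>2\<close> tends to \<open>0\<close>, and the inequality of Markov gives convergence in probability.
\<close>

(* Keeps the intervals {1..n} of vertices and {1..c} of colors in this form. *)
declare One_nat_def [simp del]

section \<open>Random colorings and recoloring of one vertex\<close>

text \<open>
  The average of \<open>F\<close> over the colors of \<open>x\<close>, the other colors being kept: the conditional
  expectation of \<open>F\<close> given the colors of all vertices except \<open>x\<close>.
\<close>

definition recolor_avg ::
  "nat \<Rightarrow> nat \<Rightarrow> ((nat \<Rightarrow> nat) \<Rightarrow> 'b) \<Rightarrow> (nat \<Rightarrow> nat) \<Rightarrow> 'b::{banach, second_countable_topology}" where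
  "recolor_avg c x F y = (\<Sum>a\<in>{1..c}. F (y(x := a))) /\<^sub>R real c"

abbreviation color_exp ::
  "nat \<Rightarrow> nat \<Rightarrow> ((nat \<Rightarrow> nat) \<Rightarrow> 'b) \<Rightarrow> 'b::{banach, second_countable_topology}" where
  "color_exp c n F \<equiv> measure_pmf.expectation (coloring_pmf c n) F"

lemma set_coloring_pmf:
  assumes "c \<ge> 1"
  shows "set_pmf (coloring_pmf c n) = PiE_dflt {1..n} 0 (\<lambda>_. {1..c})"
  using assms by (simp add: coloring_pmf_def set_Pi_pmf set_pmf_of_set PiE_dflt_def)

lemma coloring_color:
  assumes "c \<ge> 1" "y \<in> set_pmf (coloring_pmf c n)" "v \<in> {1..n}"
  shows "y v \<in> {1..c}"
  using assms by (auto simp: set_coloring_pmf PiE_dflt_def)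

lemma finite_set_coloring_pmf:
  assumes "c \<ge> 1" shows "finite (set_pmf (coloring_pmf c n))"
  using assms by (auto simp: set_coloring_pmf intro!: finite_PiE_dflt)

lemma integrable_coloring [simp]:
  assumes "c \<ge> 1" shows "integrable (measure_pmf (coloring_pmf c n)) (F :: _ \<Rightarrow> 'b::{banach, second_countable_topology})"
  using finite_set_coloring_pmf[OF assms] by (rule integrable_measure_pmf_finite)

lemma color_exp_cong:
  assumes "\<And>y. y \<in> set_pmf (coloring_pmf c n) \<Longrightarrow> F y = F' y"
  shows "color_exp c n F = color_exp c n F'"
  by (intro integral_cong_AE) (auto simp: AE_measure_pmf_iff assms)

lemma color_exp_mono:
  fixes F :: "_ \<Rightarrow> real"
  assumes "c \<ge> 1" "\<And>y. y \<in> set_pmf (coloring_pmf c n) \<Longrightarrow> F y \<le> F' y"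
  shows "color_exp c n F \<le> color_exp c n F'"
  using assms by (intro integral_mono_AE) (auto simp: AE_measure_pmf_iff)

lemma color_exp_nonneg:
  fixes F :: "_ \<Rightarrow> real"
  assumes "\<And>y. y \<in> set_pmf (coloring_pmf c n) \<Longrightarrow> 0 \<le> F y"
  shows "0 \<le> color_exp c n F"
  using assms by (intro integral_nonneg_AE) (auto simp: AE_measure_pmf_iff)

lemma color_exp_add:
  assumes "c \<ge> 1" shows "color_exp c n (\<lambda>y. F y + F' y) = color_exp c n F + color_exp c n F'"
  using assms by simp

lemma color_exp_diff:
  assumes "c \<ge> 1" shows "color_exp c n (\<lambda>y. F y - F' y) = color_exp c n F - color_exp c n F'"
  using assms by simp

lemma color_exp_sum:
  assumes "c \<ge> 1" shows "color_exp c n (\<lambda>y. \<Sum>i\<in>I. F i y) = (\<Sum>i\<in>I. color_exp c n (F i))"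
  using assms by simp

lemma norm_color_exp_le:
  assumes "c \<ge> 1" "\<And>y. y \<in> set_pmf (coloring_pmf c n) \<Longrightarrow> norm (F y) \<le> H y"
  shows "norm (color_exp c n F) \<le> color_exp c n H"
  by (rule order.trans[OF integral_norm_bound color_exp_mono]) (use assms in auto)

text \<open>
  The variance of \<open>\<bar>F\<bar>\<close> is nonnegative.
\<close>

lemma color_exp_abs_squared_le:
  assumes c: "c \<ge> 1"
  shows "(color_exp c n (\<lambda>y. \<bar>F y\<bar> :: real))\<^sup>2 \<le> color_exp c n (\<lambda>y. (F y)\<^sup>2)"
proof -
  define m where "m = color_exp c n (\<lambda>y. \<bar>F y\<bar>)"
  have "0 \<le> color_exp c n (\<lambda>y. (\<bar>F y\<bar> - m)\<^sup>2)" by (rule color_exp_nonneg) simp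
  also have "(\<lambda>y. (\<bar>F y\<bar> - m)\<^sup>2) = (\<lambda>y. (F y)\<^sup>2 + m\<^sup>2 - (2 * m) * \<bar>F y\<bar>)"
    by (rule ext) (simp add: power2_diff)
  also have "color_exp c n \<dots> = color_exp c n (\<lambda>y. (F y)\<^sup>2) + m\<^sup>2 - (2 * m) * m"
    by (simp only: color_exp_diff[OF c] color_exp_add[OF c] integral_mult_right_zero m_def) simp
  finally show ?thesis by (simp add: m_def power2_eq_square)
qed

text \<open>
  The tower property: the color of \<open>x\<close> is independent of the other colors and uniform.
\<close>

lemma color_exp_recolor_avg:
  assumes c: "c \<ge> 1" and x: "x \<in> {1..n}"
  shows "color_exp c n (recolor_avg c x F) = color_exp c n F"
proof -
  let ?B = "{1..n} - {x}"
  let ?P = "Pi_pmf ?B 0 (\<lambda>_. pmf_of_set {1..c})"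
  have ne: "{1..c} \<noteq> {}" "finite {1..c}" using c by auto
  have eq: "coloring_pmf c n = bind_pmf (pmf_of_set {1..c}) (\<lambda>a. map_pmf (\<lambda>f. f(x := a)) ?P)"
  proof -
    have "coloring_pmf c n = Pi_pmf (insert x ?B) 0 (\<lambda>_. pmf_of_set {1..c})"
      using x by (simp add: coloring_pmf_def insert_absorb)
    then show ?thesis by (subst (asm) Pi_pmf_insert') (auto simp: map_pmf_def)
  qed
  have fin: "finite (set_pmf ?P)"
    by (subst set_Pi_pmf) (use ne in \<open>auto intro!: finite_PiE_dflt\<close>)
  have gen: "color_exp c n H = (\<Sum>a\<in>{1..c}. measure_pmf.expectation ?P (\<lambda>f. H (f(x := a))) /\<^sub>R real c)"
    for H :: "_ \<Rightarrow> 'a"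
    unfolding eq using ne fin by (subst pmf_expectation_bind_pmf_of_set) auto
  have "color_exp c n (recolor_avg c x F) =
      (\<Sum>a\<in>{1..c}. measure_pmf.expectation ?P (\<lambda>f. \<Sum>b\<in>{1..c}. F (f(x := b)) /\<^sub>R real c) /\<^sub>R real c)"
    unfolding gen recolor_avg_def by (simp add: scaleR_sum_right)
  also have "\<dots> = measure_pmf.expectation ?P (\<lambda>f. \<Sum>b\<in>{1..c}. F (f(x := b)) /\<^sub>R real c)"
    using c by (simp add: sum_constant_scaleR del: sum_constant)
  also have "\<dots> = color_exp c n F"
    unfolding gen by (subst Bochner_Integration.integral_sum) (auto intro!: integrable_measure_pmf_finite[OF fin])
  finally show ?thesis .
qed

lemma color_exp_eq_0I:
  assumes "c \<ge> 1" "x \<in> {1..n}" "\<And>y. recolor_avg c x F y = 0"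
  shows "color_exp c n F = 0"
proof -
  have "recolor_avg c x F = (\<lambda>y. 0)" using assms(3) by (rule ext)
  then show ?thesis using color_exp_recolor_avg[OF assms(1,2), of F] by simp
qed

lemma recolor_avg_mult:
  fixes F :: "(nat \<Rightarrow> nat) \<Rightarrow> 'b::{banach, second_countable_topology, real_normed_algebra}"
  assumes "\<And>a. F (y(x := a)) = F y"
  shows "recolor_avg c x (\<lambda>y. F y * H y) y = F y * recolor_avg c x H y"
  by (simp add: recolor_avg_def assms sum_distrib_left)

lemma recolor_avg_const:
  assumes "c \<ge> 1" "\<And>a. F (y(x := a)) = F y"
  shows "recolor_avg c x F y = F y"
  using assms by (simp add: recolor_avg_def sum_constant_scaleR del: sum_constant)

lemma recolor_avg_add: "recolor_avg c x (\<lambda>y. F y + H y) y = recolor_avg c x F y + recolor_avg c x H y"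
  by (simp add: recolor_avg_def sum.distrib scaleR_add_right)

lemma recolor_avg_sum: "recolor_avg c x (\<lambda>y. \<Sum>i\<in>I. F i y) y = (\<Sum>i\<in>I. recolor_avg c x (F i) y)"
  by (simp add: recolor_avg_def scaleR_sum_right) (rule sum.swap)

lemma recolor_avg_idem: "recolor_avg c x F (y(x := a)) = recolor_avg c x F y"
  by (simp add: recolor_avg_def)

lemma recolor_avg_other:
  assumes "z \<noteq> x" "\<And>y. F (y(z := a)) = F y"
  shows "recolor_avg c x F (y(z := a)) = recolor_avg c x F y"
proof -
  have "F (y(z := a, x := b)) = F (y(x := b))" for b
    using assms(2)[of "y(x := b)"] assms(1) by (simp add: fun_upd_twist)
  then show ?thesis by (simp add: recolor_avg_def)
qed

lemma norm_recolor_avg_le: "norm (recolor_avg c x F y) \<le> recolor_avg c x (\<lambda>y. norm (F y)) y"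
  by (simp add: recolor_avg_def mult_left_mono norm_sum)

lemma recolor_avg_mono:
  fixes F :: "_ \<Rightarrow> real"
  assumes "\<And>a. F (y(x := a)) \<le> H (y(x := a))"
  shows "recolor_avg c x F y \<le> recolor_avg c x H y"
  using assms by (auto simp: recolor_avg_def intro!: mult_left_mono sum_mono)

lemma recolor_avg_cmult: "recolor_avg c x (\<lambda>y. k * F y) y = (k::'b::{banach, second_countable_topology, real_normed_algebra}) * recolor_avg c x F y"
  by (simp add: recolor_avg_def sum_distrib_left)

lemma recolor_avg_squared_le:
  "(recolor_avg c x F y)\<^sup>2 \<le> recolor_avg c x (\<lambda>y. (F y :: real)\<^sup>2) y"
proof (cases "c = 0")
  case False
  have "(\<Sum>a\<in>{1..c}. F (y(x := a)))\<^sup>2 \<le> real c * (\<Sum>a\<in>{1..c}. (F (y(x := a)))\<^sup>2)"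
    using sum_squared_le_sum_of_squares[of "\<lambda>a. F (y(x := a))" "{1..c}"] by (simp add: mult.commute)
  then show ?thesis using False
    by (simp add: recolor_avg_def power_mult_distrib field_simps power2_eq_square)
qed (simp add: recolor_avg_def)

text \<open>
  Condition on all colors but that of \<open>x\<close>: the factor \<open>F\<close> is then a constant, and \<open>H\<close> has
  conditional mean \<open>0\<close>.
\<close>

lemma color_exp_orthogonal:
  fixes F :: "(nat \<Rightarrow> nat) \<Rightarrow> 'b::{banach, second_countable_topology, real_normed_algebra}"
  assumes "c \<ge> 1" "x \<in> {1..n}" "\<And>y a. F (y(x := a)) = F y" "\<And>y. recolor_avg c x H y = 0"
  shows "color_exp c n (\<lambda>y. F y * H y) = 0"
  using assms by (intro color_exp_eq_0I[of c x]) (auto simp: recolor_avg_mult)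

section \<open>The degenerate kernel of an edge\<close>

text \<open>
  The case distinction makes the kernel vanish for colors outside of \<open>{1..c}\<close>. With this
  convention it is degenerate and reproduces itself (\<open>sum_kern\<close>, \<open>sum_kern_kern\<close>) for arbitrary
  arguments, hence for arbitrary functions \<open>y\<close> and not only for colorings.
\<close>

definition kern :: "nat \<Rightarrow> nat \<Rightarrow> nat \<Rightarrow> real" where
  "kern c a b = (if a \<in> {1..c} \<and> b \<in> {1..c} then (if a = b then 1 else 0) - 1 / real c else 0)"

lemma kern_commute: "kern c a b = kern c b a"
  by (auto simp: kern_def)

lemma abs_kern_le_1: "c \<ge> 1 \<Longrightarrow> \<bar>kern c a b\<bar> \<le> 1"
  by (auto simp: kern_def field_simps)

lemma sum_kern: "(\<Sum>a\<in>{1..c}. kern c a b) = 0"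
proof (cases "b \<in> {1..c}")
  case True
  then have "(\<Sum>a\<in>{1..c}. kern c a b) = (\<Sum>a\<in>{1..c}. (if a = b then 1 else 0) - 1 / real c)"
    by (intro sum.cong) (auto simp: kern_def)
  also have "\<dots> = 0" using True by (simp add: sum_subtractf)
  finally show ?thesis .
qed (auto simp: kern_def intro!: sum.neutral)

text \<open>
  As an operator on functions of a color, \<open>kern\<close> is the projection onto the functions of
  mean \<open>0\<close>; this is its idempotence.
\<close>

lemma sum_kern_kern: "(\<Sum>x\<in>{1..c}. kern c x a * kern c x b) = kern c a b"
proof (cases "a \<in> {1..c} \<and> b \<in> {1..c}")
  case True
  then have "(\<Sum>x\<in>{1..c}. kern c x a * kern c x b)
      = (\<Sum>x\<in>{1..c}. (if x = a then kern c x b else 0) - 1 / real c * kern c x b)"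
    by (intro sum.cong) (auto simp: kern_def algebra_simps)
  also have "\<dots> = kern c a b"
    using True sum_kern[of c b] by (simp add: sum_subtractf flip: sum_distrib_left sum_divide_distrib)
  finally show ?thesis .
next
  case False
  then have "kern c x a * kern c x b = 0" for x by (auto simp: kern_def)
  then show ?thesis using False by (auto simp: kern_def)
qed

lemma recolor_avg_kern: "u \<noteq> w \<Longrightarrow> recolor_avg c u (\<lambda>y. kern c (y u) (y w)) y = 0"
  by (simp add: recolor_avg_def sum_kern)

lemma recolor_avg_kern_kern:
  assumes "u \<noteq> w" "u \<noteq> w'"
  shows "recolor_avg c u (\<lambda>y. kern c (y u) (y w) * kern c (y u) (y w')) y = kern c (y w) (y w') / real c"
  using assms by (simp add: recolor_avg_def sum_kern_kern field_simps)

lemma kern_upd: "x \<noteq> u \<Longrightarrow> x \<noteq> w \<Longrightarrow> kern c ((y(x := a)) u) ((y(x := a)) w) = kern c (y u) (y w)"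
  by simp

lemma color_exp_kern_diag:
  assumes "c \<ge> 1" "w \<in> {1..n}"
  shows "color_exp c n (\<lambda>y. kern c (y w) (y w)) = 1 - 1 / real c"
proof -
  have "color_exp c n (\<lambda>y. kern c (y w) (y w)) = color_exp c n (\<lambda>y. 1 - 1 / real c)"
    by (rule color_exp_cong) (use coloring_color[OF assms(1) _ assms(2)] in \<open>auto simp: kern_def\<close>)
  then show ?thesis by simp
qed

text \<open>
  Averaging over the color of \<open>u\<close> leaves the diagonal of the kernel, which is constant on
  colors.
\<close>

lemma color_exp_kern_squared:
  assumes "c \<ge> 1" "u \<in> {1..n}" "w \<in> {1..n}" "u \<noteq> w"
  shows "color_exp c n (\<lambda>y. kern c (y u) (y w) * kern c (y u) (y w)) = (1 - 1 / real c) / real c"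
proof -
  let ?F = "\<lambda>y. kern c (y u) (y w) * kern c (y u) (y w)"
  have "recolor_avg c u ?F = (\<lambda>y. kern c (y w) (y w) / real c)"
    by (rule ext) (rule recolor_avg_kern_kern[OF assms(4,4)])
  then show ?thesis
    using color_exp_recolor_avg[OF assms(1,2), of ?F] color_exp_kern_diag[OF assms(1,3)] by simp
qed

section \<open>A quantitative martingale central limit theorem\<close>

lemma abs_exp_quadratic: "x \<ge> 0 \<Longrightarrow> \<bar>1 - x - exp (- x)\<bar> \<le> (x::real)\<^sup>2"
proof -
  assume x: "x \<ge> 0"
  have "1 - x \<le> exp (-x)" using exp_ge_add_one_self[of "-x"] by simp
  moreover have "exp (-x) \<le> 1 - x + x\<^sup>2"
  proof -
    have "1 + x \<le> exp x" by (rule exp_ge_add_one_self)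
    then have "exp (-x) \<le> 1 / (1 + x)" using x by (simp add: exp_minus field_simps)
    also have "\<dots> \<le> 1 - x + x\<^sup>2" using x
      by (simp add: field_simps power2_eq_square)
    finally show ?thesis .
  qed
  ultimately show ?thesis by simp
qed

lemma norm_iexp_minus_quadratic: "norm (iexp x - 1 - \<i> * x + x\<^sup>2 / 2) \<le> \<bar>x\<bar> ^ 3"
proof -
  have "norm (iexp x - (1 + \<i> * x - x\<^sup>2 / 2)) \<le> \<bar>x\<bar> ^ 3 / 6"
    using iexp_approx1[of x 2] by (simp add: numeral_eq_Suc power_mult_distrib fact_numeral)
  also have "\<dots> \<le> \<bar>x\<bar> ^ 3" by simp
  finally show ?thesis by (simp add: algebra_simps)
qed

lemma abs_exp_diff_le:
  assumes "a \<le> (M::real)" "b \<le> M" shows "\<bar>exp a - exp b\<bar> \<le> exp M * \<bar>a - b\<bar>"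
proof -
  have *: "exp b - exp a \<le> exp M * (b - a)" if "a \<le> b" "b \<le> M" for a b
  proof -
    have "1 - (b - a) \<le> exp (a - b)" using exp_ge_add_one_self[of "a - b"] by linarith
    then have "exp b * (1 - exp (a - b)) \<le> exp b * (b - a)" by (intro mult_left_mono) auto
    also have "\<dots> \<le> exp M * (b - a)" using that by (intro mult_right_mono) auto
    finally show ?thesis by (simp add: right_diff_distrib flip: exp_add)
  qed
  show ?thesis using *[of a b] *[of b a] assms by (cases "a \<le> b") auto
qed

lemma norm_diff_exp_le:
  fixes x :: real and z w :: complex
  assumes "x \<ge> 0"
  shows "norm (z - exp (- x)) \<le> norm (exp x * z - w) + norm (w - 1)"
proof -
  have "complex_of_real (exp (- x)) * exp x = 1"
    by (simp flip: of_real_mult exp_add)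
  then have "z - exp (- x) = complex_of_real (exp (- x)) * (exp x * z - 1)"
    by (simp add: right_diff_distrib mult.assoc[symmetric])
  then have "norm (z - exp (- x)) = exp (- x) * norm (exp x * z - 1)"
    by (simp add: norm_mult)
  also have "\<dots> \<le> 1 * norm (exp x * z - 1)" using assms by (intro mult_right_mono) auto
  also have "\<dots> \<le> norm (exp x * z - w) + norm (w - 1)"
    using norm_triangle_ineq[of "exp x * z - w" "w - 1"] by simp
  finally show ?thesis .
qed

text \<open>
  The vertices \<open>v 0, v 1, \<dots>\<close> are revealed one after the other. The term \<open>X k\<close> depends only on
  the vertices up to \<open>v k\<close> (and on vertices that are never revealed), and it is centered given
  all the others: a sequence of martingale differences, expressed without filtrations.
\<close>

locale color_martingale =
  fixes c n m :: nat and v :: "nat \<Rightarrow> nat" and X :: "nat \<Rightarrow> (nat \<Rightarrow> nat) \<Rightarrow> real"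
  assumes c: "c \<ge> 1"
    and v_range: "\<And>k. k < m \<Longrightarrow> v k \<in> {1..n}"
    and v_inj: "\<And>k l. k < l \<Longrightarrow> l < m \<Longrightarrow> v k \<noteq> v l"
    and adapted: "\<And>k l y a. k < l \<Longrightarrow> l < m \<Longrightarrow> X k (y(v l := a)) = X k y"
    and centered: "\<And>k y. k < m \<Longrightarrow> recolor_avg c (v k) (X k) y = 0"
begin

text \<open>
  The conditional variance of \<open>X k\<close>, the sum \<open>V\<close> of these, and the martingale \<open>S\<close>.
\<close>

definition W :: "nat \<Rightarrow> (nat \<Rightarrow> nat) \<Rightarrow> real" where
  "W k = recolor_avg c (v k) (\<lambda>y. (X k y)\<^sup>2)"

definition V :: "nat \<Rightarrow> (nat \<Rightarrow> nat) \<Rightarrow> real" where "V k y = (\<Sum>j<k. W j y)"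

definition S :: "nat \<Rightarrow> (nat \<Rightarrow> nat) \<Rightarrow> real" where "S k y = (\<Sum>j<k. X j y)"

lemma W_nonneg: "W k y \<ge> 0"
  by (auto simp: W_def recolor_avg_def intro!: mult_nonneg_nonneg sum_nonneg)

lemma V_mono: "k \<le> l \<Longrightarrow> V k y \<le> V l y"
  unfolding V_def by (intro sum_mono2) (auto intro: W_nonneg)

lemma W_adapted:
  assumes "k \<le> l" "l < m" shows "W k (y(v l := a)) = W k y"
proof (cases "k = l")
  case True then show ?thesis by (simp add: W_def recolor_avg_idem)
next
  case False
  then have "k < l" using assms by simp
  then show ?thesis unfolding W_def
    using v_inj[of k l] assms by (intro recolor_avg_other) (auto simp: adapted)
qed

lemma V_adapted: "k \<le> Suc l \<Longrightarrow> l < m \<Longrightarrow> V k (y(v l := a)) = V k y"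
  unfolding V_def by (intro sum.cong) (auto simp: W_adapted)

lemma S_adapted: "k \<le> l \<Longrightarrow> l < m \<Longrightarrow> S k (y(v l := a)) = S k y"
  unfolding S_def by (intro sum.cong) (auto simp: adapted)

text \<open>
  The exponential martingale, up to an error of third order: given the past, the factor
  \<open>exp (\<i> t X k)\<close> has mean close to \<open>exp (- t\<^sup>2 W k / 2)\<close>, which the second factor compensates.
\<close>

definition G :: "real \<Rightarrow> nat \<Rightarrow> (nat \<Rightarrow> nat) \<Rightarrow> complex" where
  "G t k y = exp (\<i> * (t * S k y) + complex_of_real (t\<^sup>2 / 2 * V k y))"

lemma norm_G: "norm (G t k y) = exp (t\<^sup>2 / 2 * V k y)"
  by (simp add: G_def)

text \<open>
  Expand the exponential to second order. The linear term averages to \<open>0\<close> and the quadratic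
  one to the conditional variance.
\<close>

lemma conditional_char:
  assumes k: "k < m"
  shows "norm (recolor_avg c (v k) (\<lambda>y. iexp (t * X k y)) y - exp (- (t\<^sup>2 / 2 * W k y)))
    \<le> recolor_avg c (v k) (\<lambda>y. \<bar>t * X k y\<bar> ^ 3 + (t * X k y) ^ 4) y"
proof -
  let ?A = "recolor_avg c (v k)"
  have quad: "?A (\<lambda>y. iexp (t * X k y)) y
      = ?A (\<lambda>y. iexp (t * X k y) - 1 - \<i> * (t * X k y) + (t * X k y)\<^sup>2 / 2) y + (1 - t\<^sup>2 / 2 * W k y)"
  proof -
    have one: "(\<Sum>a\<in>{1..c}. (1::complex)) = of_nat c" by simp
    have lin: "(\<Sum>a\<in>{1..c}. \<i> * complex_of_real (t * X k (y(v k := a)))) = 0"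
    proof -
      have "(\<Sum>a\<in>{1..c}. t * X k (y(v k := a))) = 0"
        using centered[OF k, of y] c by (simp add: recolor_avg_def flip: sum_distrib_left)
      then show ?thesis by (simp only: of_real_sum[symmetric] sum_distrib_left[symmetric]) simp
    qed
    have qu: "(\<Sum>a\<in>{1..c}. complex_of_real ((t * X k (y(v k := a)))\<^sup>2 / 2))
        = complex_of_real (real c * (t\<^sup>2 / 2 * W k y))"
    proof -
      have "(\<Sum>a\<in>{1..c}. (X k (y(v k := a)))\<^sup>2) = c * W k y"
        using c by (simp add: W_def recolor_avg_def)
      moreover have "(\<Sum>a\<in>{1..c}. (t * X k (y(v k := a)))\<^sup>2 / 2)
          = (t\<^sup>2 / 2) * (\<Sum>a\<in>{1..c}. (X k (y(v k := a)))\<^sup>2)"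
        unfolding sum_distrib_left by (intro sum.cong) (simp_all add: power_mult_distrib)
      ultimately show ?thesis by (simp only: of_real_sum[symmetric] mult.left_commute)
    qed
    have scale: "A /\<^sub>R real c = (A - of_nat c - 0 + complex_of_real (real c * (t\<^sup>2 / 2 * W k y))) /\<^sub>R real c + (1 - t\<^sup>2 / 2 * W k y)"
      for A :: complex
      using c by (simp add: scaleR_conv_of_real distrib_left right_diff_distrib)
    show ?thesis
      unfolding recolor_avg_def sum.distrib sum_subtractf one lin qu by (rule scale)
  qed
  have "norm (?A (\<lambda>y. iexp (t * X k y)) y - exp (- (t\<^sup>2 / 2 * W k y)))
      \<le> norm (?A (\<lambda>y. iexp (t * X k y) - 1 - \<i> * (t * X k y) + (t * X k y)\<^sup>2 / 2) y)
        + norm (complex_of_real (1 - t\<^sup>2 / 2 * W k y - exp (- (t\<^sup>2 / 2 * W k y))))"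
    unfolding quad by (rule order.trans[OF _ norm_triangle_ineq]) (simp add: algebra_simps)
  also have "\<dots> \<le> ?A (\<lambda>y. \<bar>t * X k y\<bar> ^ 3) y + ?A (\<lambda>y. (t * X k y) ^ 4) y"
  proof (rule add_mono)
    show "norm (?A (\<lambda>y. iexp (t * X k y) - 1 - \<i> * (t * X k y) + (t * X k y)\<^sup>2 / 2) y)
        \<le> ?A (\<lambda>y. \<bar>t * X k y\<bar> ^ 3) y"
      by (rule order.trans[OF norm_recolor_avg_le recolor_avg_mono]) (rule norm_iexp_minus_quadratic[THEN order.trans], simp)
    have "norm (complex_of_real (1 - t\<^sup>2 / 2 * W k y - exp (- (t\<^sup>2 / 2 * W k y)))) \<le> (t\<^sup>2 / 2 * W k y)\<^sup>2"
      unfolding norm_of_real by (intro abs_exp_quadratic) (simp add: W_nonneg)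
    also have "\<dots> \<le> (?A (\<lambda>y. (t * X k y)\<^sup>2) y)\<^sup>2"
      unfolding power_mult_distrib recolor_avg_cmult W_def by (auto intro!: mult_right_mono power_mono simp: power_divide)
    also have "\<dots> \<le> ?A (\<lambda>y. (t * X k y) ^ 4) y"
      using recolor_avg_squared_le[of c "v k" "\<lambda>y. (t * X k y)\<^sup>2" y] by simp
    finally show "norm (complex_of_real (1 - t\<^sup>2 / 2 * W k y - exp (- (t\<^sup>2 / 2 * W k y))))
      \<le> ?A (\<lambda>y. (t * X k y) ^ 4) y" .
  qed
  finally show ?thesis by (simp add: recolor_avg_add)
qed

text \<open>
  Telescope over \<open>k\<close>: each step changes the mean of \<open>G t k\<close> only by the error of
  \<open>conditional_char\<close>. The bound on the variance keeps the factors \<open>G t k\<close> bounded.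
\<close>

lemma char_bounded_variance:
  assumes bound: "\<And>y. V m y \<le> M"
  shows "norm (color_exp c n (G t m) - 1)
    \<le> exp (t\<^sup>2 / 2 * M) * (\<Sum>k<m. color_exp c n (\<lambda>y. \<bar>t * X k y\<bar> ^ 3 + (t * X k y) ^ 4))"
proof -
  have step: "norm (color_exp c n (G t (Suc k)) - color_exp c n (G t k))
      \<le> exp (t\<^sup>2 / 2 * M) * color_exp c n (\<lambda>y. \<bar>t * X k y\<bar> ^ 3 + (t * X k y) ^ 4)" if k: "k < m" for k
  proof -
    let ?A = "recolor_avg c (v k)" and ?R = "\<lambda>y. \<bar>t * X k y\<bar> ^ 3 + (t * X k y) ^ 4"
    let ?B = "\<lambda>y. exp (complex_of_real (t\<^sup>2 / 2 * W k y))"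
    have vk: "v k \<in> {1..n}" by (rule v_range[OF k])
    have Gs: "G t (Suc k) y = G t k y * ?B y * iexp (t * X k y)" for y
      by (simp add: G_def S_def V_def exp_add algebra_simps)
    have inv: "G t k (y(v k := a)) = G t k y" "?B (y(v k := a)) = ?B y" for y a
      using k by (simp_all add: G_def S_adapted V_adapted W_adapted)
    have eq1: "?A (G t (Suc k)) y - ?A (G t k) y
        = G t k y * ?B y * (?A (\<lambda>y. iexp (t * X k y)) y - exp (- (t\<^sup>2 / 2 * W k y)))" for y
    proof -
      have "?A (G t (Suc k)) y = (G t k y * ?B y) * ?A (\<lambda>y. iexp (t * X k y)) y"
        using recolor_avg_mult[where F = "\<lambda>y. G t k y * ?B y" and H = "\<lambda>y. iexp (t * X k y)" and c = c and x = "v k" and y = y]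
        unfolding Gs[abs_def] by (simp only: inv)
      moreover have "?A (G t k) y = G t k y" 
        using recolor_avg_const[where F = "G t k" and c = c and x = "v k" and y = y] c inv(1) by simp
      moreover have "?B y * exp (- (t\<^sup>2 / 2 * W k y)) = 1"
        by (simp add: exp_of_real[symmetric] exp_add[symmetric] flip: of_real_mult)
      moreover have "a = g * b * r \<Longrightarrow> a0 = g \<Longrightarrow> b * e = 1 \<Longrightarrow> a - a0 = g * b * (r - e)" for a a0 g b r e :: complex
        by (simp add: right_diff_distrib mult.assoc)
      ultimately show ?thesis by blast
    qed
    have bd: "norm (?A (G t (Suc k)) y - ?A (G t k) y) \<le> exp (t\<^sup>2 / 2 * M) * ?A ?R y" for y
    proof -
      have "norm (G t k y * ?B y) = exp (t\<^sup>2 / 2 * V (Suc k) y)"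
        by (simp add: norm_mult norm_G V_def exp_add algebra_simps add_divide_distrib)
      also have "\<dots> \<le> exp (t\<^sup>2 / 2 * M)"
        using V_mono[of "Suc k" m y] k bound[of y] by (simp add: mult_left_mono)
      finally show ?thesis unfolding eq1 norm_mult[of "G t k y * ?B y"]
        by (intro mult_mono conditional_char[OF k]) auto
    qed
    have eq: "color_exp c n (G t (Suc k)) - color_exp c n (G t k)
        = color_exp c n (\<lambda>y. ?A (G t (Suc k)) y - ?A (G t k) y)"
      by (simp only: color_exp_diff[OF c] color_exp_recolor_avg[OF c vk])
    have "norm (color_exp c n (\<lambda>y. ?A (G t (Suc k)) y - ?A (G t k) y))
        \<le> color_exp c n (\<lambda>y. exp (t\<^sup>2 / 2 * M) * ?A ?R y)"
      by (rule norm_color_exp_le[OF c bd])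
    then show ?thesis
      unfolding eq by (simp only: integral_mult_right_zero color_exp_recolor_avg[OF c vk])
  qed
  have eq: "color_exp c n (G t m) - 1 = (\<Sum>k<m. color_exp c n (G t (Suc k)) - color_exp c n (G t k))"
  proof -
    have "G t 0 = (\<lambda>_. 1)" by (rule ext) (simp add: G_def S_def V_def)
    then show ?thesis by (subst sum_lessThan_telescope) simp
  qed
  have "norm (color_exp c n (G t m) - 1) \<le> (\<Sum>k<m. norm (color_exp c n (G t (Suc k)) - color_exp c n (G t k)))"
    unfolding eq by (rule norm_sum)
  also have "\<dots> \<le> (\<Sum>k<m. exp (t\<^sup>2 / 2 * M) * color_exp c n (\<lambda>y. \<bar>t * X k y\<bar> ^ 3 + (t * X k y) ^ 4))"
    by (intro sum_mono step) auto
  finally show ?thesis by (simp only: sum_distrib_left)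
qed

text \<open>
  Since the conditional variance of step \<open>k\<close> is known before \<open>v k\<close> is revealed, stopping the
  martingale before its accumulated variance exceeds \<open>M\<close> keeps the differences centered.
\<close>

definition stopped :: "real \<Rightarrow> nat \<Rightarrow> (nat \<Rightarrow> nat) \<Rightarrow> real" where
  "stopped M k y = (if V (Suc k) y \<le> M then X k y else 0)"

lemma recolor_avg_stopped:
  assumes "k < m" 
  shows "recolor_avg c (v k) (\<lambda>y. f (stopped M k y)) y
    = (if V (Suc k) y \<le> M then recolor_avg c (v k) (\<lambda>y. f (X k y)) y else recolor_avg c (v k) (\<lambda>y. f 0) y)"
  using assms V_adapted[of "Suc k" k] by (simp add: recolor_avg_def stopped_def)

lemma stopped_martingale: "color_martingale c n m v (stopped M)"
proof
  show "recolor_avg c (v k) (stopped M k) y = 0" if "k < m" for k y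
    using recolor_avg_stopped[OF that, of "\<lambda>x. x" M y] centered[OF that, of y]
    by (simp add: recolor_avg_def)
  show "stopped M k (y(v l := a)) = stopped M k y" if "k < l" "l < m" for k l y a
    using that by (simp add: stopped_def V_adapted adapted)
qed (use c v_range v_inj in auto)

text \<open>
  Stop the martingale when its variance exceeds \<open>s + 1\<close>. The stopped martingale satisfies
  \<open>char_bounded_variance\<close>; it differs from the original one only if \<open>V m y > s + 1\<close>, an event
  whose probability is at most the mean of \<open>\<bar>V m y - s\<bar>\<close>. The same mean
  controls the cost of replacing the random variance by \<open>s\<close> in the compensator.
\<close>

theorem martingale_clt_bound:
  assumes s: "s \<ge> 0"
  shows "norm (color_exp c n (\<lambda>y. iexp (t * S m y)) - exp (- (t\<^sup>2 * s / 2)))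
    \<le> exp (t\<^sup>2 * (s + 1) / 2) * ((t\<^sup>2 + 2) * color_exp c n (\<lambda>y. \<bar>V m y - s\<bar>)
      + (\<Sum>k<m. color_exp c n (\<lambda>y. \<bar>t * X k y\<bar> ^ 3 + (t * X k y) ^ 4)))"
proof -
  \<comment> \<open>Any stopping level above \<open>s\<close> would do; the distance \<open>1\<close> enters the bound for the case that
    the martingale is stopped.\<close>
  define M where "M = s + 1"
  let ?K = "exp (t\<^sup>2 * (s + 1) / 2)" and ?e = "exp (t\<^sup>2 * s / 2)"
  let ?\<phi> = "color_exp c n (\<lambda>y. iexp (t * S m y))"
  let ?R = "\<Sum>k<m. color_exp c n (\<lambda>y. \<bar>t * X k y\<bar> ^ 3 + (t * X k y) ^ 4)"
  have M: "0 \<le> M" using s by (simp add: M_def)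
  interpret tr: color_martingale c n m v "stopped M" by (rule stopped_martingale)
  have W_tr: "tr.W k y = (if V (Suc k) y \<le> M then W k y else 0)" if "k < m" for k y
    unfolding tr.W_def W_def using that by (subst recolor_avg_stopped) (simp_all add: recolor_avg_def)
  have V_tr_le: "tr.V m y \<le> M" for y
  proof -
    have "tr.V k y \<le> M \<and> tr.V k y \<le> V k y" if "k \<le> m" for k
      using that
    proof (induction k)
      case 0
      then show ?case using M by (simp add: tr.V_def V_def)
    next
      case (Suc k)
      have *: "tr.V (Suc k) y = tr.V k y + tr.W k y" "V (Suc k) y = V k y + W k y"
        by (simp_all add: tr.V_def V_def)
      show ?case using Suc W_tr[of k y] W_nonneg[of k y] by (auto simp: * split: if_splits)
    qed
    then show ?thesis by simp
  qed
  have tr_eq: "tr.S m y = S m y" "tr.V m y = V m y" if y: "V m y \<le> M" for y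
  proof -
    have "V (Suc k) y \<le> M" if "k < m" for k using V_mono[of "Suc k" m y] that y by simp
    then show "tr.S m y = S m y" "tr.V m y = V m y"
      by (simp_all add: tr.S_def tr.V_def S_def V_def[of m] W_tr stopped_def)
  qed
  have 1: "norm (color_exp c n (tr.G t m) - 1) \<le> ?K * ?R"
  proof -
    have "norm (color_exp c n (tr.G t m) - 1) \<le> exp (t\<^sup>2 / 2 * M) *
        (\<Sum>k<m. color_exp c n (\<lambda>y. \<bar>t * stopped M k y\<bar> ^ 3 + (t * stopped M k y) ^ 4))"
      by (rule tr.char_bounded_variance) (use V_tr_le in auto)
    also have "\<dots> \<le> exp (t\<^sup>2 / 2 * M) * ?R"
      by (intro mult_left_mono sum_mono color_exp_mono[OF c]) (auto simp: stopped_def)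
    finally show ?thesis by (simp add: M_def)
  qed
  have pt: "norm (?e * iexp (t * S m y) - tr.G t m y) \<le> ?K * (t\<^sup>2 + 2) * \<bar>V m y - s\<bar>" for y
  proof (cases "V m y \<le> M")
    case True
    have "?e * iexp (t * S m y) - tr.G t m y
        = iexp (t * S m y) * complex_of_real (?e - exp (t\<^sup>2 / 2 * V m y))"
      using tr_eq[OF True] by (simp add: tr.G_def exp_add exp_of_real[symmetric] algebra_simps)
    then have "norm (?e * iexp (t * S m y) - tr.G t m y) = \<bar>?e - exp (t\<^sup>2 / 2 * V m y)\<bar>"
      by (simp add: norm_mult del: of_real_diff)
    also have "\<dots> \<le> ?K * \<bar>t\<^sup>2 * s / 2 - t\<^sup>2 / 2 * V m y\<bar>"
    proof (rule abs_exp_diff_le)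
      have "t\<^sup>2 * s \<le> t\<^sup>2 * (s + 1)" "t\<^sup>2 * V m y \<le> t\<^sup>2 * (s + 1)"
        using True by (auto intro!: mult_left_mono simp: M_def)
      then show "t\<^sup>2 * s / 2 \<le> t\<^sup>2 * (s + 1) / 2" "t\<^sup>2 / 2 * V m y \<le> t\<^sup>2 * (s + 1) / 2"
        by simp_all
    qed
    also have "\<bar>t\<^sup>2 * s / 2 - t\<^sup>2 / 2 * V m y\<bar> = t\<^sup>2 / 2 * \<bar>V m y - s\<bar>"
    proof -
      have "t\<^sup>2 * s / 2 - t\<^sup>2 / 2 * V m y = (t\<^sup>2 / 2) * (s - V m y)" by (simp add: field_simps)
      then show ?thesis by (simp only: abs_mult abs_minus_commute) simp
    qed
    also have "?K * (t\<^sup>2 / 2 * \<bar>V m y - s\<bar>) \<le> ?K * ((t\<^sup>2 + 2) * \<bar>V m y - s\<bar>)"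
      by (intro mult_left_mono mult_right_mono) auto
    finally show ?thesis by (simp add: mult.assoc)
  next
    case False
    have "norm (?e * iexp (t * S m y) - tr.G t m y) \<le> ?e + exp (t\<^sup>2 / 2 * tr.V m y)"
      by (rule order.trans[OF norm_triangle_ineq4]) (simp add: norm_mult tr.norm_G)
    also have "\<dots> \<le> ?K + ?K"
    proof (rule add_mono)
      have "t\<^sup>2 * s \<le> t\<^sup>2 * (s + 1)" "t\<^sup>2 * tr.V m y \<le> t\<^sup>2 * (s + 1)"
        using V_tr_le[of y] by (auto intro!: mult_left_mono simp: M_def)
      then show "?e \<le> ?K" "exp (t\<^sup>2 / 2 * tr.V m y) \<le> ?K" by simp_all
    qed
    also have "\<dots> = ?K * 2 * 1" by simp
    also have "\<dots> \<le> ?K * (t\<^sup>2 + 2) * \<bar>V m y - s\<bar>"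
      using False s by (intro mult_mono) (auto simp: M_def)
    finally show ?thesis .
  qed
  have 2: "norm (?e * ?\<phi> - color_exp c n (tr.G t m)) \<le> ?K * (t\<^sup>2 + 2) * color_exp c n (\<lambda>y. \<bar>V m y - s\<bar>)"
  proof -
    have eq: "?e * ?\<phi> - color_exp c n (tr.G t m) = color_exp c n (\<lambda>y. ?e * iexp (t * S m y) - tr.G t m y)"
      by (simp only: color_exp_diff[OF c] integral_mult_right_zero)
    have "norm (color_exp c n (\<lambda>y. ?e * iexp (t * S m y) - tr.G t m y))
        \<le> color_exp c n (\<lambda>y. ?K * (t\<^sup>2 + 2) * \<bar>V m y - s\<bar>)"
      by (rule norm_color_exp_le[OF c pt])
    then show ?thesis unfolding eq by (simp only: integral_mult_right_zero)
  qed
  have "norm (?\<phi> - exp (- (t\<^sup>2 * s / 2)))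
      \<le> norm (?e * ?\<phi> - color_exp c n (tr.G t m)) + norm (color_exp c n (tr.G t m) - 1)"
    by (rule norm_diff_exp_le) (use s in simp)
  also have "\<dots> \<le> ?K * (t\<^sup>2 + 2) * color_exp c n (\<lambda>y. \<bar>V m y - s\<bar>) + ?K * ?R"
    by (rule add_mono[OF 2 1])
  finally show ?thesis by (subst distrib_left) (simp only: mult.assoc)
qed

end

section \<open>Sixth moments of degenerate sums\<close>

text \<open>
  In the expansion of \<open>(F + H)\<^sup>6\<close> the term linear in \<open>H\<close> has mean \<open>0\<close>, and all others are
  dominated by \<open>F\<^sup>6\<close>, \<open>F\<^sup>4 H\<^sup>2\<close> and \<open>H\<^sup>6\<close>; the inequality of Young bounds the mean of
  \<open>F\<^sup>4 H\<^sup>2\<close> by \<open>A\<^sup>2 B\<close>. As \<open>A\<close> and \<open>B\<close> bound the squares of the \<open>L\<^sup>6\<close> norms, these squares grow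
  at most additively along a martingale, up to the constant \<open>13\<close>.
\<close>

lemma sixth_moment_add_pos:
  assumes c: "c \<ge> 1" and x: "x \<in> {1..n}"
    and F: "\<And>y a. F (y(x := a)) = F y" and H: "\<And>y. recolor_avg c x H y = 0"
    and A: "color_exp c n (\<lambda>y. F y ^ 6) \<le> A ^ 3" "A > 0"
    and B: "color_exp c n (\<lambda>y. H y ^ 6) \<le> B ^ 3" "B > (0::real)"
  shows "color_exp c n (\<lambda>y. (F y + H y) ^ 6) \<le> (A + 13 * B) ^ 3"
proof -
  have poly: "(f + h) ^ 6 \<le> f ^ 6 + 6 * (f ^ 5 * h) + 39 * (f ^ 4 * h\<^sup>2) + 18 * h ^ 6" for f h :: real
  proof -
    have "f ^ 6 + 6 * (f ^ 5 * h) + 39 * (f ^ 4 * h\<^sup>2) + 18 * h ^ 6 - (f + h) ^ 6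
        = h\<^sup>2 * (10 * (f * (f - h))\<^sup>2 + 3 * (h * (f - h))\<^sup>2 + 14 * (f\<^sup>2 - h\<^sup>2)\<^sup>2)"
      by algebra
    also have "\<dots> \<ge> 0" by (intro mult_nonneg_nonneg add_nonneg_nonneg) auto
    finally show ?thesis by simp
  qed
  have young: "f ^ 4 * h\<^sup>2 \<le> A\<^sup>2 * B * (2 / A ^ 3 * f ^ 6 + 1 / B ^ 3 * h ^ 6) / 3" for f h :: real
  proof -
    \<comment> \<open>The inequality of arithmetic and geometric means for \<open>u, u, w\<close>, where the scaling makes the
      means of \<open>u\<^sup>3\<close> and \<open>w\<^sup>3\<close> at most \<open>1\<close>.\<close>
    define u w where "u = f\<^sup>2 / A" and "w = h\<^sup>2 / B"
    have "u \<ge> 0" "w \<ge> 0" using A B by (auto simp: u_def w_def)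
    then have "0 \<le> (u - w)\<^sup>2 * (2 * u + w)" by auto
    also have "\<dots> = 2 * u ^ 3 + w ^ 3 - 3 * (u\<^sup>2 * w)"
      by algebra
    finally have "A\<^sup>2 * B * (u\<^sup>2 * w) \<le> A\<^sup>2 * B * ((2 * u ^ 3 + w ^ 3) / 3)"
      using A B by (intro mult_left_mono) auto
    moreover have "A\<^sup>2 * B * (u\<^sup>2 * w) = f ^ 4 * h\<^sup>2"
      using A B by (simp add: u_def w_def power_divide)
    moreover have "2 * u ^ 3 + w ^ 3 = 2 / A ^ 3 * f ^ 6 + 1 / B ^ 3 * h ^ 6"
      by (simp add: u_def w_def power_divide)
    ultimately show ?thesis by simp
  qed
  have cross: "color_exp c n (\<lambda>y. F y ^ 5 * H y) = 0"
    using color_exp_orthogonal[OF c x, where F = "\<lambda>y. F y ^ 5" and H = H] by (simp only: F H)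
  have mixed: "color_exp c n (\<lambda>y. F y ^ 4 * (H y)\<^sup>2) \<le> A\<^sup>2 * B"
  proof -
    have "color_exp c n (\<lambda>y. F y ^ 4 * (H y)\<^sup>2)
        \<le> color_exp c n (\<lambda>y. A\<^sup>2 * B * (2 / A ^ 3 * F y ^ 6 + 1 / B ^ 3 * H y ^ 6) / 3)"
      by (intro color_exp_mono[OF c] young)
    also have "\<dots> = A\<^sup>2 * B * (2 / A ^ 3 * color_exp c n (\<lambda>y. F y ^ 6) + 1 / B ^ 3 * color_exp c n (\<lambda>y. H y ^ 6)) / 3"
      using c by (simp only: integral_divide_zero integral_mult_right_zero color_exp_add)
    also have "\<dots> \<le> A\<^sup>2 * B * (2 / A ^ 3 * A ^ 3 + 1 / B ^ 3 * B ^ 3) / 3"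
      using A B by (intro divide_right_mono mult_left_mono add_mono) auto
    also have "\<dots> = A\<^sup>2 * B" using A B by simp
    finally show ?thesis .
  qed
  have "color_exp c n (\<lambda>y. (F y + H y) ^ 6)
      \<le> color_exp c n (\<lambda>y. F y ^ 6 + 6 * (F y ^ 5 * H y) + 39 * (F y ^ 4 * (H y)\<^sup>2) + 18 * H y ^ 6)"
    by (intro color_exp_mono[OF c] poly)
  also have "\<dots> = color_exp c n (\<lambda>y. F y ^ 6) + 6 * color_exp c n (\<lambda>y. F y ^ 5 * H y)
      + 39 * color_exp c n (\<lambda>y. F y ^ 4 * (H y)\<^sup>2) + 18 * color_exp c n (\<lambda>y. H y ^ 6)"
    by (simp only: color_exp_add[OF c] integral_mult_right_zero)
  also have "\<dots> \<le> A ^ 3 + 39 * (A\<^sup>2 * B) + 18 * B ^ 3"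
    using A B cross mixed by linarith
  also have "\<dots> \<le> (A + 13 * B) ^ 3"
  proof -
    have "(A + 13 * B) ^ 3 = A ^ 3 + 39 * (A\<^sup>2 * B) + 507 * (A * B\<^sup>2) + 2197 * B ^ 3" by algebra
    then show ?thesis using A B by simp
  qed
  finally show ?thesis .
qed

text \<open>
  Let the positive bounds of \<open>sixth_moment_add_pos\<close> decrease to \<open>A\<close> and \<open>B\<close>.
\<close>

lemma sixth_moment_add:
  assumes c: "c \<ge> 1" and x: "x \<in> {1..n}"
    and F: "\<And>y a. F (y(x := a)) = F y" and H: "\<And>y. recolor_avg c x H y = 0"
    and A: "color_exp c n (\<lambda>y. F y ^ 6) \<le> A ^ 3" "A \<ge> 0"
    and B: "color_exp c n (\<lambda>y. H y ^ 6) \<le> B ^ 3" "B \<ge> (0::real)"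
  shows "color_exp c n (\<lambda>y. (F y + H y) ^ 6) \<le> (A + 13 * B) ^ 3"
proof (rule LIMSEQ_le_const)
  show "(\<lambda>k. (A + inverse (real (Suc k)) + 13 * (B + inverse (real (Suc k)))) ^ 3) \<longlonglongrightarrow> (A + 13 * B) ^ 3"
    using tendsto_power[OF tendsto_add[OF tendsto_add[OF tendsto_const[of A] LIMSEQ_inverse_real_of_nat]
        tendsto_mult[OF tendsto_const[of 13] tendsto_add[OF tendsto_const[of B] LIMSEQ_inverse_real_of_nat]]], of 3]
    by (simp only: add_0_right)
  have "color_exp c n (\<lambda>y. (F y + H y) ^ 6) \<le> (A + \<epsilon> + 13 * (B + \<epsilon>)) ^ 3" if "\<epsilon> > 0" for \<epsilon> :: real
  proof (rule sixth_moment_add_pos[OF c x F H])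
    have "A ^ 3 \<le> (A + \<epsilon>) ^ 3" "B ^ 3 \<le> (B + \<epsilon>) ^ 3" using A B that by (auto intro!: power_mono)
    then show "color_exp c n (\<lambda>y. F y ^ 6) \<le> (A + \<epsilon>) ^ 3" "color_exp c n (\<lambda>y. H y ^ 6) \<le> (B + \<epsilon>) ^ 3"
      using A B by linarith+
  qed (use A B that in auto)
  then show "\<exists>N. \<forall>k\<ge>N. color_exp c n (\<lambda>y. (F y + H y) ^ 6)
      \<le> (A + inverse (real (Suc k)) + 13 * (B + inverse (real (Suc k)))) ^ 3"
    by (intro exI allI impI) (simp only: inverse_positive_iff_positive of_nat_0_less_iff zero_less_Suc)
qed

text \<open>
  Recolor the leaves of a star one after the other: each leaf adds a centered term of
  absolute value at most \<open>1\<close>.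
\<close>

lemma sixth_moment_star:
  assumes c: "c \<ge> 1" and "finite I" "I \<subseteq> {1..n}" "w \<notin> I"
  shows "color_exp c n (\<lambda>y. (\<Sum>u\<in>I. kern c (y u) (y w)) ^ 6) \<le> (13 * real (card I)) ^ 3"
  using assms(2-)
proof (induction I rule: finite_induct)
  case (insert u I)
  have uw: "u \<noteq> w" "u \<in> {1..n}" using insert.prems by auto
  have "color_exp c n (\<lambda>y. ((\<Sum>u\<in>I. kern c (y u) (y w)) + kern c (y u) (y w)) ^ 6) \<le> (13 * real (card I) + 13 * 1) ^ 3"
  proof (rule sixth_moment_add[OF c uw(2)])
    show "(\<Sum>u'\<in>I. kern c ((y(u := a)) u') ((y(u := a)) w)) = (\<Sum>u\<in>I. kern c (y u) (y w))" for y a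
      by (intro sum.cong refl kern_upd) (use insert.hyps uw in auto)
    show "recolor_avg c u (\<lambda>y. kern c (y u) (y w)) y = 0" for y by (rule recolor_avg_kern[OF uw(1)])
    have le: "kern c a b ^ 6 \<le> 1" for a b
      using power_le_one[OF abs_ge_zero abs_kern_le_1[OF c, of a b], of 6] by (simp add: power_even_abs)
    have "color_exp c n (\<lambda>y. kern c (y u) (y w) ^ 6) \<le> color_exp c n (\<lambda>y. 1)"
      by (rule color_exp_mono[OF c]) (rule le)
    then show "color_exp c n (\<lambda>y. kern c (y u) (y w) ^ 6) \<le> 1 ^ 3" by simp
    show "color_exp c n (\<lambda>y. (\<Sum>u\<in>I. kern c (y u) (y w)) ^ 6) \<le> (13 * real (card I)) ^ 3"
      by (rule insert.IH) (use insert.prems in auto)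
  qed simp_all
  moreover have "(\<Sum>u\<in>insert u I. kern c (y u) (y w)) = (\<Sum>u\<in>I. kern c (y u) (y w)) + kern c (y u) (y w)" for y
    using insert.hyps by (simp add: add.commute)
  moreover have "13 * real (card (insert u I)) = 13 * real (card I) + 13 * 1"
    using insert.hyps by simp
  ultimately show ?case by (simp only:)
qed simp

text \<open>
  The list \<open>v 0, \<dots>, v (n - 1)\<close> is the order in which the vertices are revealed.
\<close>

locale ordered_graph =
  fixes c n :: nat and v :: "nat \<Rightarrow> nat" and E :: "nat set set"
  assumes c: "c \<ge> 1"
    and v_range: "\<And>k. k < n \<Longrightarrow> v k \<in> {1..n}"
    and v_inj: "inj_on v {..<n}"
begin

text \<open>
  These are positions in the order, not vertices.
\<close>

definition back_nbrs :: "nat \<Rightarrow> nat set" where "back_nbrs k = {i. i < k \<and> {v i, v k} \<in> E}"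

text \<open>
  The martingale difference of step \<open>k\<close>: the contribution of the edges from \<open>v k\<close> back to
  earlier vertices.
\<close>

definition h :: "nat \<Rightarrow> (nat \<Rightarrow> nat) \<Rightarrow> real" where
  "h k y = (\<Sum>i\<in>back_nbrs k. kern c (y (v i)) (y (v k)))"

lemma finite_back_nbrs [simp]: "finite (back_nbrs k)" by (simp add: back_nbrs_def)

lemma back_nbrs_less: "i \<in> back_nbrs k \<Longrightarrow> i < k" by (simp add: back_nbrs_def)

lemma v_neq: "i < n \<Longrightarrow> j < n \<Longrightarrow> i \<noteq> j \<Longrightarrow> v i \<noteq> v j"
  using v_inj by (auto simp: inj_on_def)

lemma h_adapted: "k < l \<Longrightarrow> l < n \<Longrightarrow> h k (y(v l := a)) = h k y"
proof -
  assume kl: "k < l" "l < n"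
  have "v l \<noteq> v j" if "j \<le> k" for j using v_neq[of l j] kl that by simp
  then show ?thesis
    unfolding h_def using back_nbrs_less by (intro sum.cong refl kern_upd) (auto simp: less_imp_le)
qed

lemma h_centered: assumes "k < n" shows "recolor_avg c (v k) (h k) y = 0"
proof -
  have "recolor_avg c (v k) (\<lambda>y. kern c (y (v i)) (y (v k))) y = 0" if "i \<in> back_nbrs k" for i
    using recolor_avg_kern[of "v k" "v i" c y] v_neq[of k i] back_nbrs_less[OF that] assms
    by (simp add: kern_commute[of c "_ (v i)"])
  then show ?thesis unfolding h_def[abs_def] recolor_avg_sum by simp
qed

lemma sixth_moment_h:
  assumes "k < n"
  shows "color_exp c n (\<lambda>y. h k y ^ 6) \<le> (13 * real (card (back_nbrs k))) ^ 3"
proof -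
  have inj: "inj_on v (back_nbrs k)" using v_inj by (rule inj_on_subset) (use assms in \<open>auto dest: back_nbrs_less\<close>)
  have "h k y = (\<Sum>u\<in>v ` back_nbrs k. kern c (y u) (y (v k)))" for y
    unfolding h_def by (subst sum.reindex[OF inj]) simp
  moreover have "v ` back_nbrs k \<subseteq> {1..n}"
    using v_range assms by (auto dest!: back_nbrs_less)
  moreover have "v k \<notin> v ` back_nbrs k"
  proof
    assume "v k \<in> v ` back_nbrs k"
    then obtain i where "i \<in> back_nbrs k" "v k = v i" by auto
    then show False using back_nbrs_less[of i k] v_neq[of i k] assms by simp
  qed
  ultimately show ?thesis
    using sixth_moment_star[OF c, of "v ` back_nbrs k" n "v k"] by (simp add: card_image[OF inj])
qed

text \<open>
  The same additivity a second time, now over the steps instead of over the edges of one step.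
\<close>

lemma sixth_moment_sum_h:
  assumes "k \<le> n"
  shows "color_exp c n (\<lambda>y. (\<Sum>j<k. h j y) ^ 6) \<le> (169 * (\<Sum>j<k. real (card (back_nbrs j)))) ^ 3"
  using assms
proof (induction k)
  case (Suc k)
  have "color_exp c n (\<lambda>y. ((\<Sum>j<k. h j y) + h k y) ^ 6)
      \<le> (169 * (\<Sum>j<k. real (card (back_nbrs j))) + 13 * (13 * real (card (back_nbrs k)))) ^ 3"
  proof (rule sixth_moment_add[OF c v_range])
    show "(\<Sum>j<k. h j (y(v k := a))) = (\<Sum>j<k. h j y)" for y a
      using Suc.prems by (intro sum.cong) (auto simp: h_adapted)
  qed (use Suc sixth_moment_h[of k] in \<open>auto simp: h_centered intro!: sum_nonneg\<close>)
  then show ?case by (simp add: algebra_simps)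
qed simp

end

section \<open>Fourth moments and conditional variances in an ordered graph\<close>

text \<open>
  One of the two pairs has a vertex outside of the other pair; average over its color.
\<close>

lemma color_exp_kern_pairs_orthogonal:
  assumes c: "c \<ge> 1" and r: "a \<in> {1..n}" "b \<in> {1..n}" "a' \<in> {1..n}" "b' \<in> {1..n}"
    and ne: "a \<noteq> b" "a' \<noteq> b'" "{a, b} \<noteq> {a', b'}"
  shows "color_exp c n (\<lambda>y. kern c (y a) (y b) * kern c (y a') (y b')) = 0"
proof -
  have *: "color_exp c n (\<lambda>y. kern c (y a) (y b) * kern c (y x) (y z)) = 0"
    if "x \<in> {1..n}" "x \<noteq> z" "x \<noteq> a" "x \<noteq> b" for x z
    using color_exp_orthogonal[OF c that(1), where F = "\<lambda>y. kern c (y a) (y b)" and H = "\<lambda>y. kern c (y x) (y z)"]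
      recolor_avg_kern[OF that(2), of c] that by simp
  have "a' \<noteq> a \<and> a' \<noteq> b \<or> b' \<noteq> a \<and> b' \<noteq> b" using ne by blast
  then show ?thesis using *[of a' b'] *[of b' a'] r ne(2) by (auto simp: kern_commute[of c "_ b'"])
qed

lemma color_exp_kern_pair_le_1:
  assumes "c \<ge> 1"
  shows "color_exp c n (\<lambda>y. kern c (y a) (y b) * kern c (y a') (y b')) \<le> 1"
proof -
  have "kern c p q * kern c p' q' \<le> 1" for p q p' q'
  proof -
    have "\<bar>kern c p q\<bar> * \<bar>kern c p' q'\<bar> \<le> 1 * 1" by (intro mult_mono abs_kern_le_1 assms) auto
    then show ?thesis using abs_ge_self[of "kern c p q * kern c p' q'"] by (simp add: abs_mult)
  qed
  then have "color_exp c n (\<lambda>y. kern c (y a) (y b) * kern c (y a') (y b')) \<le> color_exp c n (\<lambda>y. 1)"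
    by (intro color_exp_mono assms)
  then show ?thesis by simp
qed

context ordered_graph begin

text \<open>
  With \<open>z = x\<^sup>2 / d\<close> this is \<open>z\<^sup>2 \<le> 1 + z\<^sup>3\<close> applied to the sixth moment, so that
  \<open>2198 = 1 + 13\<^sup>3\<close>.
\<close>

lemma fourth_moment_h:
  assumes "k < n"
  shows "color_exp c n (\<lambda>y. h k y ^ 4) \<le> 2198 * (real (card (back_nbrs k)))\<^sup>2"
proof (cases "card (back_nbrs k) = 0")
  case True
  then have "h k y = 0" for y by (simp add: h_def)
  then show ?thesis by simp
next
  case False
  define d where "d = real (card (back_nbrs k))"
  have d: "d > 0" using False unfolding d_def by linarith
  have "x ^ 4 \<le> d\<^sup>2 + x ^ 6 / d" for x :: real
  proof -
    define z where "z = x\<^sup>2 / d"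
    have z: "z \<ge> 0" using d by (simp add: z_def)
    have "z\<^sup>2 \<le> 1 + z ^ 3"
    proof (cases "z \<le> 1")
      case True
      then have "z\<^sup>2 \<le> 1" using z by (simp add: power_le_one)
      then show ?thesis using z by (simp add: add_increasing2)
    next
      case False
      then have "z\<^sup>2 \<le> z ^ 3" by (intro power_increasing) auto
      then show ?thesis by simp
    qed
    then have "d\<^sup>2 * z\<^sup>2 \<le> d\<^sup>2 * (1 + z ^ 3)" by (intro mult_left_mono) auto
    moreover have "d\<^sup>2 * z\<^sup>2 = x ^ 4" using d by (simp add: z_def power_divide)
    moreover have "d\<^sup>2 * (1 + z ^ 3) = d\<^sup>2 + x ^ 6 / d"
      using d by (simp add: z_def power_divide distrib_left) (simp add: power2_eq_square power3_eq_cube)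
    ultimately show ?thesis by simp
  qed
  then have "color_exp c n (\<lambda>y. h k y ^ 4) \<le> color_exp c n (\<lambda>y. d\<^sup>2 + h k y ^ 6 / d)"
    by (intro color_exp_mono[OF c])
  also have "\<dots> = d\<^sup>2 + color_exp c n (\<lambda>y. h k y ^ 6) / d"
    using c by simp
  also have "\<dots> \<le> d\<^sup>2 + (13 * d) ^ 3 / d"
    using sixth_moment_h[OF assms] d by (intro add_left_mono divide_right_mono) (auto simp: d_def)
  also have "\<dots> = 2198 * d\<^sup>2" using d by (simp add: power_mult_distrib power2_eq_square power3_eq_cube)
  finally show ?thesis by (simp add: d_def)
qed

text \<open>
  Obtained from the fourth moment by \<open>x\<^sup>2 \<le> d + x\<^sup>4 / d\<close>. The exact value is of the same
  order, and only the order matters.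
\<close>

lemma second_moment_h:
  assumes "k < n"
  shows "color_exp c n (\<lambda>y. (h k y)\<^sup>2) \<le> 2199 * real (card (back_nbrs k))"
proof (cases "card (back_nbrs k) = 0")
  case True
  then have "h k y = 0" for y by (simp add: h_def)
  then show ?thesis by simp
next
  case False
  define d where "d = real (card (back_nbrs k))"
  have d: "d > 0" using False unfolding d_def by linarith
  have "x\<^sup>2 \<le> d + x ^ 4 / d" for x :: real
  proof -
    have "0 \<le> (x\<^sup>2 - d)\<^sup>2 + x\<^sup>2 * d" using d by (intro add_nonneg_nonneg) auto
    also have "(x\<^sup>2 - d)\<^sup>2 + x\<^sup>2 * d = d * d + x ^ 4 - x\<^sup>2 * d" by algebra
    finally have "x\<^sup>2 * d \<le> (d + x ^ 4 / d) * d" using d by (simp add: distrib_right)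
    then show ?thesis using d by (rule mult_right_le_imp_le)
  qed
  then have "color_exp c n (\<lambda>y. (h k y)\<^sup>2) \<le> color_exp c n (\<lambda>y. d + h k y ^ 4 / d)"
    by (intro color_exp_mono[OF c])
  also have "\<dots> = d + color_exp c n (\<lambda>y. h k y ^ 4) / d"
    using c by simp
  also have "\<dots> \<le> d + (2198 * d\<^sup>2) / d"
    using fourth_moment_h[OF assms] d by (intro add_left_mono divide_right_mono) (auto simp: d_def)
  also have "\<dots> = 2199 * d" using d by (simp add: power2_eq_square)
  finally show ?thesis by (simp add: d_def)
qed

lemma martingale_h: "color_martingale c n n v (\<lambda>k y. r * h k y)"
proof
  show "recolor_avg c (v k) (\<lambda>y. r * h k y) y = 0" if "k < n" for k y
    using h_centered[OF that] by (simp add: recolor_avg_cmult)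
qed (use c v_range v_neq h_adapted in auto)

definition pairs :: "(nat \<times> nat) set" where "pairs = {(i, j). i < n \<and> j < n \<and> i \<noteq> j}"

definition codegree :: "nat \<times> nat \<Rightarrow> nat" where
  "codegree p = card {k. k < n \<and> fst p \<in> back_nbrs k \<and> snd p \<in> back_nbrs k}"

definition pkern :: "nat \<times> nat \<Rightarrow> (nat \<Rightarrow> nat) \<Rightarrow> real" where
  "pkern p y = kern c (y (v (fst p))) (y (v (snd p)))"

text \<open>
  The random part of the accumulated conditional variance (\<open>V_martingale_h\<close>).
\<close>

definition Q :: "(nat \<Rightarrow> nat) \<Rightarrow> real" where
  "Q y = (\<Sum>p\<in>pairs. real (codegree p) * pkern p y)"

lemma finite_pairs [simp]: "finite pairs"
  by (rule finite_subset[of _ "{..<n} \<times> {..<n}"]) (auto simp: pairs_def)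

lemma Q_eq: "Q y = (\<Sum>k<n. \<Sum>i\<in>back_nbrs k. \<Sum>j\<in>back_nbrs k - {i}. kern c (y (v i)) (y (v j)))"
proof -
  have "(\<Sum>i\<in>back_nbrs k. \<Sum>j\<in>back_nbrs k - {i}. kern c (y (v i)) (y (v j)))
      = (\<Sum>p\<in>pairs. if fst p \<in> back_nbrs k \<and> snd p \<in> back_nbrs k then pkern p y else 0)" if "k < n" for k
  proof -
    have "(\<Sum>i\<in>back_nbrs k. \<Sum>j\<in>back_nbrs k - {i}. kern c (y (v i)) (y (v j)))
        = (\<Sum>p\<in>Sigma (back_nbrs k) (\<lambda>i. back_nbrs k - {i}). pkern p y)"
      by (subst sum.Sigma) (auto simp: pkern_def split_def)
    also have "Sigma (back_nbrs k) (\<lambda>i. back_nbrs k - {i}) = {p \<in> pairs. fst p \<in> back_nbrs k \<and> snd p \<in> back_nbrs k}"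
      using that less_trans[OF back_nbrs_less that] by (auto simp: pairs_def)
    finally show ?thesis by (simp add: sum.inter_filter)
  qed
  then have "(\<Sum>k<n. \<Sum>i\<in>back_nbrs k. \<Sum>j\<in>back_nbrs k - {i}. kern c (y (v i)) (y (v j)))
      = (\<Sum>k<n. \<Sum>p\<in>pairs. if fst p \<in> back_nbrs k \<and> snd p \<in> back_nbrs k then pkern p y else 0)" by simp
  also have "\<dots> = (\<Sum>p\<in>pairs. \<Sum>k<n. if fst p \<in> back_nbrs k \<and> snd p \<in> back_nbrs k then pkern p y else 0)"
    by (rule sum.swap)
  also have "\<dots> = Q y"
    unfolding Q_def
  proof (intro sum.cong refl)
    fix p
    have "{k \<in> {..<n}. fst p \<in> back_nbrs k \<and> snd p \<in> back_nbrs k} = {k. k < n \<and> fst p \<in> back_nbrs k \<and> snd p \<in> back_nbrs k}" by auto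
    then show "(\<Sum>k<n. if fst p \<in> back_nbrs k \<and> snd p \<in> back_nbrs k then pkern p y else 0) = real (codegree p) * pkern p y"
      by (subst sum.inter_filter[symmetric]) (simp_all add: codegree_def)
  qed
  finally show ?thesis by simp
qed

text \<open>
  Distinct unordered pairs are uncorrelated. The factor \<open>2\<close> appears because \<open>pairs\<close> contains
  each pair in both orders.
\<close>

lemma color_exp_Q_squared: "color_exp c n (\<lambda>y. (Q y)\<^sup>2) \<le> 2 * (\<Sum>p\<in>pairs. (real (codegree p))\<^sup>2)"
proof -
  have bd: "color_exp c n (\<lambda>y. pkern p y * pkern q y)
      \<le> (if q = p then 1 else 0) + (if q = prod.swap p then 1 else 0)" if "p \<in> pairs" "q \<in> pairs" for p q
  proof (cases "q = p \<or> q = prod.swap p")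
    case True
    then have "(1::real) \<le> (if q = p then 1 else 0) + (if q = prod.swap p then 1 else 0)" by auto
    then show ?thesis unfolding pkern_def by (rule order.trans[OF color_exp_kern_pair_le_1[OF c]])
  next
    case False
    obtain a b a' b' where ab: "p = (a, b)" "q = (a', b')" by (cases p, cases q) auto
    have "{v a, v b} \<noteq> {v a', v b'}"
      using False that v_inj by (auto simp: ab pairs_def doubleton_eq_iff inj_on_def)
    then have "color_exp c n (\<lambda>y. pkern p y * pkern q y) = 0"
      unfolding pkern_def ab using that v_range v_neq
      by (intro color_exp_kern_pairs_orthogonal[OF c]) (auto simp: ab pairs_def)
    then show ?thesis by simp
  qed
  have sq: "(Q y)\<^sup>2 = (\<Sum>p\<in>pairs. \<Sum>q\<in>pairs. real (codegree p * codegree q) * (pkern p y * pkern q y))" for y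
    unfolding Q_def power2_eq_square sum_product by (simp add: ac_simps)
  have "color_exp c n (\<lambda>y. (Q y)\<^sup>2)
      = (\<Sum>p\<in>pairs. \<Sum>q\<in>pairs. real (codegree p * codegree q) * color_exp c n (\<lambda>y. pkern p y * pkern q y))"
    unfolding sq by (simp only: color_exp_sum[OF c] integral_mult_right_zero)
  also have "\<dots> \<le> (\<Sum>p\<in>pairs. \<Sum>q\<in>pairs. real (codegree p * codegree q) *
      ((if q = p then 1 else 0) + (if q = prod.swap p then 1 else 0)))"
    by (intro sum_mono mult_left_mono bd) auto
  also have "\<dots> = (\<Sum>p\<in>pairs. 2 * (real (codegree p))\<^sup>2)"
  proof (intro sum.cong refl)
    fix p assume p: "p \<in> pairs"
    then have sw: "prod.swap p \<in> pairs" by (auto simp: pairs_def)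
    have cs: "codegree (prod.swap p) = codegree p" by (simp add: codegree_def conj_commute)
    have "(\<Sum>q\<in>pairs. real (codegree p * codegree q) * ((if q = p then 1 else 0) + (if q = prod.swap p then 1 else 0)))
      = (\<Sum>q\<in>pairs. if q = p then real (codegree p * codegree q) else 0)
        + (\<Sum>q\<in>pairs. if q = prod.swap p then real (codegree p * codegree q) else 0)"
      unfolding sum.distrib[symmetric] by (intro sum.cong) auto
    also have "\<dots> = 2 * (real (codegree p))\<^sup>2"
      using p sw by (simp add: cs power2_eq_square)
    finally show "(\<Sum>q\<in>pairs. real (codegree p * codegree q) * ((if q = p then 1 else 0) + (if q = prod.swap p then 1 else 0)))
      = 2 * (real (codegree p))\<^sup>2" .
  qed
  finally show ?thesis by (simp add: sum_distrib_left)
qed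

text \<open>
  Averaging \<open>(h k y)\<^sup>2\<close> over the color of \<open>v k\<close> turns the product of the kernels towards \<open>i\<close> and
  \<open>j\<close> into \<open>kern c (y (v i)) (y (v j)) / c\<close>. The diagonal \<open>i = j\<close> gives the constant.
\<close>

lemma V_martingale_h:
  assumes y: "y \<in> set_pmf (coloring_pmf c n)"
  shows "color_martingale.V c v (\<lambda>k y. r * h k y) n y
    = r\<^sup>2 / real c * ((1 - 1 / real c) * real (\<Sum>k<n. card (back_nbrs k)) + Q y)"
proof -
  interpret M: color_martingale c n n v "\<lambda>k y. r * h k y" by (rule martingale_h)
  have W: "M.W k y = r\<^sup>2 / real c * ((1 - 1 / real c) * real (card (back_nbrs k))
      + (\<Sum>i\<in>back_nbrs k. \<Sum>j\<in>back_nbrs k - {i}. kern c (y (v i)) (y (v j))))" if k: "k < n" for k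
  proof -
    have ne: "v k \<noteq> v i" if "i \<in> back_nbrs k" for i using v_neq[of k i] back_nbrs_less[OF that] k by simp
    have h_sq: "(h k y)\<^sup>2 = (\<Sum>i\<in>back_nbrs k. \<Sum>j\<in>back_nbrs k. kern c (y (v k)) (y (v i)) * kern c (y (v k)) (y (v j)))" for y
      by (simp add: h_def power2_eq_square sum_product kern_commute[of c _ "y (v k)"])
    have "M.W k y = r\<^sup>2 * recolor_avg c (v k)
        (\<lambda>y. \<Sum>i\<in>back_nbrs k. \<Sum>j\<in>back_nbrs k. kern c (y (v k)) (y (v i)) * kern c (y (v k)) (y (v j))) y"
      unfolding M.W_def power_mult_distrib recolor_avg_cmult h_sq ..
    also have "\<dots> = r\<^sup>2 * (\<Sum>i\<in>back_nbrs k. \<Sum>j\<in>back_nbrs k. kern c (y (v i)) (y (v j)) / real c)"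
      unfolding recolor_avg_sum using ne by (simp add: recolor_avg_kern_kern)
    also have "\<dots> = r\<^sup>2 / real c * (\<Sum>i\<in>back_nbrs k. \<Sum>j\<in>back_nbrs k. kern c (y (v i)) (y (v j)))"
      by (simp add: sum_divide_distrib[symmetric])
    also have "(\<Sum>i\<in>back_nbrs k. \<Sum>j\<in>back_nbrs k. kern c (y (v i)) (y (v j)))
        = (\<Sum>i\<in>back_nbrs k. (1 - 1 / real c) + (\<Sum>j\<in>back_nbrs k - {i}. kern c (y (v i)) (y (v j))))"
    proof (intro sum.cong refl)
      fix i assume i: "i \<in> back_nbrs k"
      then have "y (v i) \<in> {1..c}" using coloring_color[OF c y v_range] back_nbrs_less[OF i] k by simp
      then show "(\<Sum>j\<in>back_nbrs k. kern c (y (v i)) (y (v j))) = (1 - 1 / real c) + (\<Sum>j\<in>back_nbrs k - {i}. kern c (y (v i)) (y (v j)))"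
        by (subst sum.remove[OF _ i]) (auto simp: kern_def)
    qed
    finally show ?thesis by (simp add: sum.distrib mult.commute)
  qed
  have "M.V n y = (\<Sum>k<n. r\<^sup>2 / real c * ((1 - 1 / real c) * real (card (back_nbrs k))
      + (\<Sum>i\<in>back_nbrs k. \<Sum>j\<in>back_nbrs k - {i}. kern c (y (v i)) (y (v j)))))"
    unfolding M.V_def by (intro sum.cong) (auto simp: W)
  also have "\<dots> = r\<^sup>2 / real c * ((1 - 1 / real c) * real (\<Sum>k<n. card (back_nbrs k)) + Q y)"
    unfolding Q_eq by (simp only: sum_distrib_left[symmetric] sum.distrib of_nat_sum)
  finally show ?thesis .
qed

end

section \<open>Sums over the edges of a graph\<close>

text \<open>
  Minimum and maximum merely choose an order of the two ends of the edge, to which the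
  symmetric kernel is insensitive (\<open>edge_kern_doubleton\<close>).
\<close>

definition edge_kern :: "nat \<Rightarrow> nat set \<Rightarrow> (nat \<Rightarrow> nat) \<Rightarrow> real" where
  "edge_kern c e y = kern c (y (Min e)) (y (Max e))"

lemma edge_kern_doubleton: "edge_kern c {a, b} y = kern c (y a) (y b)"
  by (cases "a \<le> b") (auto simp: edge_kern_def kern_commute min_def max_def)

definition simple_edges :: "nat \<Rightarrow> nat set set \<Rightarrow> bool" where
  "simple_edges n E \<longleftrightarrow> (\<forall>e\<in>E. e \<subseteq> {1..n} \<and> card e = 2)"

lemma simple_edges_finite: "simple_edges n E \<Longrightarrow> finite E"
  by (rule finite_subset[of _ "Pow {1..n}"]) (auto simp: simple_edges_def)

lemma simple_edges_neq: "simple_edges n E \<Longrightarrow> {a, b} \<in> E \<Longrightarrow> a \<noteq> b"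
  by (auto simp: simple_edges_def)

lemma simple_edges_range: "simple_edges n E \<Longrightarrow> {a, b} \<in> E \<Longrightarrow> a \<in> {1..n} \<and> b \<in> {1..n}"
  by (auto simp: simple_edges_def)

lemma simple_edges_obtain:
  assumes "simple_edges n E" "e \<in> E"
  obtains a b where "e = {a, b}" "a \<noteq> b" "a \<in> {1..n}" "b \<in> {1..n}"
proof -
  have "card e = 2" "e \<subseteq> {1..n}" using assms by (auto simp: simple_edges_def)
  then show ?thesis using that by (auto simp: card_2_iff)
qed

text \<open>
  Labelled four-cycles. For the edge set of a simple graph the four vertices are distinct, as
  adjacent ones are.
\<close>

definition c4_embeddings :: "'a set set \<Rightarrow> ('a \<times> 'a \<times> 'a \<times> 'a) set" where
  "c4_embeddings E = {(a, b, c, d). a \<noteq> c \<and> b \<noteq> d \<and>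
     {a, b} \<in> E \<and> {b, c} \<in> E \<and> {c, d} \<in> E \<and> {d, a} \<in> E}"

lemma finite_c4_embeddings: "simple_edges n E \<Longrightarrow> finite (c4_embeddings E)"
proof (rule finite_subset)
  assume E: "simple_edges n E"
  show "c4_embeddings E \<subseteq> {1..n} \<times> {1..n} \<times> {1..n} \<times> {1..n}"
    unfolding c4_embeddings_def using simple_edges_range[OF E] by blast
qed simp

lemma mono_edges_minus_mean:
  assumes c: "c \<ge> 1" and H: "simple_edges n (edges H)" and y: "y \<in> set_pmf (coloring_pmf c n)"
  shows "real (mono_edges H y) - real (card (edges H)) / real c = (\<Sum>e\<in>edges H. edge_kern c e y)"
proof -
  have fin: "finite (edges H)" by (rule simple_edges_finite[OF H])
  have "edge_kern c e y = (if \<forall>i\<in>e. \<forall>j\<in>e. y i = y j then 1 else 0) - 1 / real c" if "e \<in> edges H" for e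
  proof -
    obtain a b where ab: "e = {a, b}" "a \<noteq> b" "a \<in> {1..n}" "b \<in> {1..n}"
      using simple_edges_obtain[OF H \<open>e \<in> edges H\<close>] .
    have "y a \<in> {1..c}" "y b \<in> {1..c}" using coloring_color[OF c y] ab by blast+
    moreover have "(\<forall>i\<in>e. \<forall>j\<in>e. y i = y j) \<longleftrightarrow> y a = y b" by (auto simp: ab(1))
    ultimately show ?thesis unfolding ab(1) edge_kern_doubleton by (simp add: kern_def)
  qed
  then have "(\<Sum>e\<in>edges H. edge_kern c e y)
      = (\<Sum>e\<in>edges H. if \<forall>i\<in>e. \<forall>j\<in>e. y i = y j then 1 else 0) - (\<Sum>e\<in>edges H. 1 / real c)"
    by (simp add: sum_subtractf)
  also have "(\<Sum>e\<in>edges H. if \<forall>i\<in>e. \<forall>j\<in>e. y i = y j then 1 else (0::real)) = real (mono_edges H y)"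
    unfolding mono_edges_def using fin by (simp flip: sum.inter_filter)
  finally show ?thesis by simp
qed

lemma normalized_mono_edges_eq:
  assumes "c \<ge> 1" "simple_edges n (edges H)" "y \<in> set_pmf (coloring_pmf c n)"
  shows "normalized_mono_edges c H y
    = 1 / sqrt (real (card (edges H)) / real c) * (\<Sum>e\<in>edges H. edge_kern c e y)"
  using mono_edges_minus_mean[OF assms] by (simp add: normalized_mono_edges_def)

section \<open>Ordering the vertices by decreasing degree\<close>

text \<open>
  The inequality half of the handshake lemma: each edge carries two arcs.
\<close>

lemma card_arcs_le:
  assumes "finite E" "simple_edges n E"
  shows "card {(x, u). {x, u} \<in> E} \<le> 2 * card E" "finite {(x, u). {x, u} \<in> E}"
proof -
  let ?f = "\<lambda>(x, u::nat). ({x, u}, x < u)"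
  have sub: "?f ` {(x, u). {x, u} \<in> E} \<subseteq> E \<times> UNIV" by auto
  have inj: "inj_on ?f {(x, u). {x, u} \<in> E}"
    by (auto simp: inj_on_def doubleton_eq_iff)
  have fin: "finite (E \<times> (UNIV::bool set))" using assms by simp
  show "finite {(x, u). {x, u} \<in> E}" by (rule inj_on_finite[OF inj sub fin])
  show "card {(x, u). {x, u} \<in> E} \<le> 2 * card E"
    using card_inj_on_le[OF inj sub fin] by (simp add: card_cartesian_product)
qed

definition degree_in :: "nat set set \<Rightarrow> nat \<Rightarrow> nat" where
  "degree_in E x = card {u. {x, u} \<in> E}"

locale degree_ordered_graph = ordered_graph +
  assumes v_bij: "bij_betw v {..<n} {1..n}"
    and E_simple: "simple_edges n E"
    and degree_mono: "\<And>i k. i < k \<Longrightarrow> k < n \<Longrightarrow> degree_in E (v k) \<le> degree_in E (v i)"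
begin

lemma finite_E: "finite E" by (rule simple_edges_finite[OF E_simple])

lemma bij_back_edges: "bij_betw (\<lambda>(k, i). {v i, v k}) (Sigma {..<n} back_nbrs) E"
proof (rule bij_betw_imageI)
  show "inj_on (\<lambda>(k, i). {v i, v k}) (Sigma {..<n} back_nbrs)"
  proof (rule inj_onI, safe)
    fix k i k' i' assume k: "k < n" "i \<in> back_nbrs k" "k' < n" "i' \<in> back_nbrs k'" and eq: "{v i, v k} = {v i', v k'}"
    have "i < n" "i' < n" "i < k" "i' < k'" using k back_nbrs_less[of i k] back_nbrs_less[of i' k'] by auto
    have v_eq: "v a = v b \<longleftrightarrow> a = b" if "a < n" "b < n" for a b using v_neq[OF that] by auto
    have "i = i' \<and> k = k' \<or> i = k' \<and> k = i'"
      using eq k \<open>i < n\<close> \<open>i' < n\<close> by (simp add: doubleton_eq_iff v_eq)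
    then have "i = i' \<and> k = k'" using \<open>i < k\<close> \<open>i' < k'\<close> by linarith
    then show "k = k'" "i = i'" by auto
  qed
  show "(\<lambda>(k, i). {v i, v k}) ` Sigma {..<n} back_nbrs = E"
  proof safe
    fix k i assume "k < n" "i \<in> back_nbrs k" then show "{v i, v k} \<in> E" by (simp add: back_nbrs_def)
  next
    fix e assume e: "e \<in> E"
    obtain a b where ab: "e = {a, b}" "a \<noteq> b" "a \<in> {1..n}" "b \<in> {1..n}"
      using simple_edges_obtain[OF E_simple e] .
    have "a \<in> v ` {..<n}" "b \<in> v ` {..<n}" using ab v_bij by (auto simp: bij_betw_def)
    then obtain i j where ij: "i < n" "j < n" "a = v i" "b = v j" by blast
    consider "i < j" | "j < i" using ab ij by (cases i j rule: linorder_cases) auto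
    then show "e \<in> (\<lambda>(k, i). {v i, v k}) ` Sigma {..<n} back_nbrs"
    proof cases
      case 1
      then show ?thesis using e ab ij by (intro image_eqI[of _ _ "(j, i)"]) (auto simp: back_nbrs_def)
    next
      case 2
      then show ?thesis using e ab ij by (intro image_eqI[of _ _ "(i, j)"]) (auto simp: back_nbrs_def insert_commute)
    qed
  qed
qed

lemma sum_h: "(\<Sum>k<n. h k y) = (\<Sum>e\<in>E. edge_kern c e y)"
proof -
  have "(\<Sum>k<n. h k y) = (\<Sum>(k, i)\<in>Sigma {..<n} back_nbrs. edge_kern c {v i, v k} y)"
    unfolding h_def by (subst sum.Sigma) (auto simp: edge_kern_doubleton)
  also have "\<dots> = (\<Sum>e\<in>E. edge_kern c e y)"
    using sum.reindex_bij_betw[OF bij_back_edges, of "\<lambda>e. edge_kern c e y"] by (simp add: split_def)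
  finally show ?thesis .
qed

lemma sum_card_back_nbrs: "(\<Sum>k<n. card (back_nbrs k)) = card E"
  using bij_betw_same_card[OF bij_back_edges] by simp

text \<open>
  All earlier neighbors of \<open>v k\<close> have degree at least that of \<open>v k\<close>, hence at least
  \<open>card (back_nbrs k)\<close>. There are \<open>card (back_nbrs k)\<close> of them, and all degrees
  add up to twice the number of edges.
\<close>

lemma card_back_nbrs_squared_le:
  assumes k: "k < n"
  shows "(card (back_nbrs k))\<^sup>2 \<le> 2 * card E"
proof -
  have fin: "finite {u. {x, u} \<in> E}" for x
  proof (rule finite_subset)
    show "{u. {x, u} \<in> E} \<subseteq> {1..n}" using simple_edges_range[OF E_simple] by blast
  qed simp
  have inj: "inj_on v (back_nbrs k)" using v_inj by (rule inj_on_subset) (use k in \<open>auto dest: back_nbrs_less\<close>)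
  have "card (back_nbrs k) \<le> degree_in E (v k)"
    unfolding degree_in_def
  proof (rule card_inj_on_le[OF inj _ fin])
    show "v ` back_nbrs k \<subseteq> {u. {v k, u} \<in> E}"
      using insert_commute[of "v k" _ "{}"] by (auto simp: back_nbrs_def)
  qed
  then have "card (back_nbrs k) \<le> degree_in E (v i)" if "i \<in> back_nbrs k" for i
    using degree_mono[OF back_nbrs_less[OF that] k] by linarith
  then have "(\<Sum>i\<in>back_nbrs k. card (back_nbrs k)) \<le> (\<Sum>i\<in>back_nbrs k. degree_in E (v i))" by (rule sum_mono)
  also have "\<dots> = card (Sigma (v ` back_nbrs k) (\<lambda>x. {u. {x, u} \<in> E}))"
    using fin by (simp add: card_SigmaI degree_in_def sum.reindex[OF inj])
  also have "\<dots> \<le> card {(x, u). {x, u} \<in> E}"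
    by (rule card_mono[OF card_arcs_le(2)[OF finite_E E_simple]]) auto
  also have "\<dots> \<le> 2 * card E" by (rule card_arcs_le(1)[OF finite_E E_simple])
  finally show ?thesis by (simp add: power2_eq_square)
qed

lemma sum_card_back_nbrs_squared_le: "(\<Sum>k<n. (real (card (back_nbrs k)))\<^sup>2) \<le> sqrt (2 * real (card E)) * real (card E)"
proof -
  have "(real (card (back_nbrs k)))\<^sup>2 \<le> sqrt (2 * real (card E)) * real (card (back_nbrs k))" if "k < n" for k
  proof -
    have "(real (card (back_nbrs k)))\<^sup>2 \<le> 2 * real (card E)"
      using card_back_nbrs_squared_le[OF that] by (metis (mono_tags) of_nat_le_iff of_nat_mult of_nat_numeral of_nat_power)
    then have "real (card (back_nbrs k)) \<le> sqrt (2 * real (card E))" by (rule real_le_rsqrt)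
    then show ?thesis by (simp add: power2_eq_square mult_right_mono)
  qed
  then have "(\<Sum>k<n. (real (card (back_nbrs k)))\<^sup>2) \<le> (\<Sum>k<n. sqrt (2 * real (card E)) * real (card (back_nbrs k)))"
    by (intro sum_mono) auto
  also have "\<dots> = sqrt (2 * real (card E)) * real (card E)"
    by (simp only: sum_distrib_left[symmetric] sum_card_back_nbrs[symmetric] of_nat_sum)
  finally show ?thesis .
qed

text \<open>
  A square counts pairs of common neighbors \<open>k, l\<close>. If \<open>k \<noteq> l\<close>, then \<open>i, k, j, l\<close> is a
  four-cycle; if \<open>k = l\<close>, then \<open>i\<close> and \<open>j\<close> are two earlier neighbors of \<open>k\<close>.
\<close>

lemma sum_codegree_squared_le:
  "(\<Sum>p\<in>pairs. (real (codegree p))\<^sup>2) \<le> real (card (c4_embeddings E)) + (\<Sum>k<n. (real (card (back_nbrs k)))\<^sup>2)"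
proof -
  define K where "K p = {k. k < n \<and> fst p \<in> back_nbrs k \<and> snd p \<in> back_nbrs k}" for p
  have finK: "finite (K p)" for p by (simp add: K_def)
  let ?S = "Sigma pairs (\<lambda>p. K p \<times> K p)"
  let ?diag = "{z \<in> ?S. fst (snd z) = snd (snd z)}" and ?off = "{z \<in> ?S. fst (snd z) \<noteq> snd (snd z)}"
  have finS: "finite ?S" using finK by auto
  have "(\<Sum>p\<in>pairs. (codegree p)\<^sup>2) = card ?S"
    using finK by (simp add: card_SigmaI codegree_def K_def[symmetric] card_cartesian_product power2_eq_square)
  also have "\<dots> = card ?diag + card ?off"
    using finS by (subst card_Un_disjoint[symmetric]) (auto intro!: arg_cong[where f = card])
  also have "card ?diag \<le> card (Sigma {..<n} (\<lambda>k. back_nbrs k \<times> back_nbrs k))"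
    by (rule card_inj_on_le[of "\<lambda>((i, j), (k, l)). (k, (i, j))"]) (auto simp: inj_on_def K_def)
  also have "\<dots> = (\<Sum>k<n. (card (back_nbrs k))\<^sup>2)"
    by (simp add: card_SigmaI card_cartesian_product power2_eq_square)
  also have "card ?off \<le> card (c4_embeddings E)"
  proof (rule card_inj_on_le[of "\<lambda>((i, j), (k, l)). (v i, v k, v j, v l)"])
    show "inj_on (\<lambda>((i, j), (k, l)). (v i, v k, v j, v l)) ?off"
    proof (rule inj_onI)
      fix z z' assume z: "z \<in> ?off" "z' \<in> ?off"
        and eq: "(\<lambda>((i, j), (k, l)). (v i, v k, v j, v l)) z = (\<lambda>((i, j), (k, l)). (v i, v k, v j, v l)) z'"
      obtain i j k l where z1: "z = ((i, j), (k, l))" by (metis prod.exhaust)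
      obtain i' j' k' l' where z2: "z' = ((i', j'), (k', l'))" by (metis prod.exhaust)
      have b: "i < n" "j < n" "k < n" "l < n" "i' < n" "j' < n" "k' < n" "l' < n"
        using z by (simp_all add: z1 z2 pairs_def K_def)
      show "z = z'" using eq b v_neq[of i i'] v_neq[of j j'] v_neq[of k k'] v_neq[of l l']
        by (auto simp: z1 z2)
    qed
    show "(\<lambda>((i, j), (k, l)). (v i, v k, v j, v l)) ` ?off \<subseteq> c4_embeddings E"
    proof (rule image_subsetI)
      fix z assume z: "z \<in> ?off"
      obtain i j k l where z1: "z = ((i, j), (k, l))" by (metis prod.exhaust)
      have b: "i < n" "j < n" "k < n" "l < n" "i \<noteq> j" "k \<noteq> l"
        and e: "{v i, v k} \<in> E" "{v j, v k} \<in> E" "{v j, v l} \<in> E" "{v i, v l} \<in> E"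
        using z by (simp_all add: z1 pairs_def K_def back_nbrs_def)
      then show "(\<lambda>((i, j), (k, l)). (v i, v k, v j, v l)) z \<in> c4_embeddings E"
        using v_neq[of i j] v_neq[of k l] by (simp add: z1 c4_embeddings_def insert_commute)
    qed
  qed (rule finite_c4_embeddings[OF E_simple])
  finally have "(\<Sum>p\<in>pairs. (codegree p)\<^sup>2) \<le> (\<Sum>k<n. (card (back_nbrs k))\<^sup>2) + card (c4_embeddings E)"
    by simp
  then have "real (\<Sum>p\<in>pairs. (codegree p)\<^sup>2) \<le> real ((\<Sum>k<n. (card (back_nbrs k))\<^sup>2) + card (c4_embeddings E))"
    by (rule of_nat_mono)
  then show ?thesis by simp
qed

end

lemma degree_order_exists:
  obtains v where "bij_betw v {..<n} {1..n}"
    "\<And>i k. i < k \<Longrightarrow> k < n \<Longrightarrow> degree_in E (v k) \<le> degree_in E (v i)"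
proof
  define xs where "xs = rev (sort_key (degree_in E) [1..<Suc n])"
  have len: "length xs = n" by (simp add: xs_def)
  show "bij_betw ((!) xs) {..<n} {1..n}"
    by (rule bij_betw_nth) (auto simp: xs_def)
  have "sorted (map (degree_in E) (rev xs))" by (simp add: xs_def)
  then have sorted: "sorted (rev (map (degree_in E) xs))" by (simp add: rev_map)
  show "degree_in E (xs ! k) \<le> degree_in E (xs ! i)" if "i < k" "k < n" for i k
    using sorted_rev_nth_mono[OF sorted, of i k] that len by simp
qed

section \<open>The characteristic function for a fixed graph\<close>

text \<open>
  The quantity that governs the distance to the normal law: the density of four-cycles, and a
  term that vanishes as the number of edges grows.
\<close>

definition c4_error :: "nat set set \<Rightarrow> real" where
  "c4_error E = real (card (c4_embeddings E)) / (real (card E))\<^sup>2 + 2 / sqrt (real (card E))"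

definition char_const :: "nat \<Rightarrow> real \<Rightarrow> real" where
  "char_const c t = exp (t\<^sup>2 * (1 - 1 / real c + 1) / 2) *
     ((t\<^sup>2 + 2) * 2 + 2199 * real c * t\<^sup>2 + 2198 * (real c)\<^sup>2 * t ^ 4)"

text \<open>
  Interpolates the third absolute moment between the second and the fourth.
\<close>

lemma abs_cubed_le:
  assumes "\<delta> > (0::real)" shows "\<bar>x\<bar> ^ 3 \<le> \<delta> * x\<^sup>2 + x ^ 4 / \<delta>"
proof -
  have "0 \<le> x\<^sup>2 * ((\<delta> - \<bar>x\<bar>)\<^sup>2 + \<delta> * \<bar>x\<bar>)" using assms by simp
  also have "\<dots> = (\<delta> * x\<^sup>2 + x ^ 4 / \<delta>) * \<delta> - \<bar>x\<bar> ^ 3 * \<delta>"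
  proof -
    define u where "u = \<bar>x\<bar>"
    have x: "x\<^sup>2 = u\<^sup>2" "x ^ 4 = u ^ 4" by (simp_all add: u_def power_even_abs)
    have "u\<^sup>2 * ((\<delta> - u)\<^sup>2 + \<delta> * u) = \<delta> * u\<^sup>2 * \<delta> + u ^ 4 - u ^ 3 * \<delta>" by algebra
    then show ?thesis unfolding x u_def[symmetric] using assms by (simp add: distrib_right)
  qed
  finally have "\<bar>x\<bar> ^ 3 * \<delta> \<le> (\<delta> * x\<^sup>2 + x ^ 4 / \<delta>) * \<delta>" by simp
  then show ?thesis using assms by (rule mult_right_le_imp_le)
qed

context degree_ordered_graph begin

text \<open>
  Apply \<open>martingale_clt_bound\<close> to the normalized differences \<open>r * h k y\<close>. With
  \<open>\<alpha> = c4_error E\<close>, the variance of their accumulated conditional variance is at most \<open>2 \<alpha>\<close>, the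
  fourth moments sum up to \<open>O(\<alpha>)\<close> and the second moments to \<open>O(1)\<close>; the third absolute moments
  are therefore \<open>O(sqrt \<alpha>)\<close>.
\<close>

lemma char_sum_edge_kern:
  assumes e: "card E > 0"
  shows "norm (color_exp c n (\<lambda>y. iexp (t * (1 / sqrt (real (card E) / real c) * (\<Sum>e\<in>E. edge_kern c e y))))
      - exp (- (t\<^sup>2 * (1 - 1 / real c) / 2)))
    \<le> char_const c t * (sqrt (c4_error E) + c4_error E)"
proof -
  define r s where "r = 1 / sqrt (real (card E) / real c)" and "s = 1 - 1 / real c"
  define \<alpha> where "\<alpha> = c4_error E"
  define e where "e = real (card E)"
  have epos: "e > 0" using assms by (simp add: e_def)
  have cpos: "real c > 0" using c by simp
  have s: "s \<ge> 0" using c by (simp add: s_def)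
  have r2: "r\<^sup>2 = real c / e" using epos cpos by (simp add: r_def e_def power_divide)
  have \<alpha>_ge: "2 / sqrt e \<le> \<alpha>" by (simp add: \<alpha>_def c4_error_def e_def)
  have \<alpha>: "\<alpha> > 0" using \<alpha>_ge epos by (smt (verit) divide_pos_pos real_sqrt_gt_zero)
  have sqrt2e: "sqrt (2 * e) * e / e\<^sup>2 \<le> 2 / sqrt e"
  proof -
    have "sqrt (2 * e) * e / e\<^sup>2 = sqrt 2 * (sqrt e / e)"
      using epos by (simp add: real_sqrt_mult power2_eq_square)
    also have "sqrt e / e = 1 / sqrt e" using epos by (simp add: field_simps)
    also have "sqrt 2 * (1 / sqrt e) \<le> 2 * (1 / sqrt e)"
      using epos sqrt2_less_2 by (intro mult_right_mono) auto
    finally show ?thesis by simp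
  qed
  interpret M: color_martingale c n n v "\<lambda>k y. r * h k y" by (rule martingale_h)
  have Sn: "M.S n y = 1 / sqrt (real (card E) / real c) * (\<Sum>e\<in>E. edge_kern c e y)" for y
    unfolding M.S_def by (simp only: sum_distrib_left[symmetric] sum_h r_def)
  have sumD: "(\<Sum>k<n. real (card (back_nbrs k))) = e" unfolding e_def sum_card_back_nbrs[symmetric] by simp
  have sumD2: "(\<Sum>k<n. (real (card (back_nbrs k)))\<^sup>2) \<le> sqrt (2 * e) * e"
    using sum_card_back_nbrs_squared_le by (simp add: e_def)

  have 1: "color_exp c n (\<lambda>y. \<bar>M.V n y - s\<bar>) \<le> 2 * sqrt \<alpha>"
  proof -
    have "M.V n y - s = Q y / e" if "y \<in> set_pmf (coloring_pmf c n)" for y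
      unfolding V_martingale_h[OF that] r2 sum_card_back_nbrs e_def[symmetric] s_def[symmetric]
      using epos cpos by (simp add: field_simps)
    then have "color_exp c n (\<lambda>y. \<bar>M.V n y - s\<bar>) = color_exp c n (\<lambda>y. \<bar>Q y / e\<bar>)"
      by (intro color_exp_cong) simp
    moreover have "(color_exp c n (\<lambda>y. \<bar>Q y / e\<bar>))\<^sup>2 \<le> 2 * \<alpha>"
    proof -
      have "(color_exp c n (\<lambda>y. \<bar>Q y / e\<bar>))\<^sup>2 \<le> color_exp c n (\<lambda>y. (Q y / e)\<^sup>2)"
        by (rule color_exp_abs_squared_le[OF c])
      also have "\<dots> = color_exp c n (\<lambda>y. (Q y)\<^sup>2) / e\<^sup>2"
        by (simp only: power_divide integral_divide_zero)
      also have "\<dots> \<le> 2 * (real (card (c4_embeddings E)) + sqrt (2 * e) * e) / e\<^sup>2"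
        using color_exp_Q_squared sum_codegree_squared_le sumD2 by (intro divide_right_mono) auto
      also have "\<dots> = 2 * (real (card (c4_embeddings E)) / e\<^sup>2 + sqrt (2 * e) * e / e\<^sup>2)"
        by (simp add: add_divide_distrib)
      also have "\<dots> \<le> 2 * \<alpha>" using sqrt2e by (simp add: \<alpha>_def c4_error_def e_def)
      finally show ?thesis .
    qed
    moreover have "2 * \<alpha> \<le> (2 * sqrt \<alpha>)\<^sup>2" using \<alpha> by (simp add: power_mult_distrib)
    ultimately show ?thesis using \<alpha> by (simp only:) (rule power2_le_imp_le, auto)
  qed

  have 2: "(\<Sum>k<n. color_exp c n (\<lambda>y. \<bar>t * (r * h k y)\<bar> ^ 3 + (t * (r * h k y)) ^ 4))
      \<le> 2199 * real c * t\<^sup>2 * sqrt \<alpha> + 2198 * (real c)\<^sup>2 * t ^ 4 * (sqrt \<alpha> + \<alpha>)"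
  proof -
    \<comment> \<open>This \<open>\<delta>\<close> balances the two terms of \<open>abs_cubed_le\<close>, as the fourth moments are \<open>O(\<alpha>)\<close>.\<close>
    define \<delta> where "\<delta> = sqrt \<alpha>"
    have \<delta>: "\<delta> > 0" "\<delta>\<^sup>2 = \<alpha>" using \<alpha> by (simp_all add: \<delta>_def)
    have each: "color_exp c n (\<lambda>y. \<bar>t * (r * h k y)\<bar> ^ 3 + (t * (r * h k y)) ^ 4)
        \<le> \<delta> * t\<^sup>2 * r\<^sup>2 * 2199 * real (card (back_nbrs k)) + (1 / \<delta> + 1) * t ^ 4 * r ^ 4 * 2198 * (real (card (back_nbrs k)))\<^sup>2"
      if k: "k < n" for k
    proof -
      have "\<bar>t * (r * x)\<bar> ^ 3 + (t * (r * x)) ^ 4 \<le> \<delta> * t\<^sup>2 * r\<^sup>2 * x\<^sup>2 + (1 / \<delta> + 1) * t ^ 4 * r ^ 4 * x ^ 4" for x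
        using abs_cubed_le[OF \<delta>(1), of "t * (r * x)"] by (simp add: power_mult_distrib distrib_right mult.assoc)
      then have "color_exp c n (\<lambda>y. \<bar>t * (r * h k y)\<bar> ^ 3 + (t * (r * h k y)) ^ 4)
          \<le> color_exp c n (\<lambda>y. \<delta> * t\<^sup>2 * r\<^sup>2 * (h k y)\<^sup>2 + (1 / \<delta> + 1) * t ^ 4 * r ^ 4 * h k y ^ 4)"
        by (intro color_exp_mono[OF c])
      also have "\<dots> = \<delta> * t\<^sup>2 * r\<^sup>2 * color_exp c n (\<lambda>y. (h k y)\<^sup>2) + (1 / \<delta> + 1) * t ^ 4 * r ^ 4 * color_exp c n (\<lambda>y. h k y ^ 4)"
        by (simp only: color_exp_add[OF c] integral_mult_right_zero)
      also have "\<dots> \<le> \<delta> * t\<^sup>2 * r\<^sup>2 * (2199 * real (card (back_nbrs k))) + (1 / \<delta> + 1) * t ^ 4 * r ^ 4 * (2198 * (real (card (back_nbrs k)))\<^sup>2)"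
        using \<delta> by (intro add_mono mult_left_mono second_moment_h[OF k] fourth_moment_h[OF k] mult_nonneg_nonneg add_nonneg_nonneg) auto
      finally show ?thesis by (simp only: mult.assoc)
    qed
    have "(\<Sum>k<n. color_exp c n (\<lambda>y. \<bar>t * (r * h k y)\<bar> ^ 3 + (t * (r * h k y)) ^ 4))
        \<le> (\<Sum>k<n. \<delta> * t\<^sup>2 * r\<^sup>2 * 2199 * real (card (back_nbrs k)) + (1 / \<delta> + 1) * t ^ 4 * r ^ 4 * 2198 * (real (card (back_nbrs k)))\<^sup>2)"
      by (intro sum_mono each) auto
    also have "\<dots> = \<delta> * t\<^sup>2 * r\<^sup>2 * 2199 * e + (1 / \<delta> + 1) * t ^ 4 * r ^ 4 * 2198 * (\<Sum>k<n. (real (card (back_nbrs k)))\<^sup>2)"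
      by (simp only: sum.distrib sum_distrib_left[symmetric] sumD)
    also have "\<dots> \<le> \<delta> * t\<^sup>2 * r\<^sup>2 * 2199 * e + (1 / \<delta> + 1) * t ^ 4 * r ^ 4 * 2198 * (\<alpha> * e\<^sup>2)"
    proof -
      have "(\<Sum>k<n. (real (card (back_nbrs k)))\<^sup>2) \<le> \<alpha> * e\<^sup>2"
      proof -
        have "sqrt (2 * e) * e / e\<^sup>2 \<le> \<alpha>" using sqrt2e \<alpha>_ge by simp
        then have "sqrt (2 * e) * e \<le> \<alpha> * e\<^sup>2" using epos by (subst (asm) pos_divide_le_eq) auto
        then show ?thesis using sumD2 by simp
      qed
      then show ?thesis using \<delta> by (intro add_left_mono mult_left_mono mult_nonneg_nonneg add_nonneg_nonneg) auto
    qed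
    also have "r ^ 4 = (real c)\<^sup>2 / e\<^sup>2"
      using r2 by (metis (no_types, lifting) mult_2 numeral_Bit0 power2_eq_square power_add power_divide)
    also have "\<delta> * t\<^sup>2 * r\<^sup>2 * 2199 * e + (1 / \<delta> + 1) * t ^ 4 * ((real c)\<^sup>2 / e\<^sup>2) * 2198 * (\<alpha> * e\<^sup>2)
        = 2199 * real c * t\<^sup>2 * \<delta> + 2198 * (real c)\<^sup>2 * t ^ 4 * (\<alpha> / \<delta> + \<alpha>)"
      unfolding r2 using epos \<delta>(1) by (simp add: field_simps)
    also have "\<alpha> / \<delta> = \<delta>" using \<delta> by (simp add: power2_eq_square divide_eq_eq)
    finally show ?thesis by (simp only: \<delta>_def)
  qed
  have "norm (color_exp c n (\<lambda>y. iexp (t * M.S n y)) - exp (- (t\<^sup>2 * s / 2)))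
      \<le> exp (t\<^sup>2 * (s + 1) / 2) * ((t\<^sup>2 + 2) * color_exp c n (\<lambda>y. \<bar>M.V n y - s\<bar>)
        + (\<Sum>k<n. color_exp c n (\<lambda>y. \<bar>t * (r * h k y)\<bar> ^ 3 + (t * (r * h k y)) ^ 4)))"
    by (rule M.martingale_clt_bound[OF s])
  also have "\<dots> \<le> exp (t\<^sup>2 * (s + 1) / 2) * ((t\<^sup>2 + 2) * (2 * sqrt \<alpha>)
        + (2199 * real c * t\<^sup>2 * sqrt \<alpha> + 2198 * (real c)\<^sup>2 * t ^ 4 * (sqrt \<alpha> + \<alpha>)))"
    using 1 2 by (intro mult_left_mono add_mono) auto
  also have "\<dots> \<le> exp (t\<^sup>2 * (s + 1) / 2) * (((t\<^sup>2 + 2) * 2 + 2199 * real c * t\<^sup>2 + 2198 * (real c)\<^sup>2 * t ^ 4) * (sqrt \<alpha> + \<alpha>))"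
  proof (rule mult_left_mono)
    have "0 \<le> ((t\<^sup>2 + 2) * 2 + 2199 * real c * t\<^sup>2) * \<alpha>" using \<alpha> by auto
    then show "(t\<^sup>2 + 2) * (2 * sqrt \<alpha>)
        + (2199 * real c * t\<^sup>2 * sqrt \<alpha> + 2198 * (real c)\<^sup>2 * t ^ 4 * (sqrt \<alpha> + \<alpha>))
      \<le> ((t\<^sup>2 + 2) * 2 + 2199 * real c * t\<^sup>2 + 2198 * (real c)\<^sup>2 * t ^ 4) * (sqrt \<alpha> + \<alpha>)"
      by (simp add: algebra_simps)
  qed simp
  finally show ?thesis
    unfolding Sn s_def \<alpha>_def char_const_def mult.assoc .
qed

lemma sixth_moment_sum_edge_kern:
  "color_exp c n (\<lambda>y. (\<Sum>e\<in>E. edge_kern c e y) ^ 6) \<le> (169 * real (card E)) ^ 3"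
  using sixth_moment_sum_h[of n] unfolding sum_h sum_card_back_nbrs[symmetric] by simp

end

lemma degree_ordered_graph_exists:
  assumes "c \<ge> 1" "simple_edges n E"
  obtains v where "degree_ordered_graph c n v E"
proof -
  obtain v where v: "bij_betw v {..<n} {1..n}"
    "\<And>i k. i < k \<Longrightarrow> k < n \<Longrightarrow> degree_in E (v k) \<le> degree_in E (v i)"
    using degree_order_exists[of n E] by blast
  have "degree_ordered_graph c n v E"
  proof
    show "v k \<in> {1..n}" if "k < n" for k using bij_betwE[OF v(1)] that by blast
    show "inj_on v {..<n}" by (rule bij_betw_imp_inj_on[OF v(1)])
  qed (use assms v in auto)
  then show ?thesis by (rule that)
qed

lemma char_normalized_mono_edges:
  assumes "c \<ge> 1" "simple_edges n (edges H)" "card (edges H) > 0"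
  shows "norm (color_exp c n (\<lambda>y. iexp (t * normalized_mono_edges c H y)) - exp (- (t\<^sup>2 * (1 - 1 / real c) / 2)))
    \<le> char_const c t * (sqrt (c4_error (edges H)) + c4_error (edges H))"
proof -
  obtain v where "degree_ordered_graph c n v (edges H)"
    using degree_ordered_graph_exists[OF assms(1,2)] .
  then interpret degree_ordered_graph c n v "edges H" .
  have "color_exp c n (\<lambda>y. iexp (t * normalized_mono_edges c H y))
    = color_exp c n (\<lambda>y. iexp (t * (1 / sqrt (real (card (edges H)) / real c) * (\<Sum>e\<in>edges H. edge_kern c e y))))"
    using normalized_mono_edges_eq[OF assms(1,2)] by (intro color_exp_cong) simp
  then show ?thesis using char_sum_edge_kern[OF assms(3), of t] by (simp only:)
qed

lemma sixth_moment_normalized_mono_edges: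
  assumes "c \<ge> 1" "simple_edges n (edges H)"
  shows "color_exp c n (\<lambda>y. normalized_mono_edges c H y ^ 6) \<le> (169 * real c) ^ 3"
proof (cases "card (edges H) = 0")
  case True
  then show ?thesis by (simp add: normalized_mono_edges_def)
next
  case False
  obtain v where "degree_ordered_graph c n v (edges H)"
    using degree_ordered_graph_exists[OF assms(1,2)] .
  then interpret degree_ordered_graph c n v "edges H" .
  define r where "r = 1 / sqrt (real (card (edges H)) / real c)"
  have e: "real (card (edges H)) > 0" "real c > 0" using False assms by auto
  have "color_exp c n (\<lambda>y. normalized_mono_edges c H y ^ 6)
    = color_exp c n (\<lambda>y. r ^ 6 * (\<Sum>e\<in>edges H. edge_kern c e y) ^ 6)"
    using normalized_mono_edges_eq[OF assms(1,2)] by (intro color_exp_cong) (simp only: r_def power_mult_distrib)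
  also have "\<dots> = r ^ 6 * color_exp c n (\<lambda>y. (\<Sum>e\<in>edges H. edge_kern c e y) ^ 6)"
    by (simp only: integral_mult_right_zero)
  also have "\<dots> \<le> r ^ 6 * (169 * real (card (edges H))) ^ 3"
    by (intro mult_left_mono sixth_moment_sum_edge_kern) simp
  also have "r ^ 6 = (r\<^sup>2) ^ 3" by simp
  also have "r\<^sup>2 = real c / real (card (edges H))" using e by (simp add: r_def power_divide)
  also have "(real c / real (card (edges H))) ^ 3 * (169 * real (card (edges H))) ^ 3 = (169 * real c) ^ 3"
    using e by (simp flip: power_mult_distrib)
  finally show ?thesis .
qed

section \<open>Positivity of mixed moments through characters\<close>

lemma cis_int_period: "cis (2 * pi * of_int k) = 1"
  using cis_multiple_2pi[of "of_int k"] by simp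

text \<open>
  Orthogonality of the characters of \<open>\<int>/c\<close>, as a geometric sum.
\<close>

lemma sum_roots_of_unity:
  assumes c: "c \<ge> 1"
  shows "(\<Sum>a\<in>{1..c}. cis (2 * pi * real_of_int (m * int a) / real c)) = (if int c dvd m then of_nat c else 0)"
proof (cases "int c dvd m")
  case True
  then obtain k where k: "m = int c * k" by (rule dvdE)
  have "cis (2 * pi * real_of_int (m * int a) / real c) = 1" for a
  proof -
    have "2 * pi * real_of_int (m * int a) / real c = 2 * pi * of_int (k * int a)"
      using c by (simp add: k)
    then show ?thesis by (simp only: cis_int_period)
  qed
  then show ?thesis using True by simp
next
  case False
  define z where "z = cis (2 * pi * real_of_int m / real c)"
  have pw: "cis (2 * pi * real_of_int (m * int a) / real c) = z ^ a" for a
    unfolding z_def Complex.DeMoivre by (simp add: field_simps)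
  have zc: "z ^ c = 1"
  proof -
    have "z ^ c = cis (2 * pi * of_int m)" unfolding z_def Complex.DeMoivre using c by simp
    then show ?thesis by (simp only: cis_int_period)
  qed
  have "z \<noteq> 1"
  proof
    assume "z = 1"
    then have "cos (2 * pi * real_of_int m / real c) = 1" by (metis z_def cis.sel(1) one_complex.sel(1))
    then obtain k :: int where "2 * pi * real_of_int m / real c = real_of_int k * 2 * pi"
      by (auto simp: cos_one_2pi_int)
    then have "real_of_int m = real_of_int (int c * k)" using c by (simp add: field_simps)
    then have "m = int c * k" by (simp only: of_int_eq_iff)
    then show False using False by simp
  qed
  moreover have "(\<Sum>a\<in>{1..c}. z ^ a) * (z - 1) = 0"
  proof -
    have "(\<Sum>a\<in>{1..c}. z ^ a) = z * (\<Sum>i<c. z ^ i)"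
      unfolding One_nat_def sum.atLeast1_atMost_eq by (simp add: sum_distrib_left)
    moreover have "(\<Sum>i<c. z ^ i) * (z - 1) = 0"
      using power_diff_1_eq[of z c] zc by (simp add: mult.commute)
    ultimately show ?thesis by simp
  qed
  ultimately have "(\<Sum>a\<in>{1..c}. z ^ a) = 0" by simp
  then show ?thesis using False by (simp only: pw if_False)
qed

text \<open>
  A character of the group \<open>(\<int>/c)\<^sup>n\<close> of colorings.
\<close>

definition color_char :: "nat \<Rightarrow> nat \<Rightarrow> (nat \<Rightarrow> int) \<Rightarrow> (nat \<Rightarrow> nat) \<Rightarrow> complex" where
  "color_char c n m y = cis (2 * pi * real_of_int (\<Sum>x\<in>{1..n}. m x * int (y x)) / real c)"

lemma color_char_mult: "color_char c n m y * color_char c n m' y = color_char c n (\<lambda>x. m x + m' x) y"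
  by (simp add: color_char_def cis_mult sum.distrib distrib_left distrib_right add_divide_distrib)

lemma color_exp_color_char:
  assumes c: "c \<ge> 1"
  shows "color_exp c n (color_char c n m) = (if \<forall>x\<in>{1..n}. int c dvd m x then 1 else 0)"
proof (cases "\<forall>x\<in>{1..n}. int c dvd m x")
  case True
  have "color_char c n m y = 1" for y
  proof -
    have "int c dvd (\<Sum>x\<in>{1..n}. m x * int (y x))" using True by (intro dvd_sum) auto
    then obtain k where k: "(\<Sum>x\<in>{1..n}. m x * int (y x)) = int c * k" by (rule dvdE)
    have "2 * pi * real_of_int (int c * k) / real c = 2 * pi * of_int k" using c by simp
    then show ?thesis unfolding color_char_def k by (simp only: cis_int_period)
  qed
  then have "color_char c n m = (\<lambda>_. 1)" by (rule ext)
  then show ?thesis using True by simp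
next
  case False
  then obtain x where x: "x \<in> {1..n}" "\<not> int c dvd m x" by blast
  have "recolor_avg c x (color_char c n m) y = 0" for y
  proof -
    let ?s = "\<Sum>z\<in>{1..n} - {x}. m z * int (y z)"
    have "(\<Sum>z\<in>{1..n}. m z * int ((y(x := a)) z)) = m x * int a + ?s" for a
      using x(1) by (subst sum.remove[of _ x]) auto
    then have "color_char c n m (y(x := a))
        = cis (2 * pi * real_of_int (m x * int a) / real c) * cis (2 * pi * real_of_int ?s / real c)" for a
      unfolding color_char_def by (simp only: cis_mult of_int_add distrib_left add_divide_distrib)
    then have "(\<Sum>a\<in>{1..c}. color_char c n m (y(x := a))) = 0"
      using sum_roots_of_unity[OF c, of "m x"] x(2) by (simp only: sum_distrib_right[symmetric]) simp
    then show ?thesis by (simp add: recolor_avg_def)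
  qed
  then have "color_exp c n (color_char c n m) = 0" by (rule color_exp_eq_0I[OF c x(1)])
  then show ?thesis using False by (simp only: if_False)
qed

text \<open>
  Finite combinations of characters with nonnegative coefficients. They are closed under
  products, and their means are nonnegative.
\<close>

inductive char_cone :: "nat \<Rightarrow> nat \<Rightarrow> ((nat \<Rightarrow> nat) \<Rightarrow> complex) \<Rightarrow> bool" for c n where
  zero: "char_cone c n (\<lambda>y. 0)"
| add_char: "char_cone c n F \<Longrightarrow> r \<ge> 0 \<Longrightarrow> char_cone c n (\<lambda>y. complex_of_real r * color_char c n m y + F y)"

lemma char_cone_add:
  assumes "char_cone c n F" "char_cone c n H" shows "char_cone c n (\<lambda>y. F y + H y)"
  using assms(1)
proof induction
  case (add_char F r m)
  from char_cone.add_char[OF add_char.IH add_char.hyps(2), of m] show ?case by (simp only: add.assoc)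
qed (use assms(2) in simp)

lemma char_cone_mult_char:
  assumes "char_cone c n F" "r \<ge> 0"
  shows "char_cone c n (\<lambda>y. complex_of_real r * color_char c n m y * F y)"
  using assms(1)
proof induction
  case (add_char F q m')
  have "char_cone c n (\<lambda>y. complex_of_real (r * q) * color_char c n (\<lambda>x. m x + m' x) y
      + complex_of_real r * color_char c n m y * F y)"
    using add_char.IH add_char.hyps(2) assms(2) by (intro char_cone.add_char) auto
  then show ?case by (simp only: color_char_mult[symmetric] distrib_left of_real_mult mult.assoc mult.left_commute)
qed (simp add: char_cone.zero)

lemma char_cone_mult:
  assumes "char_cone c n F" "char_cone c n H" shows "char_cone c n (\<lambda>y. F y * H y)"
  using assms(1)
proof induction
  case (add_char F r m)
  from char_cone_add[OF char_cone_mult_char[OF assms(2) add_char.hyps(2)] add_char.IH, of m]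
  show ?case by (simp only: distrib_right)
qed (simp add: char_cone.zero)

lemma char_cone_sum:
  assumes "\<And>i. i \<in> I \<Longrightarrow> char_cone c n (F i)" shows "char_cone c n (\<lambda>y. \<Sum>i\<in>I. F i y)"
  using assms
  by (induction I rule: infinite_finite_induct) (auto intro: char_cone.zero char_cone_add)

lemma char_cone_color_exp_nonneg:
  assumes "c \<ge> 1" "char_cone c n F" shows "\<exists>r\<ge>0. color_exp c n F = complex_of_real r"
  using assms(2)
proof induction
  case zero
  then show ?case by (intro exI[of _ 0]) simp
next
  case (add_char F q m)
  obtain r where r: "r \<ge> 0" "color_exp c n F = complex_of_real r" using add_char.IH by blast
  have "color_exp c n (\<lambda>y. complex_of_real q * color_char c n m y + F y)
      = complex_of_real q * color_exp c n (color_char c n m) + color_exp c n F"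
    by (simp only: color_exp_add[OF assms(1)] integral_mult_right_zero)
  also have "\<dots> = complex_of_real (q * (if \<forall>x\<in>{1..n}. int c dvd m x then 1 else 0) + r)"
    unfolding color_exp_color_char[OF assms(1)] r(2) by simp
  finally show ?case using r(1) add_char.hyps(2)
    by (intro exI[of _ "q * (if \<forall>x\<in>{1..n}. int c dvd m x then 1 else 0) + r"]) simp
qed

text \<open>
  The indicator of \<open>y u = y w\<close> is the average of all characters of \<open>\<int>/c\<close> at
  \<open>y u - y w\<close>; subtracting \<open>1/c\<close> removes the trivial one. The remaining coefficients are \<open>1/c\<close>,
  and it is their sign that matters.
\<close>

lemma kern_char_expansion:
  assumes c: "c \<ge> 1" and u: "u \<in> {1..n}" and w: "w \<in> {1..n}" and uw: "u \<noteq> w"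
    and y: "y \<in> set_pmf (coloring_pmf c n)"
  shows "complex_of_real (kern c (y u) (y w)) = (\<Sum>r\<in>{1..<c}. complex_of_real (1 / real c) *
    color_char c n (\<lambda>x. (if x = u then int r else 0) - (if x = w then int r else 0)) y)"
proof -
  let ?d = "int (y u) - int (y w)"
  have col: "y u \<in> {1..c}" "y w \<in> {1..c}" using coloring_color[OF c y] u w by auto
  have "(\<Sum>x\<in>{1..n}. ((if x = u then int r else 0) - (if x = w then int r else 0)) * int (y x)) = ?d * int r" for r
  proof -
    have "(\<Sum>x\<in>{1..n}. ((if x = u then int r else 0) - (if x = w then int r else 0)) * int (y x))
      = (\<Sum>x\<in>{1..n}. (if x = u then int r * int (y x) else 0)) - (\<Sum>x\<in>{1..n}. (if x = w then int r * int (y x) else 0))"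
      unfolding sum_subtractf[symmetric] by (intro sum.cong) auto
    also have "\<dots> = ?d * int r" using u w by (simp add: algebra_simps)
    finally show ?thesis .
  qed
  then have char: "color_char c n (\<lambda>x. (if x = u then int r else 0) - (if x = w then int r else 0)) y
      = cis (2 * pi * real_of_int (?d * int r) / real c)" for r
    by (simp only: color_char_def)
  have split: "{1..c} = insert c {1..<c}" using c by auto
  have "cis (2 * pi * real_of_int (?d * int c) / real c) = 1"
  proof -
    have "2 * pi * real_of_int (?d * int c) / real c = 2 * pi * of_int ?d" using c by simp
    then show ?thesis by (simp only: cis_int_period)
  qed
  then have "1 + (\<Sum>r\<in>{1..<c}. cis (2 * pi * real_of_int (?d * int r) / real c))
      = (if int c dvd ?d then of_nat c else 0)"
    using sum_roots_of_unity[OF c, of ?d] unfolding split by (subst (asm) sum.insert) auto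
  moreover have "int c dvd ?d \<longleftrightarrow> y u = y w"
  proof
    assume "int c dvd ?d"
    moreover have "\<bar>?d\<bar> < int c" using col by auto
    ultimately have "?d = 0" using zdvd_imp_le[of "int c" "\<bar>?d\<bar>"] by fastforce
    then show "y u = y w" by simp
  qed simp
  ultimately have "(\<Sum>r\<in>{1..<c}. cis (2 * pi * real_of_int (?d * int r) / real c))
      = (if y u = y w then of_nat c else 0) - 1"
    by (simp add: algebra_simps)
  then show ?thesis
    unfolding char sum_distrib_left[symmetric] using col c by (auto simp: kern_def field_simps)
qed

text \<open>
  The edges may coincide in any way. Up to a factor \<open>c\<^sup>4\<close> the mean is the number of
  nowhere-zero \<open>\<int>/c\<close>-flows on the multigraph formed by the four edges.
\<close>

lemma color_exp_edge_kerns_nonneg: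
  assumes c: "c \<ge> 1" and E: "simple_edges n E"
    and e: "e1 \<in> E" "e2 \<in> E" "e3 \<in> E" "e4 \<in> E"
  shows "0 \<le> color_exp c n (\<lambda>y. edge_kern c e1 y * edge_kern c e2 y * edge_kern c e3 y * edge_kern c e4 y)"
proof -
  have ex: "\<exists>F. char_cone c n F \<and> (\<forall>y\<in>set_pmf (coloring_pmf c n). complex_of_real (edge_kern c e y) = F y)" if eE: "e \<in> E" for e
  proof -
    obtain u w where uw: "e = {u, w}" "u \<noteq> w" "u \<in> {1..n}" "w \<in> {1..n}"
      using simple_edges_obtain[OF E eE] .
    let ?F = "\<lambda>y. \<Sum>r\<in>{1..<c}. complex_of_real (1 / real c) *
      color_char c n (\<lambda>x. (if x = u then int r else 0) - (if x = w then int r else 0)) y"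
    have "char_cone c n (\<lambda>y. complex_of_real (1 / real c) * color_char c n m y)" for m
      using char_cone.add_char[OF char_cone.zero, of "1 / real c"] by simp
    then have "char_cone c n ?F" by (intro char_cone_sum)
    moreover have "complex_of_real (edge_kern c e y) = ?F y" if "y \<in> set_pmf (coloring_pmf c n)" for y
      unfolding uw(1) edge_kern_doubleton using kern_char_expansion[OF c uw(3,4,2) that] .
    ultimately show ?thesis by blast
  qed
  obtain F1 where F1: "char_cone c n F1"
    and eq1: "\<forall>y\<in>set_pmf (coloring_pmf c n). complex_of_real (edge_kern c e1 y) = F1 y"
    using ex[OF e(1)] by (elim exE conjE)
  obtain F2 where F2: "char_cone c n F2"
    and eq2: "\<forall>y\<in>set_pmf (coloring_pmf c n). complex_of_real (edge_kern c e2 y) = F2 y"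
    using ex[OF e(2)] by (elim exE conjE)
  obtain F3 where F3: "char_cone c n F3"
    and eq3: "\<forall>y\<in>set_pmf (coloring_pmf c n). complex_of_real (edge_kern c e3 y) = F3 y"
    using ex[OF e(3)] by (elim exE conjE)
  obtain F4 where F4: "char_cone c n F4"
    and eq4: "\<forall>y\<in>set_pmf (coloring_pmf c n). complex_of_real (edge_kern c e4 y) = F4 y"
    using ex[OF e(4)] by (elim exE conjE)
  let ?p = "\<lambda>y. edge_kern c e1 y * edge_kern c e2 y * edge_kern c e3 y * edge_kern c e4 y"
  obtain r where r: "r \<ge> 0" "color_exp c n (\<lambda>y. F1 y * F2 y * F3 y * F4 y) = complex_of_real r"
    using char_cone_color_exp_nonneg[OF c char_cone_mult[OF char_cone_mult[OF char_cone_mult[OF F1 F2] F3] F4]]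
    by (elim exE conjE)
  have "complex_of_real (color_exp c n ?p) = color_exp c n (\<lambda>y. complex_of_real (?p y))"
    by (rule integral_complex_of_real[symmetric])
  also have "\<dots> = color_exp c n (\<lambda>y. F1 y * F2 y * F3 y * F4 y)"
    by (rule color_exp_cong) (simp only: of_real_mult eq1 eq2 eq3 eq4)
  finally have "color_exp c n ?p = r" unfolding r(2) by (simp only: of_real_eq_iff)
  then show ?thesis using r(1) by simp
qed

section \<open>A lower bound for the fourth moment\<close>

lemma edge_kern_upd:
  assumes "x \<notin> e" "e = {a, b}" shows "edge_kern c e (y(x := z)) = edge_kern c e y"
  unfolding assms(2) edge_kern_doubleton using assms by simp

lemma color_exp_edge_kern_squared:
  assumes "c \<ge> 1" "simple_edges n E" "e \<in> E"
  shows "color_exp c n (\<lambda>y. edge_kern c e y * edge_kern c e y) = (1 - 1 / real c) / real c"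
proof -
  obtain a b where ab: "e = {a, b}" "a \<noteq> b" "a \<in> {1..n}" "b \<in> {1..n}"
    using simple_edges_obtain[OF assms(2,3)] .
  show ?thesis unfolding ab(1) edge_kern_doubleton
    using color_exp_kern_squared[OF assms(1) ab(3,4,2)] .
qed

text \<open>
  Some end of \<open>e\<close> does not lie on \<open>f\<close>. Averaging over its color makes the first square constant,
  even if the edges share their other end.
\<close>

lemma color_exp_two_edges:
  assumes c: "c \<ge> 1" and E: "simple_edges n E" and ef: "e \<in> E" "f \<in> E" "e \<noteq> f"
  shows "color_exp c n (\<lambda>y. edge_kern c e y * edge_kern c e y * (edge_kern c f y * edge_kern c f y))
    = ((1 - 1 / real c) / real c)\<^sup>2"
proof -
  obtain a b where ab: "e = {a, b}" "a \<noteq> b" "a \<in> {1..n}" "b \<in> {1..n}"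
    using simple_edges_obtain[OF E ef(1)] .
  obtain p q where pq: "f = {p, q}" "p \<noteq> q" "p \<in> {1..n}" "q \<in> {1..n}"
    using simple_edges_obtain[OF E ef(2)] .
  have "a \<notin> f \<or> b \<notin> f" using ab pq ef(3) by auto
  then obtain x w where xw: "e = {x, w}" "x \<noteq> w" "x \<in> {1..n}" "w \<in> {1..n}" "x \<notin> f"
    using ab by (metis insert_commute)
  let ?F = "\<lambda>y. edge_kern c f y * edge_kern c f y" and ?H = "\<lambda>y. edge_kern c e y * edge_kern c e y"
  have F: "?F (y(x := z)) = ?F y" for y z by (simp only: edge_kern_upd[OF xw(5) pq(1)])
  have H: "recolor_avg c x ?H y = kern c (y w) (y w) / real c" for y
    unfolding xw(1) edge_kern_doubleton by (rule recolor_avg_kern_kern[OF xw(2,2)])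
  have "color_exp c n (\<lambda>y. ?H y * ?F y) = color_exp c n (\<lambda>y. ?F y * ?H y)"
    by (simp only: mult.commute)
  also have "\<dots> = color_exp c n (recolor_avg c x (\<lambda>y. ?F y * ?H y))"
    by (rule color_exp_recolor_avg[OF c xw(3), symmetric])
  also have "recolor_avg c x (\<lambda>y. ?F y * ?H y) = (\<lambda>y. ?F y * (kern c (y w) (y w) / real c))"
    by (rule ext) (simp only: recolor_avg_mult[where F = ?F and H = ?H, OF F] H)
  also have "color_exp c n \<dots> = color_exp c n (\<lambda>y. ?F y * ((1 - 1 / real c) / real c))"
    by (rule color_exp_cong) (use coloring_color[OF c _ xw(4)] in \<open>auto simp: kern_def\<close>)
  also have "\<dots> = color_exp c n ?F * ((1 - 1 / real c) / real c)"
    by (simp only: integral_mult_left_zero)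
  finally show ?thesis unfolding color_exp_edge_kern_squared[OF c E ef(2)] power2_eq_square .
qed

text \<open>
  Average over the colors of the two opposite vertices \<open>q\<close> and \<open>t\<close>. Each contracts its two
  kernels to \<open>kern c (y p) (y s) / c\<close>, and the variance of a kernel remains.
\<close>

lemma color_exp_c4:
  assumes c: "c \<ge> 1" and r: "p \<in> {1..n}" "q \<in> {1..n}" "s \<in> {1..n}" "t \<in> {1..n}"
    and d: "p \<noteq> q" "q \<noteq> s" "s \<noteq> t" "t \<noteq> p" "p \<noteq> s" "q \<noteq> t"
  shows "color_exp c n (\<lambda>y. kern c (y p) (y q) * kern c (y q) (y s) * kern c (y s) (y t) * kern c (y t) (y p))
    = (1 - 1 / real c) / real c ^ 3"
proof -
  let ?F = "\<lambda>y. kern c (y s) (y t) * kern c (y t) (y p)"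
    and ?H = "\<lambda>y. kern c (y q) (y p) * kern c (y q) (y s)"
  let ?H' = "\<lambda>y. kern c (y t) (y s) * kern c (y t) (y p)"
    and ?F' = "\<lambda>y. kern c (y p) (y s)"
  have F: "?F (y(q := z)) = ?F y" for y z using d by simp
  have F': "?F' (y(t := z)) = ?F' y" for y z using d by simp
  have H: "recolor_avg c q ?H y = kern c (y p) (y s) / real c" for y
    by (rule recolor_avg_kern_kern) (use d in auto)
  have H': "recolor_avg c t ?H' y = kern c (y s) (y p) / real c" for y
    by (rule recolor_avg_kern_kern) (use d in auto)
  have "color_exp c n (\<lambda>y. kern c (y p) (y q) * kern c (y q) (y s) * kern c (y s) (y t) * kern c (y t) (y p))
      = color_exp c n (\<lambda>y. ?F y * ?H y)"
    by (rule color_exp_cong) (simp add: kern_commute[of c "_ p" "_ q"])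
  also have "\<dots> = color_exp c n (recolor_avg c q (\<lambda>y. ?F y * ?H y))"
    by (rule color_exp_recolor_avg[OF c r(2), symmetric])
  also have "recolor_avg c q (\<lambda>y. ?F y * ?H y) = (\<lambda>y. ?F y * (kern c (y p) (y s) / real c))"
    by (rule ext) (simp only: recolor_avg_mult[where F = ?F and H = ?H, OF F] H)
  also have "color_exp c n \<dots> = color_exp c n (\<lambda>y. (?F' y * ?H' y) / real c)"
    by (rule color_exp_cong) (simp add: kern_commute[of c "_ s" "_ t"])
  also have "\<dots> = color_exp c n (\<lambda>y. ?F' y * ?H' y) / real c"
    by (simp only: integral_divide_zero)
  also have "color_exp c n (\<lambda>y. ?F' y * ?H' y) = color_exp c n (recolor_avg c t (\<lambda>y. ?F' y * ?H' y))"
    by (rule color_exp_recolor_avg[OF c r(4), symmetric])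
  also have "recolor_avg c t (\<lambda>y. ?F' y * ?H' y) = (\<lambda>y. (kern c (y p) (y s) * kern c (y p) (y s)) / real c)"
    by (rule ext) (simp only: recolor_avg_mult[where F = ?F' and H = ?H', OF F'] H' kern_commute[of c "_ s" "_ p"] times_divide_eq_right)
  also have "color_exp c n \<dots> = (1 - 1 / real c) / real c / real c"
    by (simp only: integral_divide_zero color_exp_kern_squared[OF c r(1,3) d(5)])
  finally show ?thesis by (simp add: power3_eq_cube)
qed

text \<open>
  In the expansion over quadruples of edges all terms are nonnegative, so it suffices to keep
  the four disjoint families of pairings and of four-cycles.
\<close>

lemma fourth_moment_ge:
  assumes c: "c \<ge> 1" and E: "simple_edges n E"
  shows "3 * ((1 - 1 / real c) / real c)\<^sup>2 * (real (card E) * (real (card E) - 1))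
      + (1 - 1 / real c) / real c ^ 3 * real (card (c4_embeddings E))
    \<le> color_exp c n (\<lambda>y. (\<Sum>e\<in>E. edge_kern c e y) ^ 4)"
proof -
  have finE: "finite E" by (rule simple_edges_finite[OF E])
  define \<tau> where "\<tau> = (\<lambda>(e1, e2, e3, e4). color_exp c n (\<lambda>y. edge_kern c e1 y * edge_kern c e2 y * edge_kern c e3 y * edge_kern c e4 y))"
  let ?E4 = "E \<times> E \<times> E \<times> E"
  define OD where "OD = {(e, f). e \<in> E \<and> f \<in> E \<and> e \<noteq> f}"
  define C where "C = c4_embeddings E"
  have finOD: "finite OD" unfolding OD_def by (rule finite_subset[of _ "E \<times> E"]) (use finE in auto)
  have finC: "finite C" unfolding C_def by (rule finite_c4_embeddings[OF E])
  define f1 f2 f3 where "f1 = (\<lambda>(e::nat set, f::nat set). (e, e, f, f))"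
    and "f2 = (\<lambda>(e::nat set, f::nat set). (e, f, e, f))" and "f3 = (\<lambda>(e::nat set, f::nat set). (e, f, f, e))"
  define f4 where "f4 = (\<lambda>(p::nat, q::nat, s::nat, t::nat). ({p, q}, {q, s}, {s, t}, {t, p}))"
  have cardOD: "real (card OD) = real (card E) * (real (card E) - 1)"
  proof -
    have "OD = (E \<times> E) - (\<lambda>e. (e, e)) ` E" by (auto simp: OD_def)
    moreover have "card ((\<lambda>e. (e, e)) ` E) = card E" by (rule card_image) (auto simp: inj_on_def)
    ultimately have "card OD = card E * card E - card E"
      using finE by (simp add: card_Diff_subset image_subset_iff card_cartesian_product)
    moreover have "card E \<le> card E * card E" by (cases "card E") auto
    ultimately show ?thesis by (simp add: of_nat_diff right_diff_distrib)
  qed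
  have \<tau>_nonneg: "0 \<le> \<tau> z" if "z \<in> ?E4" for z
    using that color_exp_edge_kerns_nonneg[OF c E] by (auto simp: \<tau>_def)
  have expand: "color_exp c n (\<lambda>y. (\<Sum>e\<in>E. edge_kern c e y) ^ 4) = sum \<tau> ?E4"
  proof -
    have pw: "(\<Sum>e\<in>E. edge_kern c e y) ^ 4 = (\<Sum>e1\<in>E. \<Sum>e2\<in>E. \<Sum>e3\<in>E. \<Sum>e4\<in>E.
        edge_kern c e1 y * edge_kern c e2 y * edge_kern c e3 y * edge_kern c e4 y)" for y
    proof -
      have "x ^ 4 = x * x * x * x" for x :: real by algebra
      then show ?thesis by (simp only: sum_distrib_left[symmetric] sum_distrib_right[symmetric])
    qed
    show ?thesis unfolding pw color_exp_sum[OF c] \<tau>_def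
      by (simp add: sum.cartesian_product split_def)
  qed
  have sub: "f1 ` OD \<subseteq> ?E4" "f2 ` OD \<subseteq> ?E4" "f3 ` OD \<subseteq> ?E4" "f4 ` C \<subseteq> ?E4"
    by (auto simp: f1_def f2_def f3_def f4_def OD_def C_def c4_embeddings_def)
  have inj: "inj_on f1 OD" "inj_on f2 OD" "inj_on f3 OD"
    by (auto simp: inj_on_def f1_def f2_def f3_def)
  \<comment> \<open>In a pairing the first edge occurs twice; in a four-cycle it does not. This keeps the two
    kinds of quadruples apart.\<close>
  have f4_ne: "{p, q} \<noteq> {q, s} \<and> {p, q} \<noteq> {s, t} \<and> {p, q} \<noteq> {t, p}" if "(p, q, s, t) \<in> C" for p q s t
    using that simple_edges_neq[OF E] by (auto simp: C_def c4_embeddings_def doubleton_eq_iff)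
  have injC: "inj_on f4 C"
  proof (rule inj_onI)
    fix z z' assume z: "z \<in> C" "z' \<in> C" and eq: "f4 z = f4 z'"
    obtain p q s t where z1: "z = (p, q, s, t)" by (metis prod.exhaust)
    obtain p' q' s' t' where z2: "z' = (p', q', s', t')" by (metis prod.exhaust)
    have 1: "{p, q} = {p', q'}" "{q, s} = {q', s'}" "{s, t} = {s', t'}" "{t, p} = {t', p'}"
      using eq by (auto simp: f4_def z1 z2)
    have 2: "p \<noteq> s" "q \<noteq> t" "p' \<noteq> s'" "q' \<noteq> t'"
      using z by (auto simp: C_def c4_embeddings_def z1 z2)
    have "{p, q} \<inter> {q, s} = {q}" "{p', q'} \<inter> {q', s'} = {q'}" using 2 by auto
    then have q: "q = q'" using 1 by auto
    then have "p = p'" "s = s'" using 1 by (auto simp: doubleton_eq_iff)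
    moreover have "t = t'" using 1(4) \<open>p = p'\<close> by (auto simp: doubleton_eq_iff)
    ultimately show "z = z'" using q by (simp add: z1 z2)
  qed
  have disj: "f1 ` OD \<inter> f2 ` OD = {}" "(f1 ` OD \<union> f2 ` OD) \<inter> f3 ` OD = {}"
    by (auto simp: f1_def f2_def f3_def OD_def)
  have disjC: "(f1 ` OD \<union> f2 ` OD \<union> f3 ` OD) \<inter> f4 ` C = {}"
  proof -
    have "f4 z \<notin> f1 ` OD \<union> f2 ` OD \<union> f3 ` OD" if z: "z \<in> C" for z
    proof -
      obtain p q s t where z1: "z = (p, q, s, t)" by (metis prod.exhaust)
      show ?thesis using f4_ne[of p q s t] z unfolding z1 f4_def f1_def f2_def f3_def by auto
    qed
    then show ?thesis unfolding disjoint_iff by (metis imageE)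
  qed
  have two: "\<tau> (f1 z) = ((1 - 1 / real c) / real c)\<^sup>2" "\<tau> (f2 z) = ((1 - 1 / real c) / real c)\<^sup>2"
    "\<tau> (f3 z) = ((1 - 1 / real c) / real c)\<^sup>2" if z: "z \<in> OD" for z
  proof -
    obtain e f where ef: "z = (e, f)" by (cases z)
    have "e \<in> E" "f \<in> E" "e \<noteq> f" using z by (auto simp: OD_def ef)
    note * = color_exp_two_edges[OF c E this]
    show "\<tau> (f1 z) = ((1 - 1 / real c) / real c)\<^sup>2" "\<tau> (f2 z) = ((1 - 1 / real c) / real c)\<^sup>2"
      "\<tau> (f3 z) = ((1 - 1 / real c) / real c)\<^sup>2"
      unfolding *[symmetric] by (simp_all add: \<tau>_def ef f1_def f2_def f3_def ac_simps)
  qed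
  have four: "\<tau> (f4 z) = (1 - 1 / real c) / real c ^ 3" if z: "z \<in> C" for z
  proof -
    obtain p q s t where z1: "z = (p, q, s, t)" by (metis prod.exhaust)
    have e: "{p, q} \<in> E" "{q, s} \<in> E" "{s, t} \<in> E" "{t, p} \<in> E" and d: "p \<noteq> s" "q \<noteq> t"
      using z by (auto simp: z1 C_def c4_embeddings_def)
    note r = e[THEN simple_edges_range[OF E]] and d' = e[THEN simple_edges_neq[OF E]]
    show ?thesis
      using color_exp_c4[OF c, of p n q s t] r d' d
      by (simp add: z1 f4_def \<tau>_def edge_kern_doubleton)
  qed
  have "3 * ((1 - 1 / real c) / real c)\<^sup>2 * real (card OD) + (1 - 1 / real c) / real c ^ 3 * real (card C)
      = sum \<tau> (f1 ` OD) + sum \<tau> (f2 ` OD) + sum \<tau> (f3 ` OD) + sum \<tau> (f4 ` C)"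
    using two four by (simp add: sum.reindex[OF inj(1)] sum.reindex[OF inj(2)] sum.reindex[OF inj(3)] sum.reindex[OF injC])
  also have "\<dots> = sum \<tau> (f1 ` OD \<union> f2 ` OD \<union> f3 ` OD \<union> f4 ` C)"
    using disj disjC finOD finC by (simp add: sum.union_disjoint)
  also have "\<dots> \<le> sum \<tau> ?E4"
    using sub finE \<tau>_nonneg by (intro sum_mono2) auto
  finally show ?thesis unfolding expand cardOD C_def .
qed

lemma fourth_moment_normalized_ge:
  assumes c: "c \<ge> 1" and H: "simple_edges n (edges H)" and e: "card (edges H) > 0"
  shows "3 * (1 - 1 / real c)\<^sup>2 * (1 - 1 / real (card (edges H)))
      + (1 - 1 / real c) / real c * (real (card (c4_embeddings (edges H))) / (real (card (edges H)))\<^sup>2)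
    \<le> color_exp c n (\<lambda>y. normalized_mono_edges c H y ^ 4)"
proof -
  define r where "r = 1 / sqrt (real (card (edges H)) / real c)"
  define \<epsilon> where "\<epsilon> = real (card (edges H))"
  have pos: "\<epsilon> > 0" "real c > 0" using e c by (auto simp: \<epsilon>_def)
  have r2: "r\<^sup>2 = real c / \<epsilon>" using pos by (simp add: r_def \<epsilon>_def power_divide)
  have r4: "r ^ 4 = (real c / \<epsilon>)\<^sup>2" unfolding r2[symmetric] by simp
  have "3 * (1 - 1 / real c)\<^sup>2 * (1 - 1 / \<epsilon>)
      + (1 - 1 / real c) / real c * (real (card (c4_embeddings (edges H))) / \<epsilon>\<^sup>2)
      = r ^ 4 * (3 * ((1 - 1 / real c) / real c)\<^sup>2 * (\<epsilon> * (\<epsilon> - 1))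
      + (1 - 1 / real c) / real c ^ 3 * real (card (c4_embeddings (edges H))))"
  proof -
    have "3 * s\<^sup>2 * (1 - 1 / \<epsilon>) + s / k * (M / \<epsilon>\<^sup>2) = (k / \<epsilon>)\<^sup>2 * (3 * (s / k)\<^sup>2 * (\<epsilon> * (\<epsilon> - 1)) + s / k ^ 3 * M)"
      if "k > 0" for s k M :: real
      using that pos by (simp add: field_simps power2_eq_square power3_eq_cube)
    then show ?thesis unfolding r4 using pos(2) by blast
  qed
  also have "\<dots> \<le> r ^ 4 * color_exp c n (\<lambda>y. (\<Sum>e\<in>edges H. edge_kern c e y) ^ 4)"
    unfolding \<epsilon>_def by (intro mult_left_mono fourth_moment_ge[OF c H]) simp
  also have "\<dots> = color_exp c n (\<lambda>y. r ^ 4 * (\<Sum>e\<in>edges H. edge_kern c e y) ^ 4)"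
    by (simp only: integral_mult_right_zero)
  also have "\<dots> = color_exp c n (\<lambda>y. normalized_mono_edges c H y ^ 4)"
    using normalized_mono_edges_eq[OF c H] by (intro color_exp_cong) (simp only: r_def power_mult_distrib)
  finally show ?thesis unfolding \<epsilon>_def .
qed

section \<open>Copies of the four-cycle\<close>

lemma cycle_graph_4:
  "verts (cycle_graph 4) = {0, 1, 2, 3}"
  "edges (cycle_graph 4) = {{0, 1}, {1, 2}, {2, 3}, {3, 0}}"
proof -
  have *: "i < 4 \<longleftrightarrow> i = 0 \<or> i = 1 \<or> i = 2 \<or> i = 3" for i :: nat by auto
  show "verts (cycle_graph 4) = {0, 1, 2, 3}" by (auto simp: cycle_graph_def)
  show "edges (cycle_graph 4) = {{0, 1}, {1, 2}, {2, 3}, {3, 0}}"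
    unfolding cycle_graph_def snd_conv * by (simp add: ex_disj_distrib conj_disj_distribL conj_disj_distribR Collect_disj_eq) auto
qed

definition c4_graph :: "'a \<times> 'a \<times> 'a \<times> 'a \<Rightarrow> 'a graph" where
  "c4_graph = (\<lambda>(p, q, s, t). ({p, q, s, t}, {{p, q}, {q, s}, {s, t}, {t, p}}))"

lemma c4_graph_isomorphic:
  assumes d: "p \<noteq> q" "q \<noteq> s" "s \<noteq> t" "t \<noteq> p" "p \<noteq> s" "q \<noteq> t"
  shows "graph_isomorphic (c4_graph (p, q, s, t)) (cycle_graph 4)"
proof -
  define f :: "'a \<Rightarrow> nat" where "f = (\<lambda>x. if x = p then 0 else if x = q then 1 else if x = s then 2 else 3)"
  have f: "f p = 0" "f q = 1" "f s = 2" "f t = 3" using d by (auto simp: f_def)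
  have "bij_betw f {p, q, s, t} {0, 1, 2, 3}"
    using d f by (auto simp: bij_betw_def inj_on_def)
  moreover have "{u, v} \<in> {{p, q}, {q, s}, {s, t}, {t, p}} \<longleftrightarrow> {f u, f v} \<in> {{0, 1}, {1, 2}, {2, 3}, {3, 0}}"
    if "u \<in> {p, q, s, t}" "v \<in> {p, q, s, t}" for u v
    using that d d[symmetric] by (elim insertE emptyE) (simp_all add: f doubleton_eq_iff)
  ultimately show ?thesis
    unfolding graph_isomorphic_def cycle_graph_4 c4_graph_def by auto
qed

lemma isomorphic_c4_imp_c4_graph:
  assumes K: "simple_graph K" "graph_isomorphic K (cycle_graph 4)"
  obtains p q s t where "K = c4_graph (p, q, s, t)" "p \<noteq> s" "q \<noteq> t"
proof -
  obtain f where bij: "bij_betw f (verts K) {0, 1, 2, 3::nat}"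
    and ed': "\<forall>u\<in>verts K. \<forall>v\<in>verts K. {u, v} \<in> edges K \<longleftrightarrow> {f u, f v} \<in> {{0, 1}, {1, 2}, {2, 3}, {3, 0}}"
    using K(2) unfolding graph_isomorphic_def cycle_graph_4 by (elim exE conjE)
  note ed = ed'[THEN bspec, THEN bspec]
  have im: "f ` verts K = {0, 1, 2, 3}" using bij by (rule bij_betw_imp_surj_on)
  have ex: "\<exists>x. x \<in> verts K \<and> f x = i" if "i \<in> {0, 1, 2, 3}" for i
    using that unfolding im[symmetric] by (elim imageE) blast
  obtain p where p: "p \<in> verts K" "f p = 0" using ex[of 0] by auto
  obtain q where q: "q \<in> verts K" "f q = 1" using ex[of 1] by auto
  obtain s where s: "s \<in> verts K" "f s = 2" using ex[of 2] by auto
  obtain t where t: "t \<in> verts K" "f t = 3" using ex[of 3] by auto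
  have inj: "x = x'" if "x \<in> verts K" "x' \<in> verts K" "f x = f x'" for x x'
    by (rule inj_onD[OF bij_betw_imp_inj_on[OF bij] that(3,1,2)])
  have V: "verts K = {p, q, s, t}"
  proof
    show "verts K \<subseteq> {p, q, s, t}"
    proof
      fix x assume x: "x \<in> verts K"
      then have "f x \<in> {0, 1, 2, 3}" unfolding im[symmetric] by (rule imageI)
      then show "x \<in> {p, q, s, t}" using inj[OF x p(1)] inj[OF x q(1)] inj[OF x s(1)] inj[OF x t(1)] p(2) q(2) s(2) t(2)
        unfolding insert_iff empty_iff by metis
    qed
  qed (use p q s t in auto)
  have "edges K = {{p, q}, {q, s}, {s, t}, {t, p}}"
  proof
    show "{{p, q}, {q, s}, {s, t}, {t, p}} \<subseteq> edges K"
      using ed[OF p(1) q(1)] ed[OF q(1) s(1)] ed[OF s(1) t(1)] ed[OF t(1) p(1)] p(2) q(2) s(2) t(2) by simp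
    show "edges K \<subseteq> {{p, q}, {q, s}, {s, t}, {t, p}}"
    proof
      fix e assume e: "e \<in> edges K"
      then have "e \<subseteq> verts K" "card e = 2" using K(1) by (auto simp: simple_graph_def)
      then obtain u v where uv: "e = {u, v}" "u \<in> verts K" "v \<in> verts K" by (auto simp: card_2_iff)
      then have "{f u, f v} \<in> {{0, 1}, {1, 2}, {2, 3}, {3, 0}}" using ed[OF uv(2,3)] e by simp
      moreover have "u \<in> {p, q, s, t}" "v \<in> {p, q, s, t}" using uv V by auto
      ultimately show "e \<in> {{p, q}, {q, s}, {s, t}, {t, p}}"
      proof -
        have x: "(f x = 0 \<longrightarrow> x = p) \<and> (f x = 1 \<longrightarrow> x = q) \<and> (f x = 2 \<longrightarrow> x = s) \<and> (f x = 3 \<longrightarrow> x = t)"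
          if "x \<in> {p, q, s, t}" for x using that p(2) q(2) s(2) t(2) by auto
        show ?thesis
          using \<open>{f u, f v} \<in> {{0, 1}, {1, 2}, {2, 3}, {3, 0}}\<close> x[OF \<open>u \<in> {p, q, s, t}\<close>] x[OF \<open>v \<in> {p, q, s, t}\<close>]
          unfolding uv(1) insert_iff empty_iff doubleton_eq_iff by metis
      qed
    qed
  qed
  then have "K = c4_graph (p, q, s, t)" using V by (cases K) (simp add: c4_graph_def)
  moreover have "p \<noteq> s" "q \<noteq> t" using p q s t by auto
  ultimately show ?thesis by (rule that)
qed

lemma c4_subgraphs_eq:
  assumes E: "simple_edges n (edges H)" and V: "verts H = {1..n}"
  shows "{K. subgraph K H \<and> graph_isomorphic K (cycle_graph 4)} = c4_graph ` c4_embeddings (edges H)"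
proof (intro equalityI subsetI)
  fix K assume "K \<in> {K. subgraph K H \<and> graph_isomorphic K (cycle_graph 4)}"
  then have K: "simple_graph K" "edges K \<subseteq> edges H" "graph_isomorphic K (cycle_graph 4)"
    by (auto simp: subgraph_def)
  obtain p q s t where z: "K = c4_graph (p, q, s, t)" "p \<noteq> s" "q \<noteq> t"
    using isomorphic_c4_imp_c4_graph[OF K(1,3)] .
  then have "(p, q, s, t) \<in> c4_embeddings (edges H)"
    using K(2) by (auto simp: c4_embeddings_def c4_graph_def)
  then show "K \<in> c4_graph ` c4_embeddings (edges H)" using z(1) by blast
next
  fix K assume "K \<in> c4_graph ` c4_embeddings (edges H)"
  then obtain z where "K = c4_graph z" "z \<in> c4_embeddings (edges H)" by blast
  then obtain p q s t where z: "K = c4_graph (p, q, s, t)" "(p, q, s, t) \<in> c4_embeddings (edges H)"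
    by (metis prod.exhaust)
  have e: "{p, q} \<in> edges H" "{q, s} \<in> edges H" "{s, t} \<in> edges H" "{t, p} \<in> edges H"
    and d: "p \<noteq> s" "q \<noteq> t"
    using z(2) by (auto simp: c4_embeddings_def)
  note r = e[THEN simple_edges_range[OF E]] and d' = e[THEN simple_edges_neq[OF E]]
  have "subgraph K H" using r e d' V
    by (auto simp: subgraph_def simple_graph_def z(1) c4_graph_def)
  moreover have "graph_isomorphic K (cycle_graph 4)"
    unfolding z(1) by (rule c4_graph_isomorphic[OF d' d])
  ultimately show "K \<in> {K. subgraph K H \<and> graph_isomorphic K (cycle_graph 4)}" by simp
qed

text \<open>
  Labelled and unlabelled four-cycles agree up to a constant factor. The crude factor
  \<open>256 = 4\<^sup>4\<close> counts all quadruples of vertices of a given subgraph.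
\<close>

lemma subgraph_count_c4_bounds:
  assumes E: "simple_edges n (edges H)" and V: "verts H = {1..n}"
  shows "subgraph_count H (cycle_graph 4) \<le> card (c4_embeddings (edges H))"
    "card (c4_embeddings (edges H)) \<le> 256 * subgraph_count H (cycle_graph 4)"
proof -
  let ?C = "c4_embeddings (edges H)"
  have fin: "finite ?C" by (rule finite_c4_embeddings[OF E])
  have cnt: "subgraph_count H (cycle_graph 4) = card (c4_graph ` ?C)"
    unfolding subgraph_count_def c4_subgraphs_eq[OF E V] ..
  show "subgraph_count H (cycle_graph 4) \<le> card ?C" unfolding cnt by (rule card_image_le[OF fin])
  have "card ?C = (\<Sum>K\<in>c4_graph ` ?C. card {z \<in> ?C. c4_graph z = K})"
    using sum.image_gen[OF fin, of "\<lambda>_. 1::nat" c4_graph] by simp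
  also have "\<dots> \<le> (\<Sum>K\<in>c4_graph ` ?C. 256)"
  proof (rule sum_mono)
    fix K assume "K \<in> c4_graph ` ?C"
    then obtain p q s t where K: "K = c4_graph (p, q, s, t)" by (metis imageE prod.exhaust)
    let ?W = "{p, q, s, t}"
    have "{z \<in> ?C. c4_graph z = K} \<subseteq> ?W \<times> ?W \<times> ?W \<times> ?W"
    proof
      fix z assume z: "z \<in> {z \<in> ?C. c4_graph z = K}"
      obtain a b x y where z1: "z = (a, b, x, y)" by (metis prod.exhaust)
      have "{a, b, x, y} = ?W" using z unfolding K z1 c4_graph_def by simp
      then have "a \<in> ?W" "b \<in> ?W" "x \<in> ?W" "y \<in> ?W" by (metis insertI1 insertI2)+
      then show "z \<in> ?W \<times> ?W \<times> ?W \<times> ?W" unfolding z1 by (intro SigmaI)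
    qed
    then have "card {z \<in> ?C. c4_graph z = K} \<le> card (?W \<times> ?W \<times> ?W \<times> ?W)"
      by (rule card_mono[rotated]) (intro finite_cartesian_product finite.intros)
    also have "\<dots> = card ?W * (card ?W * (card ?W * card ?W))" by (simp only: card_cartesian_product)
    also have "\<dots> \<le> 4 * (4 * (4 * 4))"
    proof -
      have "card ?W = length (remdups [p, q, s, t])" by (simp only: length_remdups_card_conv list.set)
      also have "\<dots> \<le> length [p, q, s, t]" by (rule length_remdups_leq)
      finally have "card ?W \<le> 4" by simp
      then show ?thesis by (intro mult_mono) auto
    qed
    finally show "card {z \<in> ?C. c4_graph z = K} \<le> 256" by simp
  qed
  also have "\<dots> = 256 * subgraph_count H (cycle_graph 4)" by (simp add: cnt)
  finally show "card ?C \<le> 256 * subgraph_count H (cycle_graph 4)" .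
qed

section \<open>The limiting normal law\<close>

lemma normal_law_eq_distr:
  assumes "v > 0"
  shows "normal_law 0 v = distr std_normal_distribution borel (\<lambda>x. sqrt v * x)"
proof -
  interpret prob_space std_normal_distribution
    using real_dist_normal_dist by (simp add: real_distribution_def)
  have "distributed std_normal_distribution lborel (\<lambda>x. x) std_normal_density"
    by (simp add: distributed_def distr_id2)
  from normal_density_affine[OF this, of "sqrt v" 0] assms
  have "distributed std_normal_distribution lborel (\<lambda>x. sqrt v * x) (normal_density 0 (sqrt v))" by simp
  then have "distr std_normal_distribution lborel (\<lambda>x. sqrt v * x) = normal_law 0 v"
    by (simp add: distributed_def normal_law_def)
  then show ?thesis by (metis (no_types, lifting) distr_cong sets_lborel)
qed

lemma real_distribution_normal_law: "v > 0 \<Longrightarrow> real_distribution (normal_law 0 v)"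
proof -
  assume v: "v > 0"
  interpret prob_space std_normal_distribution
    using real_dist_normal_dist by (simp add: real_distribution_def)
  show ?thesis unfolding normal_law_eq_distr[OF v] by (rule real_distribution_distr) simp
qed

lemma char_normal_law:
  assumes v: "v > 0"
  shows "char (normal_law 0 v) t = exp (- (t\<^sup>2 * v / 2))"
proof -
  have "char (normal_law 0 v) t = (CLINT x|std_normal_distribution. iexp (t * (sqrt v * x)))"
    unfolding char_def normal_law_eq_distr[OF v] by (subst integral_distr) simp_all
  also have "\<dots> = char std_normal_distribution (t * sqrt v)"
    by (simp add: char_def mult.assoc)
  also have "\<dots> = exp (- (t\<^sup>2 * v / 2))"
    unfolding char_std_normal_distribution using v by (simp add: power_mult_distrib)
  finally show ?thesis .
qed

lemma fourth_moment_normal_law: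
  assumes v: "v > 0"
  shows "integrable (normal_law 0 v) (\<lambda>x. x ^ 4)" "integral\<^sup>L (normal_law 0 v) (\<lambda>x. x ^ 4) = 3 * v\<^sup>2"
proof -
  have hb: "has_bochner_integral lborel (\<lambda>x. normal_density 0 (sqrt v) x * x ^ 4) (3 * v\<^sup>2)"
  proof -
    have "has_bochner_integral lborel (\<lambda>x. normal_density 0 (sqrt v) x * (x - 0) ^ (2 * 2))
        (fact (2 * 2) / ((2 / (sqrt v)\<^sup>2) ^ 2 * fact 2))"
      using v by (intro normal_moment_even) simp
    moreover have "(2::nat) * 2 = 4" by simp
    moreover have "fact 4 / ((2 / (sqrt v)\<^sup>2) ^ 2 * fact 2) = 3 * v\<^sup>2"
      using v by (simp add: power_divide fact_numeral)
    moreover have "0 < sqrt v" using v by simp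
    ultimately show ?thesis by (simp only: diff_0_right)
  qed
  then show "integrable (normal_law 0 v) (\<lambda>x. x ^ 4)"
    unfolding normal_law_def by (subst integrable_density) (auto simp: has_bochner_integral_iff)
  show "integral\<^sup>L (normal_law 0 v) (\<lambda>x. x ^ 4) = 3 * v\<^sup>2"
    using hb unfolding normal_law_def by (subst integral_density) (auto simp: has_bochner_integral_iff)
qed

section \<open>Random graphs\<close>

lemma simple_graphs_on_simple_edges:
  "H \<in> simple_graphs_on {1..n} \<Longrightarrow> simple_edges n (edges H)"
  "H \<in> simple_graphs_on {1..n} \<Longrightarrow> verts H = {1..n}"
  by (auto simp: simple_graphs_on_def simple_graph_def simple_edges_def)

lemma finite_simple_graphs_on: "finite (simple_graphs_on {1..n::nat})"
proof (rule finite_subset)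
  show "simple_graphs_on {1..n} \<subseteq> {{1..n}} \<times> Pow (Pow {1..n})"
  proof
    fix H :: "nat graph" assume "H \<in> simple_graphs_on {1..n}"
    then have "verts H = {1..n}" "edges H \<subseteq> Pow {1..n}"
      by (auto simp: simple_graphs_on_def simple_graph_def)
    then show "H \<in> {{1..n}} \<times> Pow (Pow {1..n})" by (cases H) simp
  qed
qed simp

text \<open>
  The theorem of Fubini for finitely supported distributions.
\<close>

lemma expectation_pair_pmf:
  fixes f :: "'a \<times> 'b \<Rightarrow> 'c::{banach, second_countable_topology}"
  assumes "finite (set_pmf p)" "finite (set_pmf q)"
  shows "measure_pmf.expectation (pair_pmf p q) f
    = measure_pmf.expectation p (\<lambda>x. measure_pmf.expectation q (\<lambda>y. f (x, y)))"
proof -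
  have "measure_pmf.expectation (pair_pmf p q) f
      = (\<Sum>x\<in>set_pmf p. pmf p x *\<^sub>R measure_pmf.expectation (map_pmf (Pair x) q) f)"
    unfolding pair_pmf_def map_pmf_def[symmetric]
    by (subst pmf_expectation_bind) (use assms in auto)
  also have "\<dots> = (\<Sum>x\<in>set_pmf p. pmf p x *\<^sub>R measure_pmf.expectation q (\<lambda>y. f (x, y)))"
    by simp
  also have "\<dots> = measure_pmf.expectation p (\<lambda>x. measure_pmf.expectation q (\<lambda>y. f (x, y)))"
    using assms by (intro integral_measure_pmf[symmetric]) auto
  finally show ?thesis .
qed

locale random_graphs =
  fixes G :: "nat \<Rightarrow> nat graph pmf" and c :: nat
  assumes G: "\<And>n. n \<ge> 1 \<Longrightarrow> set_pmf (G n) \<subseteq> simple_graphs_on {1..n}"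
    and edges_infinity: "tendsto_infinity_in_prob G (\<lambda>H. real (card (edges H)))"
    and c2: "c \<ge> 2"
begin

abbreviation Z :: "nat graph \<Rightarrow> (nat \<Rightarrow> nat) \<Rightarrow> real" where "Z \<equiv> normalized_mono_edges c"

abbreviation \<sigma>2 :: real where "\<sigma>2 \<equiv> 1 - 1 / real c"

abbreviation ratio :: "nat graph \<Rightarrow> real" where
  "ratio H \<equiv> real (subgraph_count H (cycle_graph 4)) / (real (card (edges H)))\<^sup>2"

lemma c1: "c \<ge> 1" using c2 by simp

lemma \<sigma>2_pos: "\<sigma>2 > 0" using c2 by simp

lemma finite_G: "n \<ge> 1 \<Longrightarrow> finite (set_pmf (G n))"
  using G finite_subset finite_simple_graphs_on by metis

lemma integrable_G:
  fixes F :: "nat graph \<Rightarrow> 'b::{banach, second_countable_topology}"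
  shows "n \<ge> 1 \<Longrightarrow> integrable (measure_pmf (G n)) F"
  by (rule integrable_measure_pmf_finite[OF finite_G])

lemma G_simple: "n \<ge> 1 \<Longrightarrow> H \<in> set_pmf (G n) \<Longrightarrow> simple_edges n (edges H)"
  using G simple_graphs_on_simple_edges(1) by blast

lemma G_verts: "n \<ge> 1 \<Longrightarrow> H \<in> set_pmf (G n) \<Longrightarrow> verts H = {1..n}"
  using G simple_graphs_on_simple_edges(2) by blast

lemma real_distribution_law: "real_distribution (normalized_mono_edges_law c G n)"
  unfolding normalized_mono_edges_law_def by (rule prob_space.real_distribution_distr[OF measure_pmf.prob_space_axioms]) simp

lemma integral_law:
  fixes f :: "real \<Rightarrow> 'b::{banach, second_countable_topology}"
  assumes n: "n \<ge> 1" and f: "f \<in> borel_measurable borel"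
  shows "integral\<^sup>L (normalized_mono_edges_law c G n) f
    = measure_pmf.expectation (G n) (\<lambda>H. color_exp c n (\<lambda>y. f (Z H y)))"
  unfolding normalized_mono_edges_law_def
  by (subst integral_distr)
     (use f in \<open>simp_all add: expectation_pair_pmf[OF finite_G[OF n] finite_set_coloring_pmf[OF c1]]\<close>)

lemma G_expectation_mono:
  fixes F :: "nat graph \<Rightarrow> real"
  assumes "n \<ge> 1" "\<And>H. H \<in> set_pmf (G n) \<Longrightarrow> F H \<le> F' H"
  shows "measure_pmf.expectation (G n) F \<le> measure_pmf.expectation (G n) F'"
  by (rule integral_mono_AE) (use assms integrable_G in \<open>auto simp: AE_measure_pmf_iff\<close>)

lemma prob_few_edges: "(\<lambda>n. measure_pmf.prob (G n) {H. real (card (edges H)) \<le> K}) \<longlonglongrightarrow> 0"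
proof -
  have "measure_pmf.prob (G n) {H. real (card (edges H)) \<le> K}
      = 1 - measure_pmf.prob (G n) {H. real (card (edges H)) > K}" for n
    using measure_pmf.prob_compl[of "{H. real (card (edges H)) > K}" "G n"]
    by (simp add: not_less Collect_neg_eq[symmetric] Compl_eq_Diff_UNIV[symmetric])
  moreover have "(\<lambda>n. 1 - measure_pmf.prob (G n) {H. real (card (edges H)) > K}) \<longlonglongrightarrow> 1 - 1"
    using edges_infinity unfolding tendsto_infinity_in_prob_def by (intro tendsto_intros) blast
  ultimately show ?thesis by simp
qed

text \<open>
  The thresholds are chosen so that each of the two summands of \<open>c4_error\<close> is at most
  \<open>\<delta> / 2\<close>: the first because \<open>512 = 2 * 256\<close>, with the factor \<open>256\<close> of
  \<open>subgraph_count_c4_bounds\<close>, the second because the square root of the number of edges is at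
  least \<open>4 / \<delta>\<close>.
\<close>

lemma c4_error_le:
  assumes n: "n \<ge> 1" and H: "H \<in> set_pmf (G n)" and d: "\<delta> > 0"
    and e: "real (card (edges H)) > 16 / \<delta>\<^sup>2" and r: "ratio H \<le> \<delta> / 512"
  shows "card (edges H) > 0" "c4_error (edges H) \<le> \<delta>"
proof -
  let ?e = "real (card (edges H))"
  have pos: "?e > 0" using e d by (smt (verit) divide_pos_pos zero_less_power)
  then show "card (edges H) > 0" by simp
  have "real (card (c4_embeddings (edges H))) \<le> 256 * real (subgraph_count H (cycle_graph 4))"
    using subgraph_count_c4_bounds(2)[OF G_simple[OF n H] G_verts[OF n H]] by linarith
  then have "real (card (c4_embeddings (edges H))) / ?e\<^sup>2 \<le> 256 * real (subgraph_count H (cycle_graph 4)) / ?e\<^sup>2"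
    by (intro divide_right_mono) auto
  also have "\<dots> = 256 * ratio H" by simp
  finally have 1: "real (card (c4_embeddings (edges H))) / ?e\<^sup>2 \<le> \<delta> / 2" using r by linarith
  have "sqrt (16 / \<delta>\<^sup>2) \<le> sqrt ?e" using e by simp
  moreover have "sqrt (16 / \<delta>\<^sup>2) = 4 / \<delta>" using d by (simp add: real_sqrt_divide)
  ultimately have "4 / \<delta> \<le> sqrt ?e" by simp
  then have 2: "2 / sqrt ?e \<le> \<delta> / 2" using d pos by (simp add: field_simps)
  show "c4_error (edges H) \<le> \<delta>" unfolding c4_error_def using 1 2 by linarith
qed

text \<open>
  Condition on the graph. A typical graph satisfies the bound for fixed graphs; on the rest
  two characteristic functions differ by at most \<open>2\<close>.
\<close>

lemma char_law_bound:
  assumes n: "n \<ge> 1" and d: "\<delta> > 0"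
  shows "norm (char (normalized_mono_edges_law c G n) t - exp (- (t\<^sup>2 * \<sigma>2 / 2)))
    \<le> char_const c t * (sqrt \<delta> + \<delta>)
      + 2 * (measure_pmf.prob (G n) {H. real (card (edges H)) \<le> 16 / \<delta>\<^sup>2} + measure_pmf.prob (G n) {H. \<bar>ratio H\<bar> > \<delta> / 512})"
proof -
  let ?\<phi> = "\<lambda>H. color_exp c n (\<lambda>y. iexp (t * Z H y))" and ?\<tau> = "complex_of_real (exp (- (t\<^sup>2 * \<sigma>2 / 2)))"
  let ?A = "{H. real (card (edges H)) \<le> 16 / \<delta>\<^sup>2}" and ?B = "{H. \<bar>ratio H\<bar> > \<delta> / 512}"
  let ?k = "char_const c t * (sqrt \<delta> + \<delta>)"
  have cc: "char_const c t \<ge> 0" unfolding char_const_def by (intro mult_nonneg_nonneg add_nonneg_nonneg) auto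
  have k: "?k \<ge> 0" using cc d by (intro mult_nonneg_nonneg add_nonneg_nonneg) auto
  have pt: "norm (?\<phi> H - ?\<tau>) \<le> ?k + 2 * (indicator ?A H + indicator ?B H)" if H: "H \<in> set_pmf (G n)" for H
  proof (cases "H \<in> ?A \<or> H \<in> ?B")
    case True
    have "norm (?\<phi> H) \<le> color_exp c n (\<lambda>y. 1)" by (rule norm_color_exp_le[OF c1]) simp
    moreover have "color_exp c n (\<lambda>y. 1::real) = 1" by simp
    moreover have "norm ?\<tau> \<le> 1" using \<sigma>2_pos unfolding norm_of_real by simp
    ultimately have "norm (?\<phi> H - ?\<tau>) \<le> 2" using norm_triangle_ineq4[of "?\<phi> H" ?\<tau>] by linarith
    moreover have "(1::real) \<le> indicator ?A H + indicator ?B H" using True by (auto simp: indicator_def)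
    moreover have "x \<le> 2 \<Longrightarrow> 1 \<le> b \<Longrightarrow> 0 \<le> a \<Longrightarrow> x \<le> a + 2 * b" for x a b :: real by linarith
    ultimately show ?thesis using k by blast
  next
    case False
    then have e: "card (edges H) > 0" "c4_error (edges H) \<le> \<delta>"
      using c4_error_le[OF n H d] by auto
    have "norm (?\<phi> H - ?\<tau>) \<le> char_const c t * (sqrt (c4_error (edges H)) + c4_error (edges H))"
      by (rule char_normalized_mono_edges[OF c1 G_simple[OF n H] e(1)])
    also have "\<dots> \<le> ?k" using cc e(2) by (intro mult_left_mono add_mono) auto
    finally show ?thesis by (simp add: indicator_def)
  qed
  have "char (normalized_mono_edges_law c G n) t = measure_pmf.expectation (G n) ?\<phi>"
    unfolding char_def by (rule integral_law[OF n]) simp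
  moreover have "measure_pmf.expectation (G n) (\<lambda>H. ?\<phi> H - ?\<tau>)
      = measure_pmf.expectation (G n) ?\<phi> - measure_pmf.expectation (G n) (\<lambda>_. ?\<tau>)"
    by (rule Bochner_Integration.integral_diff[OF integrable_G[OF n] integrable_G[OF n]])
  moreover have "measure_pmf.expectation (G n) (\<lambda>_. ?\<tau>) = ?\<tau>" by simp
  ultimately have "char (normalized_mono_edges_law c G n) t - ?\<tau> = measure_pmf.expectation (G n) (\<lambda>H. ?\<phi> H - ?\<tau>)"
    by (simp only:)
  then have "norm (char (normalized_mono_edges_law c G n) t - ?\<tau>) \<le> measure_pmf.expectation (G n) (\<lambda>H. norm (?\<phi> H - ?\<tau>))"
    by (simp only: integral_norm_bound)
  also have "\<dots> \<le> measure_pmf.expectation (G n) (\<lambda>H. ?k + 2 * (indicator ?A H + indicator ?B H))"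
    by (rule G_expectation_mono[OF n pt])
  also have "\<dots> = ?k + 2 * (measure_pmf.prob (G n) ?A + measure_pmf.prob (G n) ?B)"
  proof -
    have "measure_pmf.expectation (G n) (\<lambda>H. ?k + 2 * (indicator ?A H + indicator ?B H))
        = measure_pmf.expectation (G n) (\<lambda>_. ?k)
          + 2 * (measure_pmf.expectation (G n) (indicator ?A) + measure_pmf.expectation (G n) (indicator ?B))"
      by (simp only: Bochner_Integration.integral_add[OF integrable_G[OF n] integrable_G[OF n]] integral_mult_right_zero)
    moreover have "measure_pmf.expectation (G n) (\<lambda>_. ?k) = ?k" by simp
    moreover have "measure_pmf.expectation (G n) (indicator X) = measure_pmf.prob (G n) X" for X by simp
    ultimately show ?thesis by (simp only:)
  qed
  finally show ?thesis .
qed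

theorem acf4_imp_weak_conv:
  assumes "ACF4_in_prob G"
  shows "weak_conv_m (normalized_mono_edges_law c G) (normal_law 0 \<sigma>2)"
proof (rule levy_continuity[OF real_distribution_law real_distribution_normal_law[OF \<sigma>2_pos]])
  fix t
  let ?d = "\<lambda>n. norm (char (normalized_mono_edges_law c G n) t - char (normal_law 0 \<sigma>2) t)"
  have "?d \<longlonglongrightarrow> 0"
  proof (rule tendstoI)
    fix \<epsilon> :: real assume \<epsilon>: "\<epsilon> > 0"
    have "((\<lambda>\<delta>. char_const c t * (sqrt \<delta> + \<delta>)) \<longlongrightarrow> char_const c t * (sqrt 0 + 0)) (at_right 0)"
      by (intro tendsto_intros)
    then have "\<forall>\<^sub>F \<delta> in at_right 0. char_const c t * (sqrt \<delta> + \<delta>) < \<epsilon> / 2"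
      using \<epsilon> by (intro order_tendstoD(2)) auto
    then have "\<forall>\<^sub>F \<delta> in at_right (0::real). \<delta> > 0 \<and> char_const c t * (sqrt \<delta> + \<delta>) < \<epsilon> / 2"
      by (intro eventually_conj) (simp_all add: eventually_at_right_less)
    then obtain \<delta> where d: "\<delta> > 0" "char_const c t * (sqrt \<delta> + \<delta>) < \<epsilon> / 2"
      using eventually_happens'[OF trivial_limit_at_right_real] by blast
    let ?a = "\<lambda>n. measure_pmf.prob (G n) {H. real (card (edges H)) \<le> 16 / \<delta>\<^sup>2}"
      and ?b = "\<lambda>n. measure_pmf.prob (G n) {H. \<bar>ratio H\<bar> > \<delta> / 512}"
    have "?b \<longlonglongrightarrow> 0"
    proof -
      have "\<delta> / 512 > 0" using d(1) by simp
      then show ?thesis using assms unfolding ACF4_in_prob_def tendsto_zero_in_prob_def by (elim allE impE)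
    qed
    then have "(\<lambda>n. 2 * (?a n + ?b n)) \<longlonglongrightarrow> 2 * (0 + 0)"
      by (intro tendsto_intros prob_few_edges)
    then have "\<forall>\<^sub>F n in sequentially. 2 * (?a n + ?b n) < \<epsilon> / 2"
      using \<epsilon> by (intro order_tendstoD(2)) auto
    then show "\<forall>\<^sub>F n in sequentially. dist (?d n) 0 < \<epsilon>"
      using eventually_ge_at_top[of 1]
    proof eventually_elim
      case (elim n)
      then show ?case
        using char_law_bound[OF elim(2) d(1), of t] d(2) unfolding char_normal_law[OF \<sigma>2_pos] by simp
    qed
  qed
  then show "(\<lambda>n. char (normalized_mono_edges_law c G n) t) \<longlonglongrightarrow> char (normal_law 0 \<sigma>2) t"
    by (rule LIM_zero_cancel[OF tendsto_norm_zero_cancel])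
qed

end

lemma truncated_fourth_moment_le:
  assumes "v > 0"
  shows "integral\<^sup>L (normal_law 0 v) (\<lambda>x. min (x ^ 4) B) \<le> 3 * v\<^sup>2"
proof -
  interpret real_distribution "normal_law 0 v" by (rule real_distribution_normal_law[OF assms])
  note m = fourth_moment_normal_law[OF assms]
  have "integrable (normal_law 0 v) (\<lambda>x. min (x ^ 4) B)"
    by (intro integrable_min m(1) integrable_const)
  then have "integral\<^sup>L (normal_law 0 v) (\<lambda>x. min (x ^ 4) B) \<le> integral\<^sup>L (normal_law 0 v) (\<lambda>x. x ^ 4)"
    by (intro integral_mono m(1)) auto
  then show ?thesis unfolding m(2) .
qed

text \<open>
  Truncation makes the fourth power a bounded continuous test function. The sixth moment pays
  for the truncation.
\<close>

lemma fourth_power_le_truncated: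
  assumes "L > (0::real)" shows "z ^ 4 \<le> min (z ^ 4) (L ^ 4) + z ^ 6 / L\<^sup>2"
proof (cases "\<bar>z\<bar> \<le> L")
  case True
  then have "\<bar>z\<bar> ^ 4 \<le> L ^ 4" by (intro power_mono) auto
  moreover have "0 \<le> z ^ 6 / L\<^sup>2" by simp
  ultimately show ?thesis by (simp add: power_even_abs)
next
  case False
  then have "L\<^sup>2 \<le> \<bar>z\<bar>\<^sup>2" using assms by (intro power_mono) auto
  then have "z ^ 4 * L\<^sup>2 \<le> z ^ 4 * z\<^sup>2" by (intro mult_left_mono) auto
  also have "z ^ 4 * z\<^sup>2 = z ^ 6" by algebra
  finally have "z ^ 4 \<le> z ^ 6 / L\<^sup>2" using assms by (simp add: pos_le_divide_eq)
  moreover have "0 \<le> min (z ^ 4) (L ^ 4)" using assms by simp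
  ultimately show ?thesis by linarith
qed

context random_graphs begin

lemma fourth_moment_graph_le:
  assumes "n \<ge> 1" "H \<in> set_pmf (G n)" "L > 0"
  shows "color_exp c n (\<lambda>y. Z H y ^ 4) \<le> color_exp c n (\<lambda>y. min (Z H y ^ 4) (L ^ 4)) + (169 * real c) ^ 3 / L\<^sup>2"
proof -
  have "color_exp c n (\<lambda>y. Z H y ^ 4) \<le> color_exp c n (\<lambda>y. min (Z H y ^ 4) (L ^ 4) + Z H y ^ 6 / L\<^sup>2)"
    by (intro color_exp_mono[OF c1] fourth_power_le_truncated assms(3))
  also have "\<dots> = color_exp c n (\<lambda>y. min (Z H y ^ 4) (L ^ 4)) + color_exp c n (\<lambda>y. Z H y ^ 6) / L\<^sup>2"
    by (simp only: color_exp_add[OF c1] integral_divide_zero)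
  also have "\<dots> \<le> color_exp c n (\<lambda>y. min (Z H y ^ 4) (L ^ 4)) + (169 * real c) ^ 3 / L\<^sup>2"
    by (intro add_left_mono divide_right_mono sixth_moment_normalized_mono_edges[OF c1 G_simple[OF assms(1,2)]]) simp
  finally show ?thesis .
qed

text \<open>
  On an edgeless graph both the normalized count and the quotient are \<open>0\<close>, so that the bound
  holds for all graphs.
\<close>

lemma fourth_moment_graph_ge:
  assumes n: "n \<ge> 1" and H: "H \<in> set_pmf (G n)" and K: "K \<ge> 1"
  shows "3 * \<sigma>2\<^sup>2 * (1 - 1 / K) * indicator {H. real (card (edges H)) > K} H + \<sigma>2 / real c * ratio H
    \<le> color_exp c n (\<lambda>y. Z H y ^ 4)"
proof (cases "card (edges H) = 0")
  case True
  then show ?thesis using K by (simp add: indicator_def normalized_mono_edges_def)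
next
  case False
  let ?e = "real (card (edges H))"
  have e: "?e \<ge> 1" using False by simp
  have "3 * \<sigma>2\<^sup>2 * (1 - 1 / K) * indicator {H. real (card (edges H)) > K} H \<le> 3 * \<sigma>2\<^sup>2 * (1 - 1 / ?e)"
  proof (cases "?e > K")
    case True
    then have "1 / ?e \<le> 1 / K" using K by (intro divide_left_mono) auto
    then show ?thesis using True by (auto intro!: mult_left_mono)
  next
    case False
    then show ?thesis using e by (auto intro!: mult_nonneg_nonneg)
  qed
  moreover have "\<sigma>2 / real c * ratio H \<le> \<sigma>2 / real c * (real (card (c4_embeddings (edges H))) / ?e\<^sup>2)"
    using subgraph_count_c4_bounds(1)[OF G_simple[OF n H] G_verts[OF n H]] \<sigma>2_pos
    by (intro mult_left_mono divide_right_mono) auto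
  moreover have "3 * \<sigma>2\<^sup>2 * (1 - 1 / ?e) + \<sigma>2 / real c * (real (card (c4_embeddings (edges H))) / ?e\<^sup>2)
      \<le> color_exp c n (\<lambda>y. Z H y ^ 4)"
    by (rule fourth_moment_normalized_ge[OF c1 G_simple[OF n H]]) (use False in simp)
  ultimately show ?thesis by linarith
qed

lemma expected_ratio_le:
  assumes n: "n \<ge> 1" and L: "L > 0" and K: "K \<ge> 1"
  shows "\<sigma>2 / real c * measure_pmf.expectation (G n) ratio
    \<le> integral\<^sup>L (normalized_mono_edges_law c G n) (\<lambda>x. min (x ^ 4) (L ^ 4)) + (169 * real c) ^ 3 / L\<^sup>2
      - 3 * \<sigma>2\<^sup>2 * (1 - 1 / K) * measure_pmf.prob (G n) {H. real (card (edges H)) > K}"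
proof -
  let ?I = "indicator {H. real (card (edges H)) > K} :: nat graph \<Rightarrow> real"
  let ?m = "\<lambda>H. color_exp c n (\<lambda>y. min (Z H y ^ 4) (L ^ 4))"
  have le: "3 * \<sigma>2\<^sup>2 * (1 - 1 / K) * ?I H + \<sigma>2 / real c * ratio H \<le> ?m H + (169 * real c) ^ 3 / L\<^sup>2"
    if "H \<in> set_pmf (G n)" for H
    using fourth_moment_graph_ge[OF n that K] fourth_moment_graph_le[OF n that L] by (rule order.trans)
  have "measure_pmf.expectation (G n) (\<lambda>H. 3 * \<sigma>2\<^sup>2 * (1 - 1 / K) * ?I H + \<sigma>2 / real c * ratio H)
      \<le> measure_pmf.expectation (G n) (\<lambda>H. ?m H + (169 * real c) ^ 3 / L\<^sup>2)"
    by (rule G_expectation_mono[OF n le])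
  moreover have "measure_pmf.expectation (G n) (\<lambda>H. 3 * \<sigma>2\<^sup>2 * (1 - 1 / K) * ?I H + \<sigma>2 / real c * ratio H)
      = 3 * \<sigma>2\<^sup>2 * (1 - 1 / K) * measure_pmf.expectation (G n) ?I + \<sigma>2 / real c * measure_pmf.expectation (G n) ratio"
    by (simp only: Bochner_Integration.integral_add[OF integrable_G[OF n] integrable_G[OF n]] integral_mult_right_zero)
  moreover have "measure_pmf.expectation (G n) (\<lambda>H. ?m H + (169 * real c) ^ 3 / L\<^sup>2)
      = measure_pmf.expectation (G n) ?m + measure_pmf.expectation (G n) (\<lambda>_. (169 * real c) ^ 3 / L\<^sup>2)"
    by (rule Bochner_Integration.integral_add[OF integrable_G[OF n] integrable_G[OF n]])
  moreover have "measure_pmf.expectation (G n) (\<lambda>_. (169 * real c) ^ 3 / L\<^sup>2) = (169 * real c) ^ 3 / L\<^sup>2" by simp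
  moreover have "measure_pmf.expectation (G n) ?I = measure_pmf.prob (G n) {H. real (card (edges H)) > K}" by simp
  moreover have "integral\<^sup>L (normalized_mono_edges_law c G n) (\<lambda>x. min (x ^ 4) (L ^ 4)) = measure_pmf.expectation (G n) ?m"
    by (rule integral_law[OF n]) simp
  ultimately have "3 * \<sigma>2\<^sup>2 * (1 - 1 / K) * measure_pmf.prob (G n) {H. real (card (edges H)) > K}
      + \<sigma>2 / real c * measure_pmf.expectation (G n) ratio
    \<le> integral\<^sup>L (normalized_mono_edges_law c G n) (\<lambda>x. min (x ^ 4) (L ^ 4)) + (169 * real c) ^ 3 / L\<^sup>2"
    by (simp only:)
  then show ?thesis by (simp only: le_diff_eq add.commute)
qed

text \<open>
  Weak convergence bounds the limit of the truncated fourth moments by \<open>3 \<sigma>2\<^sup>2\<close>, while the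
  Gaussian part of the lower bound already approaches this value. The mean of the quotient is
  squeezed between the two.
\<close>

theorem weak_conv_imp_acf4:
  assumes conv: "weak_conv_m (normalized_mono_edges_law c G) (normal_law 0 \<sigma>2)"
  shows "ACF4_in_prob G"
proof -
  let ?\<kappa> = "\<sigma>2 / real c" and ?C = "(169 * real c) ^ 3" and ?s = "3 * \<sigma>2\<^sup>2"
  have \<kappa>: "?\<kappa> > 0" using \<sigma>2_pos c2 by (intro divide_pos_pos) auto
  have s: "?s > 0" using \<sigma>2_pos by (intro mult_pos_pos zero_less_power) auto
  have C: "?C > 0" using c2 by simp
  have small: "\<forall>\<^sub>F n in sequentially. measure_pmf.expectation (G n) ratio < \<eta>" if "\<eta> > 0" for \<eta>
  proof -
    \<comment> \<open>Four errors of size \<open>\<theta>\<close> occur: truncation at level \<open>L\<close>, few edges (at most \<open>K\<close>), and the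
      two limits in \<open>n\<close>.\<close>
    define \<theta> where "\<theta> = ?\<kappa> * \<eta> / 4"
    have \<theta>: "\<theta> > 0" unfolding \<theta>_def using mult_pos_pos[OF \<kappa> that] by (rule divide_pos_pos) simp
    define L where "L = sqrt (?C / \<theta>)"
    have L: "L > 0" "?C / L\<^sup>2 = \<theta>" unfolding L_def using C \<theta> by (simp_all add: less_imp_le)
    define K where "K = max 1 (?s / \<theta>)"
    have K: "K \<ge> 1" "?s / K \<le> \<theta>"
    proof -
      show "K \<ge> 1" by (simp add: K_def)
      then have "?s \<le> K * \<theta>" using \<theta> unfolding K_def by (simp add: pos_divide_le_eq[symmetric])
      then show "?s / K \<le> \<theta>" using \<open>K \<ge> 1\<close> by (simp add: pos_divide_le_eq mult.commute)
    qed
    let ?A = "\<lambda>n. integral\<^sup>L (normalized_mono_edges_law c G n) (\<lambda>x. min (x ^ 4) (L ^ 4))"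
      and ?N = "integral\<^sup>L (normal_law 0 \<sigma>2) (\<lambda>x. min (x ^ 4) (L ^ 4))"
      and ?p = "\<lambda>n. measure_pmf.prob (G n) {H. real (card (edges H)) > K}"
    have "?A \<longlonglongrightarrow> ?N"
    proof (rule weak_conv_imp_integral_bdd_continuous_conv[OF real_distribution_law real_distribution_normal_law[OF \<sigma>2_pos] conv])
      show "isCont (\<lambda>x. min (x ^ 4) (L ^ 4)) x" for x :: real by (intro continuous_intros)
      show "norm (min (x ^ 4) (L ^ 4)) \<le> L ^ 4" for x :: real using L(1) by simp
    qed
    moreover have "?N < ?s + \<theta>" using truncated_fourth_moment_le[OF \<sigma>2_pos, of "L ^ 4"] \<theta> by linarith
    ultimately have 1: "\<forall>\<^sub>F n in sequentially. ?A n < ?s + \<theta>" by (rule order_tendstoD(2))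
    have "(\<lambda>n. ?s * (1 - 1 / K) * ?p n) \<longlonglongrightarrow> ?s * (1 - 1 / K) * 1"
      using edges_infinity unfolding tendsto_infinity_in_prob_def by (intro tendsto_intros) blast
    moreover have "?s * (1 - 1 / K) * 1 > ?s - 2 * \<theta>"
    proof -
      have "?s * (1 - 1 / K) * 1 = ?s - ?s / K" by (simp add: right_diff_distrib)
      then show ?thesis using K(2) \<theta> by linarith
    qed
    ultimately have 2: "\<forall>\<^sub>F n in sequentially. ?s * (1 - 1 / K) * ?p n > ?s - 2 * \<theta>" by (rule order_tendstoD(1))
    show ?thesis
      using 1 2 eventually_ge_at_top[of 1]
    proof eventually_elim
      case (elim n)
      have "?\<kappa> * measure_pmf.expectation (G n) ratio \<le> ?A n + ?C / L\<^sup>2 - ?s * (1 - 1 / K) * ?p n"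
        by (rule expected_ratio_le[OF elim(3) L(1) K(1)])
      also have "\<dots> < 4 * \<theta>" using elim(1,2) L(2) by linarith
      also have "\<dots> = ?\<kappa> * \<eta>" by (simp add: \<theta>_def)
      finally show ?case using \<kappa> by (rule mult_left_less_imp_less[OF _ less_imp_le])
    qed
  qed
  show ?thesis unfolding ACF4_in_prob_def tendsto_zero_in_prob_def
  proof (intro allI impI)
    fix \<epsilon> :: real assume \<epsilon>: "\<epsilon> > 0"
    let ?q = "\<lambda>n. measure_pmf.prob (G n) {H. \<bar>ratio H\<bar> > \<epsilon>}"
    show "?q \<longlonglongrightarrow> 0"
    proof (rule tendstoI)
      fix \<rho> :: real assume \<rho>: "\<rho> > 0"
      have "\<forall>\<^sub>F n in sequentially. measure_pmf.expectation (G n) ratio < \<rho> * \<epsilon>" using \<rho> \<epsilon> by (intro small) simp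
      then show "\<forall>\<^sub>F n in sequentially. dist (?q n) 0 < \<rho>"
        using eventually_ge_at_top[of 1]
      proof eventually_elim
        case (elim n)
        have "\<epsilon> * ?q n = measure_pmf.expectation (G n) (\<lambda>H. \<epsilon> * indicator {H. \<bar>ratio H\<bar> > \<epsilon>} H)" by simp
        also have "\<dots> \<le> measure_pmf.expectation (G n) ratio"
          by (rule G_expectation_mono[OF elim(2)]) (auto simp: indicator_def)
        also have "\<dots> < \<epsilon> * \<rho>" using elim(1) by (simp add: mult.commute)
        finally have "?q n < \<rho>" using \<epsilon> by (rule mult_left_less_imp_less[OF _ less_imp_le])
        then show ?case by (simp add: dist_real_def)
      qed
    qed
  qed
qed

end

theorem theorem1p3:
  fixes G :: "nat \<Rightarrow> nat graph pmf" and c :: nat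
  assumes "\<And>n. n \<ge> 1 \<Longrightarrow> set_pmf (G n) \<subseteq> simple_graphs_on {1..n}"
    and "tendsto_infinity_in_prob G (\<lambda>H. real (card (edges H)))"
    and "c \<ge> 2"
  shows "weak_conv_m (normalized_mono_edges_law c G) (normal_law 0 (1 - 1 / real c))
     \<longleftrightarrow> ACF4_in_prob G"
proof -
  interpret random_graphs G c by unfold_locales (use assms in auto)
  show ?thesis using acf4_imp_weak_conv weak_conv_imp_acf4 by blast
qed

end
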